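(* Let $n\in\mathbb{Z}_{>0}$, $r\in\mathbb{Z}_{\ge0}$, $x=(x_1,\dots,x_n)$, and $b,q,t$ generic with $|q|<1$. Then the Macdonald polynomial of type $C_n$ with one-row diagram satisfies $$P^{(C_n)}_{(r)}(x|b;q,t)=\frac{(q;q)_r}{(t;q)_r}\sum_{j=0}^{\lfloor r/2\rfloor}G_{r-2j}(x;q,t)\frac{(b/t;q)_j(t^{-n}q^{-r};q)_j}{(q;q)_j(t^{-n+1}q^{-r+1}/b;q)_j}\frac{1-t^{-n}q^{-r+2j}}{1-t^{-n}q^{-r}}\Big(\frac{t^2}{qb}\Big)^j.$$
   Context: Notation: $(a_1,\dots,a_k;q)_n=\prod_{j=1}^k\prod_{i=0}^{n-1}(1-q^ia_j)$. Koornwinder polynomials: for parameters $a,b,c,d,q,t$ (generic, $|q|<1$), put $\alpha=(abcdq^{-1})^{1/2}$ and $$\mathcal{D}_x=\sum_{i=1}^n\frac{(1-ax_i)(1-bx_i)(1-cx_i)(1-dx_i)}{\alpha t^{n-1}(1-x_i^2)(1-qx_i^2)}\prod_{j\ne i}\frac{(1-tx_ix_j)(1-tx_i/x_j)}{(1-x_ix_j)(1-x_i/x_j)}(T_{q,x_i}-1)+\sum_{i=1}^n\frac{(1-a/x_i)(1-b/x_i)(1-c/x_i)(1-d/x_i)}{\alpha t^{n-1}(1-1/x_i^2)(1-q/x_i^2)}\prod_{j\ne i}\frac{(1-tx_j/x_i)(1-t/x_ix_j)}{(1-x_j/x_i)(1-1/x_ix_j)}(T_{q,x_i}^{-1}-1),$$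 where $T_{q,x_i}^{\pm1}$ replaces $x_i$ by $q^{\pm1}x_i$. For a partition $\mu$ of length $\le n$, $P_\mu(x|a,b,c,d|q,t)$ is the unique Laurent polynomial invariant under permutations and inversions of the $x_i$, of the form $m_\mu+{}$(lower terms in dominance order), $m_\mu$ being the orbit sum of $x^\mu$, which is an eigenfunction of $\mathcal{D}_x$. The type $C_n$ Macdonald polynomial is $P^{(C_n)}_\mu(x|b;q,t)=P_\mu(x|-b^{1/2},b^{1/2},-q^{1/2}b^{1/2},q^{1/2}b^{1/2}|q,t)$. Define $G_r(x;q,t)$ by $\prod_{i=1}^n\frac{(tux_i;q)_\infty(tu/x_i;q)_\infty}{(ux_i;q)_\infty(u/x_i;q)_\infty}=\sum_{r\ge0}G_r(x;q,t)u^r$. *)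

theory Defs
  imports
    "HOL-Complex_Analysis.Complex_Analysis"
    "HOL-Combinatorics.Permutations"
    "HOL-Library.Poly_Mapping"
begin

definition qpoch :: "complex \<Rightarrow> complex \<Rightarrow> nat \<Rightarrow> complex" where
  "qpoch a q n = (\<Prod>i<n. 1 - q ^ i * a)"

definition qpoch_inf :: "complex \<Rightarrow> complex \<Rightarrow> complex" where
  "qpoch_inf a q = prodinf (\<lambda>i. 1 - q ^ i * a)"

text \<open>A Laurent polynomial is the finitely supported map sending an exponent vector to its
  coefficient. Exponent vectors are functions on \<open>nat\<close> vanishing outside \<open>{..<n}\<close>.\<close>

type_synonym laurent = "(nat \<Rightarrow> int) \<Rightarrow>\<^sub>0 complex"

definition in_vars :: "nat \<Rightarrow> laurent \<Rightarrow> bool" where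
  "in_vars n p \<longleftrightarrow> (\<forall>e \<in> Poly_Mapping.keys p. \<forall>i\<ge>n. e i = 0)"

definition leval :: "nat \<Rightarrow> laurent \<Rightarrow> (nat \<Rightarrow> complex) \<Rightarrow> complex" where
  "leval n p x = (\<Sum>e \<in> Poly_Mapping.keys p. Poly_Mapping.lookup p e * (\<Prod>i<n. x i powi e i))"

definition weyl_invariant :: "nat \<Rightarrow> laurent \<Rightarrow> bool" where
  "weyl_invariant n p \<longleftrightarrow>
     (\<forall>\<sigma> e. \<sigma> permutes {..<n} \<longrightarrow> Poly_Mapping.lookup p (e \<circ> \<sigma>) = Poly_Mapping.lookup p e) \<and>
     (\<forall>i<n. \<forall>e. Poly_Mapping.lookup p (e(i := - e i)) = Poly_Mapping.lookup p e)"

definition weyl_orbit :: "nat \<Rightarrow> (nat \<Rightarrow> nat) \<Rightarrow> (nat \<Rightarrow> int) set" where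
  "weyl_orbit n \<mu> = {e. \<exists>\<sigma> s. \<sigma> permutes {..<n} \<and> (\<forall>i. s i \<in> {1, -1}) \<and>
                     e = (\<lambda>i. s i * int (\<mu> (\<sigma> i)))}"

definition orbit_sum :: "nat \<Rightarrow> (nat \<Rightarrow> nat) \<Rightarrow> laurent" where
  "orbit_sum n \<mu> = (\<Sum>e \<in> weyl_orbit n \<mu>. Poly_Mapping.single e 1)"

text \<open>The part \<open>\<mu>\<^sub>i\<close> of a partition is \<open>\<mu> (i - 1)\<close>.\<close>

definition is_partition :: "nat \<Rightarrow> (nat \<Rightarrow> nat) \<Rightarrow> bool" where
  "is_partition n \<mu> \<longleftrightarrow> antimono \<mu> \<and> (\<forall>i\<ge>n. \<mu> i = 0)"

text \<open>Dominance order of type \<open>BC\<^sub>n\<close>: the two partitions need not have the same size.\<close>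

definition dominance_less :: "nat \<Rightarrow> (nat \<Rightarrow> nat) \<Rightarrow> (nat \<Rightarrow> nat) \<Rightarrow> bool" where
  "dominance_less n \<nu> \<mu> \<longleftrightarrow> \<nu> \<noteq> \<mu> \<and> (\<forall>k\<le>n. (\<Sum>i<k. \<nu> i) \<le> (\<Sum>i<k. \<mu> i))"

definition one_row :: "nat \<Rightarrow> nat \<Rightarrow> nat" where
  "one_row r = (\<lambda>i. if i = 0 then r else 0)"

definition koornwinder_op ::
  "nat \<Rightarrow> complex \<Rightarrow> complex \<Rightarrow> complex \<Rightarrow> complex \<Rightarrow> complex \<Rightarrow> complex \<Rightarrow>
    ((nat \<Rightarrow> complex) \<Rightarrow> complex) \<Rightarrow> (nat \<Rightarrow> complex) \<Rightarrow> complex" where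
  "koornwinder_op n a b c d q t f x =
    (let \<alpha> = csqrt (a * b * c * d / q) in
     (\<Sum>i<n. (1 - a * x i) * (1 - b * x i) * (1 - c * x i) * (1 - d * x i)
          / (\<alpha> * t ^ (n - 1) * (1 - (x i)\<^sup>2) * (1 - q * (x i)\<^sup>2))
        * (\<Prod>j \<in> {..<n} - {i}. (1 - t * x i * x j) * (1 - t * x i / x j)
            / ((1 - x i * x j) * (1 - x i / x j)))
        * (f (x(i := q * x i)) - f x))
   + (\<Sum>i<n. (1 - a / x i) * (1 - b / x i) * (1 - c / x i) * (1 - d / x i)
          / (\<alpha> * t ^ (n - 1) * (1 - 1 / (x i)\<^sup>2) * (1 - q / (x i)\<^sup>2))
        * (\<Prod>j \<in> {..<n} - {i}. (1 - t * x j / x i) * (1 - t / (x i * x j))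
            / ((1 - x j / x i) * (1 - 1 / (x i * x j))))
        * (f (x(i := x i / q)) - f x)))"

text \<open>The points of the torus at which no denominator of the operator vanishes. They are Zariski
  dense, so an identity of rational functions may be tested on them.\<close>

definition regular_point :: "nat \<Rightarrow> complex \<Rightarrow> (nat \<Rightarrow> complex) \<Rightarrow> bool" where
  "regular_point n q x \<longleftrightarrow>
     (\<forall>i<n. x i \<noteq> 0 \<and> (x i)\<^sup>2 \<noteq> 1 \<and> q * (x i)\<^sup>2 \<noteq> 1 \<and> (x i)\<^sup>2 \<noteq> q) \<and>
     (\<forall>i<n. \<forall>j<n. i \<noteq> j \<longrightarrow> x i \<noteq> x j \<and> x i * x j \<noteq> 1)"

text \<open>In an invariant \<open>P\<close>, the lower terms form a linear combination of orbit sums of smaller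
  partitions exactly when their exponents lie in the orbits of smaller partitions.\<close>

definition is_koornwinder ::
  "nat \<Rightarrow> complex \<Rightarrow> complex \<Rightarrow> complex \<Rightarrow> complex \<Rightarrow> complex \<Rightarrow> complex \<Rightarrow>
    (nat \<Rightarrow> nat) \<Rightarrow> laurent \<Rightarrow> bool" where
  "is_koornwinder n a b c d q t \<mu> P \<longleftrightarrow>
     in_vars n P \<and> weyl_invariant n P \<and>
     (\<forall>e \<in> Poly_Mapping.keys (P - orbit_sum n \<mu>).
        \<exists>\<nu>. is_partition n \<nu> \<and> dominance_less n \<nu> \<mu> \<and> e \<in> weyl_orbit n \<nu>) \<and>
     (\<exists>E. \<forall>x. regular_point n q x \<longrightarrow>
        koornwinder_op n a b c d q t (leval n P) x = E * leval n P x)"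

definition koornwinder ::
  "nat \<Rightarrow> complex \<Rightarrow> complex \<Rightarrow> complex \<Rightarrow> complex \<Rightarrow> complex \<Rightarrow> complex \<Rightarrow>
    (nat \<Rightarrow> nat) \<Rightarrow> laurent" where
  "koornwinder n a b c d q t \<mu> = (THE P. is_koornwinder n a b c d q t \<mu> P)"

text \<open>The choice of the square roots is immaterial: changing a sign permutes the four parameters.\<close>

definition macdonald_C ::
  "nat \<Rightarrow> complex \<Rightarrow> complex \<Rightarrow> complex \<Rightarrow> (nat \<Rightarrow> nat) \<Rightarrow> laurent" where
  "macdonald_C n b q t \<mu> =
     koornwinder n (- csqrt b) (csqrt b) (- (csqrt q * csqrt b)) (csqrt q * csqrt b) q t \<mu>"

definition macdonald_G :: "nat \<Rightarrow> complex \<Rightarrow> complex \<Rightarrow> nat \<Rightarrow> (nat \<Rightarrow> complex) \<Rightarrow> complex" where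
  "macdonald_G n q t r x = fps_nth (fps_expansion
     (\<lambda>u. \<Prod>i<n. qpoch_inf (t * u * x i) q * qpoch_inf (t * u / x i) q
                  / (qpoch_inf (u * x i) q * qpoch_inf (u / x i) q)) 0) r"

text \<open>With the parameters of type \<open>C\<^sub>n\<close> the scalar \<open>\<alpha>\<close> is \<open>b\<close> up to sign, and (up to that sign)
  the operator is triangular on orbit sums with the following diagonal entries.\<close>

definition eigenvalue_C ::
  "nat \<Rightarrow> complex \<Rightarrow> complex \<Rightarrow> complex \<Rightarrow> (nat \<Rightarrow> nat) \<Rightarrow> complex" where
  "eigenvalue_C n b q t \<mu> =
     (\<Sum>i<n. b * t ^ (n - 1 - i) * (q ^ \<mu> i - 1) + (1 / q ^ \<mu> i - 1) / (b * t ^ (n - 1 - i)))"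

text \<open>The parameters avoid finitely many proper hypersurfaces: the denominators of the explicit
  formula do not vanish, and the eigenvalue of \<open>(r)\<close> differs from those of the smaller
  partitions, which is what makes the polynomial indexed by \<open>(r)\<close> unique. As polynomials in
  \<open>b\<close>, \<open>q\<close>, \<open>t\<close> and their inverses, the eigenvalues of different partitions are different.\<close>

definition generic_params :: "nat \<Rightarrow> nat \<Rightarrow> complex \<Rightarrow> complex \<Rightarrow> complex \<Rightarrow> bool" where
  "generic_params n r b q t \<longleftrightarrow>
     b \<noteq> 0 \<and> q \<noteq> 0 \<and> t \<noteq> 0 \<and>
     qpoch t q r \<noteq> 0 \<and>
     t ^ n * q ^ r \<noteq> 1 \<and>
     qpoch (t powi (1 - int n) * q powi (1 - int r) / b) q (r div 2) \<noteq> 0 \<and>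
     (\<forall>\<nu>. is_partition n \<nu> \<and> dominance_less n \<nu> (one_row r) \<longrightarrow>
        eigenvalue_C n b q t \<nu> \<noteq> eigenvalue_C n b q t (one_row r))"

end

theory Submission
  imports Defs
begin

text \<open>Let \<open>\<Pi>(u)\<close> be the generating function of the \<open>G\<^sub>r\<close>. Lagrange interpolation at the nodes
  \<open>x\<^sub>i, 1/x\<^sub>i, 0, u/q, 1/(t u)\<close> expresses \<open>D\<^sub>x \<Pi>\<close> as a combination of \<open>\<Pi>(q u)\<close>, \<open>\<Pi>(u)\<close> and
  \<open>\<Pi>(u/q)\<close>. For the parameters of type \<open>C\<^sub>n\<close> the resulting second-order \<open>q\<close>-difference operator
  in \<open>u\<close> is, up to an additive constant, the square of a first-order operator \<open>S\<close> that shifts \<open>u\<close>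
  by half powers of \<open>q\<close>. The coefficients of the formula define a linear functional on power series
  in \<open>u\<close> which is an eigenvector of the transpose of \<open>S\<close>; this is a two-term recursion solved by
  \<open>q\<close>-shifted factorials. Hence the right-hand side is an eigenfunction of \<open>D\<^sub>x\<close>.

  For uniqueness, let \<open>x\<^sub>1, \<dots>, x\<^sub>n\<close> tend to infinity at very different rates. Only the largest
  exponent of an eigenfunction survives in the limit, and its eigenvalue is the one that genericity
  distinguishes from the eigenvalue of \<open>(r)\<close>.\<close>

section \<open>Lagrange interpolation\<close>

text \<open>Why a square appears: put \<open>\<beta> = b * t ^ (n - 1)\<close>. Multiplied by its
  scalar prefactor, the eigenvalue of (r) is \<beta>^2 (q^r - 1) + q^(-r) - 1, and adding (1 +
  \<beta>)^2 turns it into (\<beta> q^(r/2) + q^(-r/2))^2. The square root of this relation replaces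
  a three-term recursion for the coefficients by a two-term one.

  The interpolation needs many denominators in u to be nonzero, whereas its result is used
  coefficientwise in u. The identity is therefore proved over an arbitrary field and applied with u
  equal to the generator of the field of formal Laurent series, where all conditions on u hold
  automatically. Analysis enters the existence part only through the q-binomial theorem, which
  identifies the infinite products with formal series.

  In the uniqueness part the eigenvalue equation is available only pointwise, at regular points. It
  is tested on the curve x_i = z^(-N_i), z -> 0, where the N_i are powers of a base so large that
  different exponent vectors of size at most r give different powers of z. Then exactly one monomial
  dominates.\<close>

lemma lagrange_leading_coeff:
  fixes p :: "'a::field poly"
  assumes "finite Z" "degree p < card Z"
  shows "(\<Sum>z\<in>Z. poly p z / (\<Prod>w\<in>Z-{z}. z - w)) = coeff p (card Z - 1)"
proof -
  define l where "l z = (\<Prod>w\<in>Z-{z}. [:-w, 1:])" for z :: 'a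
  have deg: "degree (l z) = card Z - 1" and lead: "coeff (l z) (card Z - 1) = 1" if "z \<in> Z" for z
  proof -
    show d: "degree (l z) = card Z - 1"
      unfolding l_def by (subst degree_prod_eq_sum_degree) (use that assms in auto)
    have "lead_coeff (l z) = 1" unfolding l_def by (simp add: lead_coeff_prod)
    then show "coeff (l z) (card Z - 1) = 1" using d by simp
  qed
  have nz: "(\<Prod>w\<in>Z-{z}. z - w) \<noteq> 0" for z using assms(1) by auto
  have l_same: "poly (l z) z = (\<Prod>w\<in>Z-{z}. z - w)" for z
    by (simp add: l_def poly_prod)
  have l_diff: "poly (l z) z' = 0" if "z' \<in> Z" "z \<noteq> z'" for z z'
    using that assms(1) by (auto simp: l_def poly_prod)
  \<comment> \<open>The Lagrange interpolant. Each basis polynomial \<open>l z\<close> is monic of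
    degree \<open>card Z - 1\<close>, so the sum of its weights is its coefficient in that
    degree.\<close>
  define L where "L = (\<Sum>z\<in>Z. smult (poly p z / (\<Prod>w\<in>Z-{z}. z - w)) (l z))"
  have "p = L"
  proof (rule poly_eqI_degree[where A = Z])
    fix z assume z: "z \<in> Z"
    have "poly L z = (\<Sum>w\<in>Z. if w = z then poly p z else 0)"
      unfolding L_def poly_sum by (rule sum.cong) (auto simp: l_diff z l_same nz)
    then show "poly p z = poly L z" using z assms(1) by simp
  next
    have "degree L \<le> card Z - 1" unfolding L_def
      by (rule degree_sum_le) (use assms deg in \<open>auto intro!: order.trans[OF degree_smult_le]\<close>)
    then show "degree L < card Z" using assms by simp
  qed (use assms in auto)
  then have "coeff p (card Z - 1) = coeff L (card Z - 1)" by simp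
  also have "\<dots> = (\<Sum>z\<in>Z. poly p z / (\<Prod>w\<in>Z-{z}. z - w))"
    unfolding L_def coeff_sum coeff_smult by (rule sum.cong) (simp_all only: lead mult_1_right)
  finally show ?thesis by simp
qed

text \<open>As a polynomial in z this is (1 - t z x)(1 - t z / x), invariant under x -> 1/x. For
  general \<open>t\<close> it gives the numerators of the products in D_x, for \<open>t = 1\<close>
  the denominators, with roots x and 1/x.\<close>

definition kern :: "'a::field \<Rightarrow> 'a \<Rightarrow> 'a poly" where
  "kern t x = [:1, - t * (x + 1 / x), t\<^sup>2:]"

lemma poly_kern: "x \<noteq> 0 \<Longrightarrow> poly (kern t x) z = (1 - t * z * x) * (1 - t * z / x)"
  by (simp add: kern_def field_simps power2_eq_square)

lemma kern_1: "x \<noteq> 0 \<Longrightarrow> kern 1 x = [:- x, 1:] * [:- (1 / x), 1:]"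
  by (simp add: kern_def)

text \<open>Modulo 1 - t z^2, the numerator factor is t times the denominator factor. This
  congruence makes the quotients below exist.\<close>

lemma kern_diff: "kern t x - smult t (kern 1 x) = smult (1 - t) [:1, 0, -t:]"
  by (simp add: kern_def algebra_simps power2_eq_square)

text \<open>Multiplies the congruence between \<open>P\<close> and \<open>smult s D\<close> by the
  one for a single factor. The quotient is kept explicit because the old one enters only through
  \<open>kern 1 x * M\<close>, which vanishes at x and 1/x.\<close>

lemma kern_quotient_step:
  assumes "[:1, 0, -t:] * M = P - smult s D"
  shows "[:1, 0, -t:] * (smult (1 - t) P + smult t (kern 1 x * M))
       = kern t x * P - smult (t * s) (kern 1 x * D)"
proof -
  have "[:1, 0, -t:] * (smult (1 - t) P + smult t (kern 1 x * M)) =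
     smult (1 - t) [:1, 0, -t:] * P + smult t (kern 1 x) * ([:1, 0, -t:] * M)"
    by (simp only: smult_add_right distrib_left mult_smult_left mult_smult_right mult.assoc
        mult.left_commute)
  also have "\<dots> = (kern t x - smult t (kern 1 x)) * P + smult t (kern 1 x) * (P - smult s D)"
    by (simp only: assms kern_diff)
  also have "\<dots> = kern t x * P - smult (t * s) (kern 1 x * D)"
    by (simp add: algebra_simps smult_diff_right)
  finally show ?thesis .
qed

lemma kern_quotient_ex:
  assumes "finite I"
  shows "\<exists>M. [:1, 0, -t:] * M =
    (\<Prod>j\<in>I. kern t (x j)) - smult (t ^ card I) (\<Prod>j\<in>I. kern 1 (x j))"
  using assms
proof (induction rule: finite_induct)
  case empty
  show ?case by (rule exI[of _ 0]) simp
next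
  case (insert i I)
  then obtain M where "[:1, 0, -t:] * M =
    (\<Prod>j\<in>I. kern t (x j)) - smult (t ^ card I) (\<Prod>j\<in>I. kern 1 (x j))" by blast
  from kern_quotient_step[OF this, of "x i"] insert show ?case by auto
qed

text \<open>Let i be the last factor adjoined: the term with \<open>kern 1 (x i)\<close> dies at z,
  and what remains is the numerator of the coefficient in D_x. Compared with the full product of the
  \<open>kern t (x j)\<close>, the surplus factor 1 - t z^2 has been divided out.\<close>

lemma kern_quotient_poly:
  assumes "finite I" "i \<in> I" "x i \<noteq> 0" "t \<noteq> 0"
    and M: "[:1, 0, -t:] * M =
      (\<Prod>j\<in>I. kern t (x j)) - smult (t ^ card I) (\<Prod>j\<in>I. kern 1 (x j))"
    and z: "z = x i \<or> z = 1 / x i"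
  shows "poly M z = (1 - t) * (\<Prod>j\<in>I - {i}. poly (kern t (x j)) z)"
proof -
  obtain N where "[:1, 0, -t:] * N = (\<Prod>j\<in>I - {i}. kern t (x j))
      - smult (t ^ card (I - {i})) (\<Prod>j\<in>I - {i}. kern 1 (x j))"
    using kern_quotient_ex[of "I - {i}" t x] assms(1) by auto
  from kern_quotient_step[OF this, of "x i"]
  have "[:1, 0, -t:] * (smult (1 - t) (\<Prod>j\<in>I - {i}. kern t (x j)) + smult t (kern 1 (x i) * N))
      = [:1, 0, -t:] * M"
    unfolding M
    by (simp add: prod.remove[OF assms(1,2)] card.remove[OF assms(1,2)])
  then have "M = smult (1 - t) (\<Prod>j\<in>I - {i}. kern t (x j)) + smult t (kern 1 (x i) * N)"
    using assms(4) by (subst (asm) mult_cancel_left) auto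
  moreover have "poly (kern 1 (x i)) z = 0"
    using z assms(3) by (auto simp: poly_kern)
  ultimately show ?thesis by (simp add: poly_prod)
qed

lemma degree_kern: "t \<noteq> 0 \<Longrightarrow> degree (kern t x) = 2"
  by (simp add: kern_def)

lemma degree_prod_kern: "t \<noteq> 0 \<Longrightarrow> degree (\<Prod>j\<in>I. kern t (x j)) = 2 * card I"
  by (subst degree_prod_eq_sum_degree) (auto simp: degree_kern kern_def)

lemma coeff_prod_kern: "t \<noteq> 0 \<Longrightarrow> coeff (\<Prod>j\<in>I. kern t (x j)) (2 * card I) = t ^ (2 * card I)"
proof -
  assume t: "t \<noteq> 0"
  have "lead_coeff (\<Prod>j\<in>I. kern t (x j)) = (\<Prod>j\<in>I. t\<^sup>2)"
    unfolding lead_coeff_prod using t by (intro prod.cong) (auto simp: kern_def)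
  then show ?thesis using t by (simp add: degree_prod_kern power_mult)
qed

text \<open>Compare top coefficients: each \<open>kern t\<close> contributes t^2, each
  \<open>kern 1\<close> contributes 1, and dividing by 1 - t z^2 lowers the degree by 2 and divides
  the coefficient by -t.\<close>

lemma kern_quotient_degree:
  fixes t :: "'a::field"
  assumes "t \<noteq> 0"
    and M: "[:1, 0, -t:] * M =
      (\<Prod>j\<in>I. kern t (x j)) - smult (t ^ card I) (\<Prod>j\<in>I. kern 1 (x j))"
    and "card I > 0"
  shows "degree M \<le> 2 * card I - 2"
    and "coeff M (2 * card I - 2) = - (t ^ (2 * card I) - t ^ card I) / t"
proof -
  let ?R = "(\<Prod>j\<in>I. kern t (x j)) - smult (t ^ card I) (\<Prod>j\<in>I. kern 1 (x j))"
  have "degree ?R \<le> 2 * card I"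
    by (rule degree_diff_le) (use assms(1) in \<open>auto simp: degree_prod_kern\<close>)
  moreover have "degree ([:1, 0, -t:] * M) = 2 + degree M" if "M \<noteq> 0"
    using that assms(1) by (subst degree_mult_eq) auto
  ultimately show d: "degree M \<le> 2 * card I - 2"
    unfolding M[symmetric] by (cases "M = 0") auto
  obtain m where m: "2 * card I = Suc (Suc m)" using assms(3)
    by (metis Suc_pred add_Suc_right mult_2 add_gr_0)
  have "coeff ?R (2 * card I) = t ^ (2 * card I) - t ^ card I"
    using coeff_prod_kern[OF assms(1), of x I] coeff_prod_kern[of "1::'a" x I] by simp
  moreover have "coeff ([:1, 0, -t:] * M) (2 * card I) = - t * coeff M m"
  proof -
    have "coeff M (Suc (Suc m)) = 0" using d m by (intro coeff_eq_0) simp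
    then show ?thesis by (simp add: m)
  qed
  ultimately have "- t * coeff M m = t ^ (2 * card I) - t ^ card I" using M by metis
  then show "coeff M (2 * card I - 2) = - (t ^ (2 * card I) - t ^ card I) / t"
    using assms(1) m by (simp add: field_simps)
qed

text \<open>The left-hand side is the contribution of the nodes x_i and 1/x_i to the Lagrange sum.
  Here \<open>Rp\<close> and \<open>Rm\<close> play the roles of \<Pi>(q u)/\<Pi>(u) and
  \<Pi>(u/q)/\<Pi>(u); they come from the nodes 1/(t u) and u/q, and the constant comes from the
  node 0 and the top coefficient. \<open>F\<close> lacks the denominator 1 - q z^2 of D_x because
  the shift of \<Pi> in x_i, minus 1, supplies that factor.\<close>

lemma kernel_identity:
  fixes x :: "nat \<Rightarrow> 'a::field" and b q t u :: 'a
  assumes fin: "finite I" and ne: "card I > 0"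
    and x0: "\<And>i. i \<in> I \<Longrightarrow> x i \<noteq> 0" and x1: "\<And>i. i \<in> I \<Longrightarrow> (x i)\<^sup>2 \<noteq> 1"
    and xx: "\<And>i j. i \<in> I \<Longrightarrow> j \<in> I \<Longrightarrow> i \<noteq> j \<Longrightarrow> x i \<noteq> x j \<and> x i * x j \<noteq> 1"
    and nz: "t \<noteq> 0" "q \<noteq> 0" "u \<noteq> 0"
    and u1: "t * u\<^sup>2 \<noteq> 1" "t * u\<^sup>2 \<noteq> q" "t * u\<^sup>2 \<noteq> q\<^sup>2"
    and u2: "\<And>i. i \<in> I \<Longrightarrow> u \<noteq> q * x i \<and> u * x i \<noteq> q \<and> t * u * x i \<noteq> 1 \<and> t * u \<noteq> x i"
  defines "F \<equiv> \<lambda>i z. (1 - b * z\<^sup>2) * (1 - q * b * z\<^sup>2) / (1 - z\<^sup>2)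
      * (\<Prod>j\<in>I - {i}. poly (kern t (x j)) z / poly (kern 1 (x j)) z)
      * (u * (1 - t) / (q * z * (1 - t * u * z) * (1 - u / (q * z))))"
    and "A \<equiv> b\<^sup>2 * t ^ (2 * card I) / t\<^sup>2 * (1 - t\<^sup>2 * u\<^sup>2 / b) * (1 - t\<^sup>2 * u\<^sup>2 / (q * b))
      / ((1 - t * u\<^sup>2) * (1 - t * u\<^sup>2 / q))"
    and "B \<equiv> (1 - b * u\<^sup>2 / q\<^sup>2) * (1 - b * u\<^sup>2 / q) / ((1 - t * u\<^sup>2 / q\<^sup>2) * (1 - t * u\<^sup>2 / q))"
    and "Rp \<equiv> (\<Prod>i\<in>I. (1 - u * x i) * (1 - u / x i) / ((1 - t * u * x i) * (1 - t * u / x i)))"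
    and "Rm \<equiv> (\<Prod>i\<in>I. (1 - t * (u / q) * x i) * (1 - t * (u / q) / x i)
                / ((1 - (u / q) * x i) * (1 - (u / q) / x i)))"
  assumes b0: "b \<noteq> 0"
  shows "(\<Sum>i\<in>I. F i (x i) + F i (1 / x i)) =
    A * (Rp - 1 / t ^ card I) + B * (Rm - t ^ card I) + (t ^ card I - 1) * (1 - b\<^sup>2 * t ^ card I / t\<^sup>2)"
proof -
  define n where "n = card I"
  define P where "P = (\<Prod>j\<in>I. kern t (x j))"
  define D where "D = (\<Prod>j\<in>I. kern 1 (x j))"
  obtain M where M: "[:1, 0, -t:] * M = P - smult (t ^ n) D"
    using kern_quotient_ex[OF fin] unfolding n_def P_def D_def by blast
  \<comment> \<open>The product \<open>P\<close> over 1 - t z^2 has the right values at x_i and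
    1/x_i but extra poles. Subtracting \<open>t ^ n\<close> times \<open>D\<close>, which vanishes
    at these nodes, removes the poles; the terms \<open>t ^ card I\<close> and
    \<open>1 / t ^ card I\<close> subtracted from \<open>Rm\<close> and \<open>Rp\<close> originate
    here.\<close>
  define p where "p = [:1, 0, -b:] * [:1, 0, -(q * b):] * M"
  have poly_p: "poly p z = (1 - b * z\<^sup>2) * (1 - q * b * z\<^sup>2) * poly M z" for z
    by (simp add: p_def power2_eq_square algebra_simps)
  have M_eval: "poly M z = (poly P z - t ^ n * poly D z) / (1 - t * z\<^sup>2)" if "t * z\<^sup>2 \<noteq> 1" for z
  proof -
    have "(1 - t * z\<^sup>2) * poly M z = poly ([:1, 0, -t:] * M) z"
      by (simp add: power2_eq_square algebra_simps)
    also have "\<dots> = poly P z - t ^ n * poly D z" unfolding M by simp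
    finally show ?thesis using that by (simp add: eq_divide_eq mult.commute)
  qed
  have dM: "degree M \<le> 2 * n - 2" and cM: "coeff M (2 * n - 2) = - (t ^ (2 * n) - t ^ n) / t"
    using kern_quotient_degree[OF nz(1) M[unfolded P_def D_def n_def] ne] by (auto simp: n_def)
  \<comment> \<open>These are the zeros of 1 - u/(q z) and 1 - t u z in the last factor of
    \<open>F\<close>. The node 0 turns the leftover factor z - 1/z of \<open>kern 1 (x i)\<close>
    into z^2 - 1.\<close>
  define a1 where "a1 = u / q"
  define a2 where "a2 = 1 / (t * u)"
  define Y where "Y = (\<lambda>i. 1 / x i)"
  define Z where "Z = x ` I \<union> Y ` I \<union> {0, a1, a2}"
  have injx: "inj_on x I" and injY: "inj_on Y I"
    using xx x0 by (auto simp: inj_on_def Y_def)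
  have disj: "x ` I \<inter> Y ` I = {}"
  proof (safe)
    fix i j assume "i \<in> I" "j \<in> I" "x i = Y j"
    then have "x i * x j = 1" using x0 by (simp add: Y_def)
    then show "x i \<in> {}" using xx[of i j] x1[of i] \<open>i \<in> I\<close> \<open>j \<in> I\<close>
      by (cases "i = j") (auto simp: power2_eq_square)
  qed
  have a: "a1 \<noteq> 0" "a2 \<noteq> 0" "a1 \<noteq> a2"
    using nz u1 by (auto simp: a1_def a2_def field_simps power2_eq_square)
  have disj2: "(x ` I \<union> Y ` I) \<inter> {0, a1, a2} = {}"
    using x0 u2 nz by (auto simp: a1_def a2_def Y_def field_simps)
  have D_nz: "poly D z \<noteq> 0" if "z \<notin> x ` I \<union> Y ` I" for z
    unfolding D_def poly_prod using fin that x0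
    by (auto simp: kern_1 Y_def simp del: mult_pCons_left mult_pCons_right)
  have finZ: "finite Z" using fin by (simp add: Z_def)
  have cardZ: "card Z = 2 * n + 3"
    unfolding Z_def using fin disj disj2 a injx injY
    by (simp add: card_Un_disjoint card_image n_def)
  have W: "(\<Prod>w\<in>Z. [:-w, 1:]) = D * ([:0, 1:] * ([:-a1, 1:] * [:-a2, 1:]))"
  proof -
    have "(\<Prod>w\<in>Z. [:-w, 1:]) = (\<Prod>w\<in>x ` I. [:-w, 1:]) * (\<Prod>w\<in>Y ` I. [:-w, 1:]) * (\<Prod>w\<in>{0, a1, a2}. [:-w, 1:])"
      unfolding Z_def using fin disj disj2 by (subst prod.union_disjoint; simp)+
    also have "(\<Prod>w\<in>x ` I. [:-w, 1:]) * (\<Prod>w\<in>Y ` I. [:-w, 1:]) = D"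
      unfolding D_def using injx injY x0
      by (simp add: prod.reindex prod.distrib[symmetric] kern_1 Y_def del: mult_pCons_left mult_pCons_right)
    finally show ?thesis using a by (simp del: mult_pCons_left mult_pCons_right)
  qed
  \<comment> \<open>The product of differences at a node is read off from any factorization of the
    nodal polynomial by cancelling its linear factor.\<close>
  have V: "(\<Prod>w\<in>Z-{z}. z - w) = poly v z"
    if "z \<in> Z" and "D * ([:0, 1:] * ([:-a1, 1:] * [:-a2, 1:])) = [:-z, 1:] * v" for z v
  proof -
    have "[:-z, 1:] * (\<Prod>w\<in>Z-{z}. [:-w, 1:]) = [:-z, 1:] * v"
      using W that prod.remove[OF finZ that(1), of "\<lambda>w. [:-w, 1:]"] by simp
    then have "(\<Prod>w\<in>Z-{z}. [:-w, 1:]) = v" by (subst (asm) mult_cancel_left) auto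
    then show ?thesis by (auto simp: poly_prod)
  qed
  \<comment> \<open>The degree 2n - 2 of \<open>M\<close> plus 4 is exactly
    \<open>card Z - 1\<close>, so the top coefficient does contribute to the Lagrange sum.\<close>
  have degp: "degree p \<le> 2 * n + 2" and cp: "coeff p (2 * n + 2) = q * b\<^sup>2 * coeff M (2 * n - 2)"
  proof -
    define m where "m = 2 * n - 2"
    have m: "2 * n + 2 = Suc (Suc (Suc (Suc m)))" using ne by (simp add: m_def n_def)
    have hi: "coeff M k = 0" if "k > m" for k
      using dM that by (intro coeff_eq_0) (simp add: m_def)
    show "degree p \<le> 2 * n + 2"
      unfolding m p_def by (rule degree_le) (auto simp: coeff_pCons hi split: nat.splits)
    show "coeff p (2 * n + 2) = q * b\<^sup>2 * coeff M (2 * n - 2)"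
      unfolding m m_def[symmetric] p_def by (simp add: hi power2_eq_square)
  qed
  define G where "G z = poly p z / (\<Prod>w\<in>Z-{z}. z - w)" for z
  have G_sum: "(\<Sum>z\<in>Z. G z) = coeff p (2 * n + 2)"
    unfolding G_def using lagrange_leading_coeff[OF finZ, of p] degp cardZ by simp
  have G_split: "(\<Sum>z\<in>Z. G z) = (\<Sum>i\<in>I. G (x i)) + (\<Sum>i\<in>I. G (Y i)) + (G 0 + (G a1 + G a2))"
    unfolding Z_def using fin disj disj2 a injx injY
    by (simp add: sum.union_disjoint sum.reindex)
  have Gx: "G z = q * t * F i z" if "i \<in> I" "z = x i \<or> z = 1 / x i" for i z
  proof -
    define z' where "z' = 1 / z"
    have z0: "z \<noteq> 0" using that x0 by auto
    have "z\<^sup>2 \<noteq> 1" using that x1[of i] by (auto simp: field_simps)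
    have zz: "kern 1 (x i) = [:-z, 1:] * [:-(1/z), 1:]"
      using that x0[of i] by (auto simp: kern_def)
    have zZ: "z \<in> Z" using that by (auto simp: Z_def Y_def)
    have Dz: "D = [:-z, 1:] * [:-(1/z), 1:] * (\<Prod>j\<in>I-{i}. kern 1 (x j))"
      unfolding D_def prod.remove[OF fin that(1)] zz ..
    have "(\<Prod>w\<in>Z-{z}. z - w) = poly ([:-(1/z), 1:] * (\<Prod>j\<in>I-{i}. kern 1 (x j)) * ([:0, 1:] * ([:-a1, 1:] * [:-a2, 1:]))) z"
      by (rule V[OF zZ]) (simp only: Dz mult.assoc)
    also have "\<dots> = (z - 1 / z) * (\<Prod>j\<in>I-{i}. poly (kern 1 (x j)) z) * (z * ((z - a1) * (z - a2)))"
      by (simp add: poly_prod del: mult_pCons_left mult_pCons_right)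
    finally have "G z = (1 - b * z\<^sup>2) * (1 - q * b * z\<^sup>2) * ((1 - t) * (\<Prod>j\<in>I - {i}. poly (kern t (x j)) z))
       / ((z - 1 / z) * (\<Prod>j\<in>I-{i}. poly (kern 1 (x j)) z) * (z * ((z - a1) * (z - a2))))"
      unfolding G_def poly_p
      using kern_quotient_poly[where z=z, OF fin that(1) x0[OF that(1)] nz(1) M[unfolded P_def D_def n_def]] that by simp
    also have "\<dots> = (1 - b * z\<^sup>2) * (1 - q * b * z\<^sup>2)
       * (\<Prod>j\<in>I - {i}. poly (kern t (x j)) z / poly (kern 1 (x j)) z)
       * ((1 - t) / ((z - 1 / z) * (z * ((z - a1) * (z - a2)))))"
      unfolding prod_dividef times_divide_eq_right times_divide_eq_left divide_divide_eq_left
      by (simp only: mult_ac)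
    also have "(1 - t) / ((z - 1 / z) * (z * ((z - a1) * (z - a2)))) =
       q * t / (1 - z\<^sup>2) * (u * (1 - t) / (q * z * (1 - t * u * z) * (1 - u / (q * z))))"
    proof -
      have "z * q \<noteq> u \<and> t * u * z \<noteq> 1"
        using that(2)
      proof
        assume z: "z = 1 / x i"
        show ?thesis unfolding z using u2[OF that(1)] x0[OF that(1)] by (auto simp: field_simps)
      qed (use u2[OF that(1)] in \<open>auto simp: field_simps\<close>)
      then have "z * q \<noteq> u" "t * u * z \<noteq> 1" by auto
      have d: "(z - 1 / z) * (z * ((z - a1) * (z - a2))) = (1 - z\<^sup>2) * ((z * q - u) * (1 - t * u * z)) / (q * t * u)"
        using z0 nz by (simp add: a1_def a2_def field_simps power2_eq_square)
      have d2: "1 - u / (q * z) = (z * q - u) / (q * z)"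
        using z0 nz by (simp add: field_simps)
      define X1 X2 X3 where "X1 = 1 - z\<^sup>2" and "X2 = z * q - u" and "X3 = 1 - t * u * z"
      have "X1 \<noteq> 0" "X2 \<noteq> 0" "X3 \<noteq> 0"
        using \<open>z\<^sup>2 \<noteq> 1\<close> \<open>z * q \<noteq> u\<close> \<open>t * u * z \<noteq> 1\<close> by (auto simp: X1_def X2_def X3_def)
      then show ?thesis unfolding d d2 X1_def[symmetric] X2_def[symmetric] X3_def[symmetric]
        using z0 nz by (simp add: divide_simps)
    qed
    also have "(1 - b * z\<^sup>2) * (1 - q * b * z\<^sup>2)
       * (\<Prod>j\<in>I - {i}. poly (kern t (x j)) z / poly (kern 1 (x j)) z)
       * (q * t / (1 - z\<^sup>2) * (u * (1 - t) / (q * z * (1 - t * u * z) * (1 - u / (q * z))))) = q * t * F i z"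
      unfolding F_def times_divide_eq_right times_divide_eq_left divide_divide_eq_left
      by (simp only: mult_ac)
    finally show ?thesis .
  qed
  have G0: "G 0 = q * t * (1 - t ^ n)"
  proof -
    have "(\<Prod>w\<in>Z-{0}. 0 - w) = poly (D * ([:-a1, 1:] * [:-a2, 1:])) 0"
      by (rule V) (simp_all add: Z_def)
    moreover have "poly D 0 = 1" "poly P 0 = 1"
      by (simp_all add: D_def P_def poly_prod kern_def)
    ultimately show ?thesis using nz by (simp add: G_def poly_p M_eval a1_def a2_def)
  qed
  have Ga1: "G a1 = - q * t * B * (Rm - t ^ n)"
  proof -
    have "(\<Prod>w\<in>Z-{a1}. a1 - w) = poly (D * ([:0, 1:] * [:-a2, 1:])) a1"
      by (rule V) (simp_all add: Z_def mult_ac del: mult_pCons_left mult_pCons_right)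
    then have V1: "(\<Prod>w\<in>Z-{a1}. a1 - w) = poly D a1 * (a1 * (a1 - a2))"
      by (simp del: mult_pCons_left mult_pCons_right)
    have D0: "poly D a1 \<noteq> 0"
      by (rule D_nz) (use disj2 in auto)
    have PD: "poly P a1 = Rm * poly D a1"
    proof -
      have "Rm = poly P a1 / poly D a1"
        unfolding Rm_def P_def D_def poly_prod prod_dividef[symmetric]
        by (rule prod.cong) (use x0 in \<open>auto simp: poly_kern a1_def\<close>)
      then show ?thesis using D0 by simp
    qed
    have t1: "t * a1\<^sup>2 \<noteq> 1" and t2: "1 - t * u\<^sup>2 / q \<noteq> 0"
      using u1 nz by (auto simp: a1_def field_simps)
    have e: "a1 * (a1 - a2) = - (1 - t * u\<^sup>2 / q) / (q * t)"
      using nz by (simp add: a1_def a2_def field_simps power2_eq_square)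
    have "G a1 = (1 - b * a1\<^sup>2) * (1 - q * b * a1\<^sup>2) * ((Rm - t ^ n) * poly D a1 / (1 - t * a1\<^sup>2))
       / (poly D a1 * (- (1 - t * u\<^sup>2 / q) / (q * t)))"
      unfolding G_def poly_p V1 M_eval[OF t1] PD e by (simp add: algebra_simps)
    also have "\<dots> = - q * t * ((1 - b * a1\<^sup>2) * (1 - q * b * a1\<^sup>2) / ((1 - t * a1\<^sup>2) * (1 - t * u\<^sup>2 / q))) * (Rm - t ^ n)"
      using D0 t1 t2 nz by (simp add: divide_simps)
    also have "(1 - b * a1\<^sup>2) * (1 - q * b * a1\<^sup>2) / ((1 - t * a1\<^sup>2) * (1 - t * u\<^sup>2 / q)) = B"
      using nz by (simp add: B_def a1_def power_divide power2_eq_square)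
    finally show ?thesis .
  qed
  have Ga2: "G a2 = - q * t * A * (Rp - 1 / t ^ n)"
  proof -
    have "(\<Prod>w\<in>Z-{a2}. a2 - w) = poly (D * ([:0, 1:] * [:-a1, 1:])) a2"
      by (rule V) (simp_all add: Z_def mult_ac del: mult_pCons_left mult_pCons_right)
    then have V1: "(\<Prod>w\<in>Z-{a2}. a2 - w) = poly D a2 * (a2 * (a2 - a1))"
      by (simp del: mult_pCons_left mult_pCons_right)
    have D0: "poly D a2 \<noteq> 0"
      by (rule D_nz) (use disj2 in auto)
    \<comment> \<open>At z = 1/(t u) the factors 1 - t z x_i become 1 - x_i/u and the factors 1 - z
      x_i become 1 - x_i/(t u); clearing the powers of u and t leaves one t^2 for each i.\<close>
    have PD: "poly P a2 = t ^ (2 * n) * Rp * poly D a2"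
    proof -
      have "t ^ (2 * n) * Rp = (\<Prod>i\<in>I. t\<^sup>2 * ((1 - u * x i) * (1 - u / x i) / ((1 - t * u * x i) * (1 - t * u / x i))))"
        unfolding Rp_def n_def power_mult prod.distrib[of "\<lambda>_. t\<^sup>2"] prod_constant ..
      also have "\<dots> = (\<Prod>i\<in>I. poly (kern t (x i)) a2 / poly (kern 1 (x i)) a2)"
      proof (rule prod.cong)
        fix i assume i: "i \<in> I"
        have "poly (kern t (x i)) a2 = (1 - u * x i) * (1 - u / x i) / u\<^sup>2"
          using x0[OF i] nz by (simp add: poly_kern a2_def field_simps power2_eq_square)
        moreover have "poly (kern 1 (x i)) a2 = (1 - t * u * x i) * (1 - t * u / x i) / (t\<^sup>2 * u\<^sup>2)"
          using x0[OF i] nz by (simp add: poly_kern a2_def field_simps power2_eq_square)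
        ultimately show "t\<^sup>2 * ((1 - u * x i) * (1 - u / x i) / ((1 - t * u * x i) * (1 - t * u / x i)))
           = poly (kern t (x i)) a2 / poly (kern 1 (x i)) a2" using nz by simp
      qed simp
      also have "\<dots> = poly P a2 / poly D a2" by (simp add: P_def D_def poly_prod prod_dividef)
      finally show ?thesis using D0 by simp
    qed
    have t1: "t * a2\<^sup>2 \<noteq> 1" and t2: "1 - t * u\<^sup>2 / q \<noteq> 0" and t3: "1 - t * u\<^sup>2 \<noteq> 0"
      using u1 nz by (auto simp: a2_def field_simps power2_eq_square)
    have e: "a2 * (a2 - a1) = (1 - t * u\<^sup>2 / q) / (t\<^sup>2 * u\<^sup>2)"
      using nz by (simp add: a1_def a2_def field_simps power2_eq_square)
    have e2: "1 - t * a2\<^sup>2 = - (1 - t * u\<^sup>2) / (t * u\<^sup>2)"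
      using nz by (simp add: a2_def field_simps power2_eq_square)
    have e3: "(1 - b * a2\<^sup>2) * (1 - q * b * a2\<^sup>2) =
        q * b\<^sup>2 * (1 - t\<^sup>2 * u\<^sup>2 / b) * (1 - t\<^sup>2 * u\<^sup>2 / (q * b)) / (t ^ 4 * u ^ 4)"
      using nz b0 by (simp add: a2_def field_simps power2_eq_square power4_eq_xxxx)
    have e4: "t ^ (2 * n) * Rp * poly D a2 - t ^ n * poly D a2 = t ^ (2 * n) * (Rp - 1 / t ^ n) * poly D a2"
      unfolding mult_2 power_add using nz by (simp add: field_simps)
    show ?thesis
      unfolding G_def poly_p V1 M_eval[OF t1] PD e e2 e3 e4 A_def n_def[symmetric]
      using D0 t2 t3 nz by (simp add: divide_simps power2_eq_square power4_eq_xxxx)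
        (simp add: algebra_simps)
  qed
  have "(\<Sum>i\<in>I. G (x i)) + (\<Sum>i\<in>I. G (Y i)) = q * t * (\<Sum>i\<in>I. F i (x i) + F i (1 / x i))"
    by (simp add: Gx Y_def sum.distrib sum_distrib_left distrib_left)
  then have "q * t * (\<Sum>i\<in>I. F i (x i) + F i (1 / x i)) + q * t * (1 - t ^ n)
      - q * t * B * (Rm - t ^ n) - q * t * A * (Rp - 1 / t ^ n)
      = q * b\<^sup>2 * (- (t ^ (2 * n) - t ^ n) / t)"
    using G_sum G_split unfolding G0 Ga1 Ga2 cp cM by (simp add: algebra_simps)
  also have "q * b\<^sup>2 * (- (t ^ (2 * n) - t ^ n) / t) = q * t * (- (t ^ n - 1) * (b\<^sup>2 * t ^ n / t\<^sup>2))"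
    unfolding mult_2 power_add using nz by (simp add: field_simps power2_eq_square)
  finally have eq: "q * t * (\<Sum>i\<in>I. F i (x i) + F i (1 / x i)) + q * t * (1 - t ^ n)
      - q * t * B * (Rm - t ^ n) - q * t * A * (Rp - 1 / t ^ n)
      = q * t * (- (t ^ n - 1) * (b\<^sup>2 * t ^ n / t\<^sup>2))" .
  have cancel: "X = A' + B' + (T - 1) * (1 - K)"
    if "q * t * X + q * t * (1 - T) - q * t * B' - q * t * A' = q * t * (- (T - 1) * K)" for X A' B' T K
  proof -
    have "q * t * X = q * t * (A' + B' + (T - 1) * (1 - K))"
      using that by (simp add: algebra_simps)
    then show ?thesis using nz by simp
  qed
  show ?thesis unfolding n_def[symmetric] by (rule cancel) (use eq in \<open>simp only: mult.assoc\<close>)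
qed

section \<open>Infinite products and the q-binomial theorem\<close>

lemma qpoch_Suc: "qpoch a q (Suc n) = qpoch a q n * (1 - q ^ n * a)"
  by (simp add: qpoch_def)

lemma qpoch_0 [simp]: "qpoch a q 0 = 1"
  by (simp add: qpoch_def)

lemma power_neq_1_of_norm_less_1:
  fixes q :: complex
  assumes "norm q < 1" "n > 0"
  shows "q ^ n \<noteq> 1"
proof
  assume "q ^ n = 1"
  then have "norm q ^ n = 1" by (metis norm_power norm_one)
  moreover have "norm q ^ n < 1"
    using assms by (simp add: power_less_one_iff)
  ultimately show False by simp
qed

lemma qpoch_q_nonzero: "norm q < 1 \<Longrightarrow> qpoch q q n \<noteq> 0"
  unfolding qpoch_def power_Suc2[symmetric]
  by (auto dest: power_neq_1_of_norm_less_1[of q "Suc i" for i])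

lemma convergent_qpoch_inf:
  fixes q z :: complex
  assumes "norm q < 1"
  shows "convergent_prod (\<lambda>n. 1 - q ^ n * z)"
proof (rule abs_convergent_prod_imp_convergent_prod, rule summable_imp_abs_convergent_prod)
  show "summable (\<lambda>n. norm (1 - q ^ n * z - 1))"
    using assms by (auto simp: norm_mult norm_power intro!: summable_mult2 summable_geometric)
qed

lemma qpoch_inf_holomorphic:
  assumes "norm q < 1"
  shows "(\<lambda>z. qpoch_inf z q) holomorphic_on A"
proof (rule holomorphic_on_subset)
  show "(\<lambda>z. qpoch_inf z q) holomorphic_on UNIV"
  proof (rule holomorphic_uniform_sequence)
    fix z :: complex
    define R where "R = norm z + 1"
    define P where "P = (\<lambda>N z. \<Prod>n<N. 1 - q ^ n * z)"
    have "uniformly_convergent_on (cball 0 R) P"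
      unfolding P_def
    proof (rule uniformly_convergent_on_prod')
      show "uniformly_convergent_on (cball 0 R) (\<lambda>N z. \<Sum>n<N. norm (1 - q ^ n * z - 1))"
      proof (rule Weierstrass_m_test')
        show "norm (norm (1 - q ^ n * w - 1)) \<le> norm q ^ n * R" if "w \<in> cball 0 R" for n w
          using that by (auto simp: norm_mult norm_power intro!: mult_left_mono)
        show "summable (\<lambda>n. norm q ^ n * R)"
          using assms by (intro summable_mult2 summable_geometric) auto
      qed
    qed (auto intro!: continuous_intros)
    then obtain g where g: "uniform_limit (cball 0 R) P g at_top"
      by (auto simp: uniformly_convergent_on_def)
    also have "?this \<longleftrightarrow> uniform_limit (cball 0 R) P (\<lambda>z. qpoch_inf z q) at_top"
    proof (intro uniform_limit_cong)
      fix w :: complex assume "w \<in> cball 0 R"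
      with g have "(\<lambda>n. P (Suc n) w) \<longlonglongrightarrow> g w"
        by (metis tendsto_uniform_limitI filterlim_sequentially_Suc)
      moreover have "(\<lambda>n. P (Suc n) w) \<longlonglongrightarrow> qpoch_inf w q"
        using convergent_prod_LIMSEQ[OF convergent_qpoch_inf[OF assms, of w]] unfolding P_def lessThan_Suc_atMost
        by (simp add: qpoch_inf_def)
      ultimately show "g w = qpoch_inf w q" using tendsto_unique by force
    qed auto
    finally have "uniform_limit (cball 0 R) P (\<lambda>z. qpoch_inf z q) at_top" .
    then have "uniform_limit (cball z 1) P (\<lambda>z. qpoch_inf z q) at_top"
      by (rule uniform_limit_on_subset) (simp add: cball_subset_cball_iff R_def)
    then show "\<exists>d>0. cball z d \<subseteq> UNIV \<and> uniform_limit (cball z d) P (\<lambda>z. qpoch_inf z q) at_top"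
      by (intro exI[of _ 1]) auto
    show "P n holomorphic_on UNIV" for n unfolding P_def by (intro holomorphic_intros)
  qed auto
qed auto

lemma qpoch_inf_0 [simp]: "qpoch_inf 0 q = 1"
  by (simp add: qpoch_inf_def)

lemma qpoch_inf_step:
  assumes "norm q < 1"
  shows "qpoch_inf z q = (1 - z) * qpoch_inf (q * z) q"
proof -
  define P where "P = (\<lambda>z N. \<Prod>n<N. 1 - q ^ n * z)"
  have lim: "P z \<longlonglongrightarrow> qpoch_inf z q" for z
    using convergent_prod_LIMSEQ[OF convergent_qpoch_inf[OF assms, of z]]
    by (simp add: P_def qpoch_inf_def lessThan_Suc_atMost[symmetric] LIMSEQ_lessThan_iff_atMost[of "\<lambda>A. \<Prod>n\<in>A. 1 - q ^ n * z"])
  have "P z (Suc n) = (1 - z) * P (q * z) n" for n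
    unfolding P_def prod.lessThan_Suc_shift by (simp add: mult_ac)
  then have "(\<lambda>n. (1 - z) * P (q * z) n) \<longlonglongrightarrow> qpoch_inf z q"
    using lim[of z] by (simp only: filterlim_sequentially_Suc[of "P z", symmetric])
  moreover have "(\<lambda>n. (1 - z) * P (q * z) n) \<longlonglongrightarrow> (1 - z) * qpoch_inf (q * z) q"
    by (intro tendsto_intros lim)
  ultimately show ?thesis using LIMSEQ_unique by blast
qed

lemma fps_nth_linear_mult:
  "fps_nth ((1 - fps_const c * fps_X) * F) (Suc k) = fps_nth F (Suc k) - c * fps_nth F k"
  "fps_nth ((1 - fps_const c * fps_X) * F) 0 = fps_nth F 0"
  for c :: "'a::comm_ring_1"
  by (simp_all add: left_diff_distrib mult.assoc)

text \<open>The series of the q-binomial theorem: the expansion in u of (t c u; q)_inf / (c u;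
  q)_inf.\<close>

definition qbin_fps :: "complex \<Rightarrow> complex \<Rightarrow> complex \<Rightarrow> complex fps" where
  "qbin_fps q t c = Abs_fps (\<lambda>k. qpoch t q k / qpoch q q k * c ^ k)"

lemma qbin_fps_nth_0 [simp]: "fps_nth (qbin_fps q t c) 0 = 1"
  by (simp add: qbin_fps_def)

text \<open>The hypothesis is (1 - c u) F(u) = (1 - t c u) F(q u). Coefficientwise it is a two-term
  recursion that can be solved because q^(k+1) is never 1.\<close>

lemma qbin_fps_eqI:
  assumes q: "norm q < 1" and F0: "fps_nth F 0 = 1"
    and F: "(1 - fps_const c * fps_X) * F
      = (1 - fps_const (t * c) * fps_X) * Abs_fps (\<lambda>k. q ^ k * fps_nth F k)"
  shows "F = qbin_fps q t c"
proof (rule fps_ext)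
  fix k show "fps_nth F k = fps_nth (qbin_fps q t c) k"
  proof (induction k)
    case (Suc k)
    have "fps_nth ((1 - fps_const c * fps_X) * F) (Suc k) =
      fps_nth ((1 - fps_const (t * c) * fps_X) * Abs_fps (\<lambda>k. q ^ k * fps_nth F k)) (Suc k)"
      by (simp only: F)
    then have "fps_nth F (Suc k) * (1 - q ^ Suc k) = fps_nth F k * c * (1 - q ^ k * t)"
      unfolding fps_nth_linear_mult by (simp add: algebra_simps)
    moreover have "1 - q ^ Suc k \<noteq> 0"
      using power_neq_1_of_norm_less_1[OF q, of "Suc k"] by simp
    ultimately have "fps_nth F (Suc k) = fps_nth F k * c * (1 - q ^ k * t) / (1 - q ^ Suc k)"
      by (simp add: eq_divide_eq)
    then show ?case unfolding Suc
      by (simp add: qbin_fps_def qpoch_Suc mult_ac)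
  qed (simp add: F0)
qed

text \<open>The same functional equation with the dilation of u moved into \<open>c\<close>. In this
  form it describes how a factor of \<Pi> reacts to x_i -> q x_i.\<close>

lemma qbin_fps_step:
  assumes q: "norm q < 1"
  shows "(1 - fps_const c * fps_X) * qbin_fps q t c =
    (1 - fps_const (t * c) * fps_X) * qbin_fps q t (q * c)"
proof (rule fps_ext)
  fix k
  show "fps_nth ((1 - fps_const c * fps_X) * qbin_fps q t c) k =
    fps_nth ((1 - fps_const (t * c) * fps_X) * qbin_fps q t (q * c)) k"
  proof (cases k)
    case (Suc m)
    have "1 - q ^ Suc m \<noteq> 0" "qpoch q q m \<noteq> 0"
      using power_neq_1_of_norm_less_1[OF q, of "Suc m"] qpoch_q_nonzero[OF q] by auto
    then show ?thesis unfolding Suc fps_nth_linear_mult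
      by (simp add: qbin_fps_def qpoch_Suc algebra_simps power_mult_distrib divide_simps)
  qed (simp add: qbin_fps_def)
qed

text \<open>Removing the first factor from both infinite products gives a first-order q-difference
  equation for their quotient; with the value 1 at 0 it determines the expansion.\<close>

lemma qbinomial_has_fps_expansion:
  assumes q: "norm q < 1"
  shows "(\<lambda>u. qpoch_inf (t * u * c) q / qpoch_inf (u * c) q) has_fps_expansion qbin_fps q t c"
proof -
  define f where "f = (\<lambda>u. qpoch_inf (t * u * c) q / qpoch_inf (u * c) q)"
  have an: "(\<lambda>z. qpoch_inf z q) analytic_on A" for A
    using qpoch_inf_holomorphic[OF q, of UNIV] analytic_on_holomorphic by blast
  have an2: "(\<lambda>u. qpoch_inf (a * u) q) analytic_on A" for A and a
    using analytic_on_compose[of "\<lambda>u. a * u" A "\<lambda>z. qpoch_inf z q"] an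
    by (auto simp: o_def intro!: analytic_intros)
  have "f analytic_on {0}"
    unfolding f_def using an2[of "t * c" "{0}"] an2[of c "{0}"]
    by (intro analytic_on_divide) (auto simp: mult_ac)
  then have F: "f has_fps_expansion fps_expansion f 0"
    by (rule analytic_at_imp_has_fps_expansion_0)
  define F where "F = fps_expansion f 0"
  have F: "f has_fps_expansion F" using F by (simp add: F_def)
  have Fq: "(\<lambda>u. f (q * u)) has_fps_expansion Abs_fps (\<lambda>k. q ^ k * fps_nth F k)"
  proof -
    have "(f \<circ> (\<lambda>u. q * u)) has_fps_expansion fps_compose F (fps_const q * fps_X)"
      by (intro fps_expansion_intros F) auto
    moreover have "fps_compose F (fps_const q * fps_X) = Abs_fps (\<lambda>k. q ^ k * fps_nth F k)"
      by (simp add: fps_compose_linear)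
    ultimately show ?thesis by (simp add: o_def)
  qed
  have fstep: "(1 - c * u) * f u = (1 - t * c * u) * f (q * u)" if "qpoch_inf (u * c) q \<noteq> 0" for u
  proof -
    have "qpoch_inf (u * c) q = (1 - u * c) * qpoch_inf (q * u * c) q"
      "qpoch_inf (t * u * c) q = (1 - t * u * c) * qpoch_inf (t * (q * u) * c) q"
      using qpoch_inf_step[OF q, of "u * c"] qpoch_inf_step[OF q, of "t * u * c"] by (simp_all add: mult_ac)
    then show ?thesis using that by (simp add: f_def mult_ac)
  qed
  \<comment> \<open>The functional equation is needed only near 0, where the denominator is close to
    its value 1 at 0.\<close>
  have "eventually (\<lambda>u. qpoch_inf (u * c) q \<noteq> 0) (nhds 0)"
  proof -
    have "isCont (\<lambda>u. qpoch_inf (c * u) q) 0"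
      using an2[of c "{0}"] analytic_at_imp_isCont by blast
    then have "((\<lambda>u. qpoch_inf (c * u) q) \<longlongrightarrow> 1) (at 0)"
      by (simp add: isCont_def)
    then have "eventually (\<lambda>u. qpoch_inf (c * u) q \<noteq> 0) (at 0)"
      by (rule tendsto_imp_eventually_ne) simp
    then show ?thesis by (simp add: eventually_nhds_conv_at mult.commute)
  qed
  then have ev: "eventually (\<lambda>u. (1 - c * u) * f u = (1 - t * c * u) * f (q * u)) (nhds 0)"
    by eventually_elim (rule fstep)
  have "(\<lambda>u. (1 - c * u) * f u) has_fps_expansion (1 - fps_const c * fps_X) * F"
    by (intro fps_expansion_intros F)
  moreover have "(\<lambda>u. (1 - t * c * u) * f (q * u)) has_fps_expansion
      (1 - fps_const (t * c) * fps_X) * Abs_fps (\<lambda>k. q ^ k * fps_nth F k)"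
    by (intro fps_expansion_intros Fq)
  ultimately have "(1 - fps_const c * fps_X) * F =
      (1 - fps_const (t * c) * fps_X) * Abs_fps (\<lambda>k. q ^ k * fps_nth F k)"
    using has_fps_expansion_cong[OF ev refl] fps_expansion_unique_complex by blast
  moreover have "fps_nth F 0 = 1"
    using has_fps_expansion_imp_0_eq_fps_nth_0[OF F] by (simp add: f_def)
  ultimately have "F = qbin_fps q t c" by (intro qbin_fps_eqI[OF q])
  then show ?thesis using F by (simp add: f_def)
qed

text \<open>\<Pi>(u) as a formal series in u only; the x_i stay numbers, so that D_x can evaluate it
  at shifted points.\<close>

definition kernel_fps :: "nat \<Rightarrow> complex \<Rightarrow> complex \<Rightarrow> (nat \<Rightarrow> complex) \<Rightarrow> complex fps" where
  "kernel_fps n q t x = (\<Prod>i<n. qbin_fps q t (x i) * qbin_fps q t (1 / x i))"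

lemma macdonald_G_eq_nth:
  assumes q: "norm q < 1"
  shows "macdonald_G n q t r x = fps_nth (kernel_fps n q t x) r"
proof -
  have "(\<lambda>u. \<Prod>i<n. (qpoch_inf (t * u * x i) q / qpoch_inf (u * x i) q) *
      (qpoch_inf (t * u * (1 / x i)) q / qpoch_inf (u * (1 / x i)) q)) has_fps_expansion kernel_fps n q t x"
    unfolding kernel_fps_def
    by (intro fps_expansion_intros qbinomial_has_fps_expansion[OF q])
  then show ?thesis
    unfolding macdonald_G_def by (simp add: fps_expansion_eqI)
qed

section \<open>The half shift and its eigenfunctionals\<close>

text \<open>Since \<open>c\<close> is a difference of \<open>Y\<close>, Abel summation turns the sum
  of \<open>c j * g j\<close> into one of \<open>Y j * (g j - \<kappa> * g (Suc j))\<close>, where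
  the relation between \<open>g\<close> and \<open>f\<close> applies. Collecting by
  \<open>f j\<close> gives the transposed recursion, solved with eigenvalue \<open>ev\<close>; the
  terms at \<open>Suc J\<close> are the boundary.\<close>

lemma functional_summation_by_parts:
  fixes c :: "nat \<Rightarrow> 'a::idom"
  assumes "c 0 = Y 0" and "\<And>j. j < J \<Longrightarrow> c (Suc j) = Y (Suc j) - \<kappa> * Y j"
    and "e 0 = ev" and "\<And>j. j < J \<Longrightarrow> Y (Suc j) * e (Suc j) - \<phi> j * Y j = ev * c (Suc j)"
    and g: "\<And>j. j \<le> J \<Longrightarrow> g j - \<kappa> * g (Suc j) = e j * f j - \<phi> j * f (Suc j)"
  shows "(\<Sum>j\<le>J. c j * g j) - \<kappa> * Y J * g (Suc J) = ev * (\<Sum>j\<le>J. c j * f j) - \<phi> J * Y J * f (Suc J)"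
  using assms
proof (induction J)
  case 0
  have "Y 0 * (g 0 - \<kappa> * g (Suc 0)) = Y 0 * (e 0 * f 0 - \<phi> 0 * f (Suc 0))" using 0(5)[of 0] by simp
  then show ?case using 0(1,3) by (simp add: algebra_simps)
next
  case (Suc J)
  have IH: "(\<Sum>j\<le>J. c j * g j) = \<kappa> * Y J * g (Suc J) + (ev * (\<Sum>j\<le>J. c j * f j) - \<phi> J * Y J * f (Suc J))"
  proof -
    have "(\<Sum>j\<le>J. c j * g j) - \<kappa> * Y J * g (Suc J) = ev * (\<Sum>j\<le>J. c j * f j) - \<phi> J * Y J * f (Suc J)"
      by (rule Suc.IH[OF Suc.prems(1,2,3,4,5)]) simp_all
    then show ?thesis by (simp add: algebra_simps)
  qed
  have "Y (Suc J) * (g (Suc J) - \<kappa> * g (Suc (Suc J)))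
      = Y (Suc J) * (e (Suc J) * f (Suc J) - \<phi> (Suc J) * f (Suc (Suc J)))"
    using Suc.prems(5)[of "Suc J"] by simp
  moreover have "(Y (Suc J) * e (Suc J) - \<phi> J * Y J) * f (Suc J) = ev * c (Suc J) * f (Suc J)"
    using Suc.prems(4)[of J] by simp
  moreover have "c (Suc J) * g (Suc J) = (Y (Suc J) - \<kappa> * Y J) * g (Suc J)"
    using Suc.prems(2)[of J] by simp
  ultimately show ?case unfolding sum.atMost_Suc IH by algebra
qed

definition fps_dil :: "complex \<Rightarrow> complex fps \<Rightarrow> complex fps" where
  "fps_dil p f = Abs_fps (\<lambda>m. p ^ m * fps_nth f m)"

lemma fps_nth_dil [simp]: "fps_nth (fps_dil p f) m = p ^ m * fps_nth f m"
  by (simp add: fps_dil_def)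

lemma fps_dil_compose: "fps_dil p f = fps_compose f (fps_const p * fps_X)"
  by (simp add: fps_dil_def fps_compose_linear)

lemma fps_dil_mult: "fps_dil p (f * g) = fps_dil p f * fps_dil p g"
  by (simp add: fps_dil_compose fps_compose_mult_distrib)

lemma fps_dil_prod: "fps_dil p (\<Prod>i\<in>I. f i) = (\<Prod>i\<in>I. fps_dil p (f i))"
  by (simp add: fps_dil_compose fps_compose_prod_distrib)

lemma fps_dil_add: "fps_dil p (f + g) = fps_dil p f + fps_dil p g"
  by (simp add: fps_eq_iff algebra_simps)

lemma fps_dil_dil: "fps_dil p (fps_dil p' f) = fps_dil (p * p') f"
  by (simp add: fps_eq_iff power_mult_distrib mult_ac)

lemma fps_dil_1 [simp]: "fps_dil 1 f = f"
  by (simp add: fps_eq_iff)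

lemma fps_dil_quadratic:
  "fps_dil p (1 - fps_const c * fps_X\<^sup>2) = 1 - fps_const (c * p\<^sup>2) * fps_X\<^sup>2"
proof (rule fps_ext)
  fix k show "fps_nth (fps_dil p (1 - fps_const c * fps_X\<^sup>2)) k = fps_nth (1 - fps_const (c * p\<^sup>2) * fps_X\<^sup>2) k"
    by (cases "k = 2") auto
qed

lemma fps_dil_const_mult: "fps_dil p (fps_const c * f) = fps_const c * fps_dil p f"
  by (simp add: fps_eq_iff)

lemma fps_dil_qbin: "fps_dil p (qbin_fps q t c) = qbin_fps q t (p * c)"
  by (simp add: fps_eq_iff qbin_fps_def power_mult_distrib)

text \<open>The operator S of the overview, used with \<open>p\<^sup>2 = q\<close>. Its denominator
  has constant term 1, so S maps power series to power series. The factors in u^2 are chosen so that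
  S applied twice reproduces the coefficients \<open>A\<close> and \<open>B\<close> of
  \<open>kernel_identity\<close>.\<close>

definition half_shift :: "complex \<Rightarrow> complex \<Rightarrow> complex \<Rightarrow> complex \<Rightarrow> complex \<Rightarrow> complex fps \<Rightarrow> complex fps" where
  "half_shift \<beta> b t q p f = inverse (1 - fps_const (t / q) * fps_X\<^sup>2) *
     (fps_const \<beta> * ((1 - fps_const (t\<^sup>2 / (b * q)) * fps_X\<^sup>2) * fps_dil p f)
      + (1 - fps_const (b / q) * fps_X\<^sup>2) * fps_dil (1 / p) f)"

lemma half_shift_mult:
  "(1 - fps_const (t / q) * fps_X\<^sup>2) * half_shift \<beta> b t q p f =
     fps_const \<beta> * ((1 - fps_const (t\<^sup>2 / (b * q)) * fps_X\<^sup>2) * fps_dil p f)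
      + (1 - fps_const (b / q) * fps_X\<^sup>2) * fps_dil (1 / p) f"
proof -
  have "(1 - fps_const (t / q) * fps_X\<^sup>2) * inverse (1 - fps_const (t / q) * fps_X\<^sup>2) = 1"
    by (subst mult.commute, rule inverse_mult_eq_1) simp
  then show ?thesis unfolding half_shift_def mult.assoc[symmetric] by simp
qed

lemma fps_nth_quadratic_mult:
  "fps_nth ((1 - fps_const c * fps_X\<^sup>2) * F) k = fps_nth F k - (if k < 2 then 0 else c * fps_nth F (k - 2))"
  for c :: complex
  by (simp add: left_diff_distrib mult.assoc fps_X_power_mult_nth)

text \<open>Only u^2 occurs in the factors of S, so coefficients are linked in steps of 2; hence the
  indices r - 2j of the formula.\<close>

lemma half_shift_nth:
  fixes \<beta> b t q p f
  defines "g \<equiv> half_shift \<beta> b t q p f"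
  shows "fps_nth g k - (if k < 2 then 0 else t / q * fps_nth g (k - 2)) =
    (\<beta> * p ^ k + 1 / p ^ k) * fps_nth f k
    - (if k < 2 then 0 else (\<beta> * t\<^sup>2 / (b * q) * p ^ (k - 2) + b / q / p ^ (k - 2)) * fps_nth f (k - 2))"
proof -
  have "fps_nth ((1 - fps_const (t / q) * fps_X\<^sup>2) * g) k = \<beta> * fps_nth ((1 - fps_const (t\<^sup>2 / (b * q)) * fps_X\<^sup>2) * fps_dil p f) k
      + fps_nth ((1 - fps_const (b / q) * fps_X\<^sup>2) * fps_dil (1 / p) f) k"
    unfolding g_def half_shift_mult by simp
  then show ?thesis unfolding fps_nth_quadratic_mult
    by (simp add: algebra_simps power_divide add_divide_distrib diff_divide_distrib split: if_splits)
qed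

lemma qpoch_Suc_shift: "qpoch a q (Suc n) = (1 - a) * qpoch (a * q) q n"
  unfolding qpoch_def prod.lessThan_Suc_shift by (simp add: mult_ac)

text \<open>Shifting the numerator parameters by \<open>q\<close> turns the very-well-poised coefficients into
  differences \<open>Y (Suc j) - t / q * Y j\<close>, which is the form compatible with the denominator
  \<open>1 - t u\<^sup>2 / q\<close> of the half shift.\<close>

lemma functional_eigen:
  fixes b t q s w \<beta> :: complex and r :: nat
  assumes nz: "b \<noteq> 0" "t \<noteq> 0" "q \<noteq> 0" "p \<noteq> 0" and p: "p\<^sup>2 = q" and q1: "norm q < 1"
    and s: "\<beta> * t * q ^ r * s = b" and s1: "s \<noteq> 1"
    and den: "qpoch (s * t * q / b) q (r div 2) \<noteq> 0"
  defines "c \<equiv> \<lambda>j. qpoch (b / t) q j * qpoch s q j / (qpoch q q j * qpoch (s * t * q / b) q j) *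
      ((1 - s * q ^ (2 * j)) / (1 - s)) * (t\<^sup>2 / (q * b)) ^ j"
  shows "(\<Sum>j\<le>r div 2. c j * fps_nth (half_shift \<beta> b t q p f) (r - 2 * j)) =
    (\<beta> * p ^ r + 1 / p ^ r) * (\<Sum>j\<le>r div 2. c j * fps_nth f (r - 2 * j))"
proof -
  define J where "J = r div 2"
  define w where "w = p ^ r"
  define ev where "ev = \<beta> * p ^ r + 1 / p ^ r"
  define Y where "Y j = qpoch (b / t * q) q j * qpoch (s * q) q j / (qpoch q q j * qpoch (s * t * q / b) q j) *
      (t\<^sup>2 / (q * b)) ^ j" for j
  \<comment> \<open>\<open>e\<close> and \<open>\<phi>\<close> are the two coefficients in
    \<open>half_shift_nth\<close> at the index r - 2j, written with p^(r - 2j) = w / q^j.\<close>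
  define e where "e j = \<beta> * w / q ^ j + q ^ j / w" for j
  define \<phi> where "\<phi> j = \<beta> * t\<^sup>2 / (b * q) * (w / q ^ Suc j) + b / q * (q ^ Suc j / w)" for j
  \<comment> \<open>The value 0 for 2j > r stands for the absent coefficients of negative index. It
    absorbs the case distinction \<open>k < 2\<close> and kills the boundary terms at
    \<open>Suc J\<close>.\<close>
  define G where "G j = (if 2 * j \<le> r then fps_nth (half_shift \<beta> b t q p f) (r - 2 * j) else 0)" for j
  define F where "F j = (if 2 * j \<le> r then fps_nth f (r - 2 * j) else 0)" for j
  have w0: "w \<noteq> 0" and ww: "w * w = q ^ r"
    using nz p by (auto simp: w_def power_mult_distrib[symmetric] power2_eq_square)
  have s0: "s \<noteq> 0" using s nz by auto
  \<comment> \<open>Here the condition on \<open>s\<close> enters. Eliminating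
    \<open>\<beta>\<close> in this way is what lets \<open>e (Suc j) - ev\<close> and
    \<open>\<phi> j - t / q * ev\<close> split into linear factors.\<close>
  have bw: "\<beta> * w = b / (t * s * w)"
  proof -
    have "\<beta> * t * (w * w) * s = b" using s ww by simp
    then show ?thesis using nz s0 w0 by (simp add: field_simps)
  qed
  have pw: "p ^ (r - 2 * j) = w / q ^ j" if "2 * j \<le> r" for j
    using that nz p by (simp add: w_def power_diff power_mult)
  have den0: "1 - s * t * q ^ Suc j / b \<noteq> 0" if "j < J" for j
    using den that unfolding qpoch_def J_def by (auto simp: mult_ac)
  have q0: "1 - q ^ Suc j \<noteq> 0" for j
    using power_neq_1_of_norm_less_1[OF q1, of "Suc j"] by simp
  have Y_Suc: "Y (Suc j) = Y j * ((1 - b * q ^ Suc j / t) * (1 - s * q ^ Suc j) * (t\<^sup>2 / (q * b))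
      / ((1 - q ^ Suc j) * (1 - s * t * q ^ Suc j / b)))" for j
    by (simp add: Y_def qpoch_Suc mult_ac)
  have c_Suc: "c (Suc j) = Y j * ((1 - b / t) * (1 - s * (q ^ Suc j)\<^sup>2) * (t\<^sup>2 / (q * b))
      / ((1 - q ^ Suc j) * (1 - s * t * q ^ Suc j / b)))" for j
  proof -
    have "q ^ (2 * Suc j) = (q ^ Suc j)\<^sup>2" by (simp only: power_mult[symmetric] mult.commute)
    then show ?thesis
      unfolding c_def Y_def qpoch_Suc_shift[of "b / t"] qpoch_Suc_shift[of s] qpoch_Suc[of q] qpoch_Suc[of "s * t * q / b"]
      using s1 by (simp add: mult_ac)
  qed
  have c_diff: "c (Suc j) = Y (Suc j) - t / q * Y j" if "j < J" for j
  proof -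
    define Q where "Q = q ^ Suc j"
    define d where "d = (1 - Q) * (1 - s * t * Q / b)"
    have d: "d \<noteq> 0" using q0 den0[OF that] by (auto simp: d_def Q_def)
    \<comment> \<open>This three-term identity in Q is the telescoping: after division by
      \<open>d\<close> its three terms are the ratios to \<open>Y j\<close> of
      \<open>c (Suc j)\<close>, \<open>Y (Suc j)\<close> and \<open>t / q * Y j\<close>, up to the
      common factor \<open>t\<^sup>2 / (q * b)\<close>.\<close>
    have num: "(1 - b / t) * (1 - s * Q\<^sup>2) = (1 - b * Q / t) * (1 - s * Q) - b / t * d"
      unfolding d_def using nz by (simp add: field_simps power2_eq_square)
    have quot: "t / q = b / t * (t\<^sup>2 / (q * b))"
      using nz by (simp add: power2_eq_square)
    have "(X - K * d) * R / d = X * R / d - K * R" for X K R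
      using d by (simp add: field_simps)
    then have "(1 - b / t) * (1 - s * Q\<^sup>2) * (t\<^sup>2 / (q * b)) / ((1 - Q) * (1 - s * t * Q / b))
      = (1 - b * Q / t) * (1 - s * Q) * (t\<^sup>2 / (q * b)) / ((1 - Q) * (1 - s * t * Q / b)) - t / q"
      unfolding num quot d_def[symmetric] .
    then show ?thesis unfolding c_Suc Y_Suc Q_def[symmetric] by (simp add: right_diff_distrib)
  qed
  have rec: "Y (Suc j) * e (Suc j) - \<phi> j * Y j = ev * c (Suc j)" if "j < J" for j
  proof -
    define Q where "Q = q ^ Suc j"
    have Q: "Q \<noteq> 0" "1 - Q \<noteq> 0" "1 - s * t * Q / b \<noteq> 0" using nz q0 den0[OF that] by (auto simp: Q_def)
    \<comment> \<open>With \<open>c_diff\<close> inserted, the recursion reads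
      \<open>Y (Suc j) * (e (Suc j) - ev) = Y j * (\<phi> j - t / q * ev)\<close>. Both differences
      factor, and the quotient of the factorizations is the ratio of consecutive
      \<open>Y\<close>.\<close>
    have el: "e (Suc j) - ev = (1 - Q) * (1 - s * t * Q / b) * b / (t * s * Q * w)"
    proof -
      have "e (Suc j) - ev = b / (t * s * w) / Q + Q / w - (b / (t * s * w) + 1 / w)"
        unfolding e_def ev_def Q_def[symmetric] w_def[symmetric] bw ..
      also have "\<dots> = (1 - Q) * (1 - s * t * Q / b) * b / (t * s * Q * w)"
        using nz s0 w0 Q(1) by (simp add: field_simps)
      finally show ?thesis .
    qed
    have pl: "\<phi> j - t / q * ev = (1 - b * Q / t) * (1 - s * Q) * t / (q * s * Q * w)"
    proof -
      have "\<phi> j - t / q * ev = t\<^sup>2 / (b * q) * (\<beta> * w) / Q + b / q * (Q / w) - t / q * (\<beta> * w + 1 / w)"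
        unfolding \<phi>_def ev_def Q_def[symmetric] w_def[symmetric] by simp
      also have "\<dots> = (1 - b * Q / t) * (1 - s * Q) * t / (q * s * Q * w)"
        unfolding bw using nz s0 w0 Q(1) by (simp add: field_simps power2_eq_square)
      finally show ?thesis .
    qed
    have "Y (Suc j) * (e (Suc j) - ev) = Y j * (\<phi> j - t / q * ev)"
    proof -
      define d1 d2 where "d1 = 1 - Q" and "d2 = 1 - s * t * Q / b"
      have "d1 \<noteq> 0" "d2 \<noteq> 0" using Q by (simp_all only: d1_def d2_def not_False_eq_True)
      then show ?thesis
        unfolding Y_Suc Q_def[symmetric] el pl d1_def[symmetric] d2_def[symmetric]
        using Q(1) nz s0 w0 by (simp add: power2_eq_square mult.assoc)
    qed
    then show ?thesis unfolding c_diff[OF that] by (simp add: algebra_simps)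
  qed
  have "(\<Sum>j\<le>J. c j * G j) - t / q * Y J * G (Suc J) = ev * (\<Sum>j\<le>J. c j * F j) - \<phi> J * Y J * F (Suc J)"
  proof (rule functional_summation_by_parts[where e = e])
    show "c 0 = Y 0" using s1 by (simp add: c_def Y_def)
    show "e 0 = ev" by (simp add: e_def ev_def w_def)
    fix j assume "j \<le> J"
    then have j: "2 * j \<le> r" by (simp add: J_def)
    have a: "r - 2 * Suc j = r - 2 * j - 2" "(r - 2 * j < 2) = (\<not> 2 * Suc j \<le> r)" by auto
    show "G j - t / q * G (Suc j) = e j * F j - \<phi> j * F (Suc j)"
      using half_shift_nth[of \<beta> b t q p f "r - 2 * j"] j pw[OF j] pw[of "Suc j"]
      unfolding G_def F_def e_def \<phi>_def a by (auto split: if_splits)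
  qed (use c_diff rec in auto)
  moreover have "G (Suc J) = 0" "F (Suc J) = 0" by (auto simp: G_def F_def J_def)
  moreover have "(\<Sum>j\<le>J. c j * G j) = (\<Sum>j\<le>J. c j * fps_nth (half_shift \<beta> b t q p f) (r - 2 * j))"
    by (rule sum.cong) (auto simp: G_def J_def)
  moreover have "(\<Sum>j\<le>J. c j * F j) = (\<Sum>j\<le>J. c j * fps_nth f (r - 2 * j))"
    by (rule sum.cong) (auto simp: F_def J_def)
  ultimately show ?thesis by (simp add: J_def ev_def)
qed

section \<open>The square of the half shift\<close>

text \<open>The coefficient of the unshifted series: on the left from S applied twice, on the right
  from \<open>kernel_identity\<close>, with V = u^2/q^2. The constant
  \<open>(1 + b * \<tau>)\<^sup>2\<close> is forced by comparing both sides at V = 0.\<close>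

lemma middle_coefficient:
  fixes b t q \<tau> V :: "'a::field"
  assumes "t \<noteq> 0" "1 - t * q * V \<noteq> 0" "1 - t * q\<^sup>2 * V \<noteq> 0" "1 - t * V \<noteq> 0"
  shows "\<tau> * (b - t\<^sup>2 * q * V) * (1 - b * q\<^sup>2 * V) / ((1 - t * q * V) * (1 - t * q\<^sup>2 * V))
     + (1 - b * q * V) * (\<tau> * (b - t\<^sup>2 * V)) / ((1 - t * q * V) * (1 - t * V)) - (1 + b * \<tau>)\<^sup>2
   = - (\<tau> * (b - t\<^sup>2 * q\<^sup>2 * V) * (b - t\<^sup>2 * q * V) / (t * ((1 - t * q\<^sup>2 * V) * (1 - t * q * V))))
     - t * \<tau> * (1 - b * V) * (1 - b * q * V) / ((1 - t * V) * (1 - t * q * V))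
     + (t * \<tau> - 1) * (1 - b\<^sup>2 * \<tau> / t)"
proof -
  define d0 d1 d2 where d: "d0 = 1 - t * q * V" "d1 = 1 - t * q\<^sup>2 * V" "d2 = 1 - t * V"
  have d_nz: "d0 \<noteq> 0" "d1 \<noteq> 0" "d2 \<noteq> 0" using assms by (auto simp: d)
  have key: "t * (\<tau> * (b - t\<^sup>2 * q * V) * (1 - b * q\<^sup>2 * V) * d2
      + (1 - b * q * V) * (\<tau> * (b - t\<^sup>2 * V)) * d1 - (1 + b * \<tau>)\<^sup>2 * (d0 * d1 * d2))
    = - (\<tau> * (b - t\<^sup>2 * q\<^sup>2 * V) * (b - t\<^sup>2 * q * V)) * d2
     - t * (t * \<tau> * (1 - b * V) * (1 - b * q * V)) * d1
     + (t * \<tau> - 1) * (t - b\<^sup>2 * \<tau>) * (d0 * d1 * d2)"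
    unfolding d by algebra
  have L: "t * (X * d2 + Y * d1 - Z * (d0 * d1 * d2)) / (t * (d0 * d1 * d2)) = X / (d0 * d1) + Y / (d0 * d2) - Z" for X Y Z
    using assms(1) d_nz by (simp add: divide_simps)
  have R: "(- X * d2 - t * Y * d1 + Z * (t - W) * (d0 * d1 * d2)) / (t * (d0 * d1 * d2))
      = - (X / (t * (d1 * d0))) - Y / (d2 * d0) + Z * (1 - W / t)" for X Y Z W
    using assms(1) d_nz by (simp add: divide_simps)
  show ?thesis unfolding d[symmetric]
    by (rule trans[OF L[symmetric] trans[OF _ R]]) (simp only: key)
qed

text \<open>With v = u^2, the letters stand for: \<open>SS\<close> for S(S f), \<open>TS\<close> and
  \<open>TS'\<close> for S f at p u and u/p, and \<open>P\<close>, \<open>Pp\<close>,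
  \<open>Pm\<close> for f at u, q u and u/q. The outer coefficients agree on substitution, the
  middle one by \<open>middle_coefficient\<close>.\<close>

lemma half_shift_square_field:
  fixes b t q \<tau> v :: "'a::field"
  assumes nz: "b \<noteq> 0" "t \<noteq> 0" "q \<noteq> 0" and d: "1 - t / q * v \<noteq> 0" "1 - t * v \<noteq> 0" "1 - t / q\<^sup>2 * v \<noteq> 0"
    and SS: "(1 - t / q * v) * SS = b * \<tau> * ((1 - t\<^sup>2 / (b * q) * v) * TS) + (1 - b / q * v) * TS'"
    and TS: "(1 - t * v) * TS = b * \<tau> * ((1 - t\<^sup>2 / b * v) * Pp) + (1 - b * v) * P"
    and TS': "(1 - t / q\<^sup>2 * v) * TS' = b * \<tau> * ((1 - t\<^sup>2 / (b * q\<^sup>2) * v) * P) + (1 - b / q\<^sup>2 * v) * Pm"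
  shows "SS - (1 + b * \<tau>)\<^sup>2 * P =
     b\<^sup>2 * (t * \<tau>)\<^sup>2 / t\<^sup>2 * (1 - t\<^sup>2 * v / b) * (1 - t\<^sup>2 * v / (q * b)) / ((1 - t * v) * (1 - t * v / q)) * (Pp - P / (t * \<tau>))
   + (1 - b * v / q\<^sup>2) * (1 - b * v / q) / ((1 - t * v / q\<^sup>2) * (1 - t * v / q)) * (Pm - t * \<tau> * P)
   + (t * \<tau> - 1) * (1 - b\<^sup>2 * (t * \<tau>) / t\<^sup>2) * P"
proof -
  define V where "V = v / q\<^sup>2"
  have v: "v = q\<^sup>2 * V" using nz by (simp add: V_def)
  define d0 d1 d2 where dd: "d0 = 1 - t * q * V" "d1 = 1 - t * q\<^sup>2 * V" "d2 = 1 - t * V"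
  have dv: "1 - t / q * v = d0" "1 - t * v = d1" "1 - t / q\<^sup>2 * v = d2"
      "1 - t * v / q = d0" "1 - t * v / q\<^sup>2 = d2"
    using nz by (auto simp: dd v power2_eq_square)
  have d_nz: "d0 \<noteq> 0" "d1 \<noteq> 0" "d2 \<noteq> 0" using d unfolding dv by auto
  have e: "b * \<tau> * ((1 - t\<^sup>2 / (b * q) * v) * X) = \<tau> * (b - t\<^sup>2 * q * V) * X"
    "b * \<tau> * ((1 - t\<^sup>2 / b * v) * X) = \<tau> * (b - t\<^sup>2 * q\<^sup>2 * V) * X"
    "b * \<tau> * ((1 - t\<^sup>2 / (b * q\<^sup>2) * v) * X) = \<tau> * (b - t\<^sup>2 * V) * X"
    "1 - b / q * v = 1 - b * q * V" "1 - b / q\<^sup>2 * v = 1 - b * V" "1 - b * v = 1 - b * q\<^sup>2 * V"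
    "1 - b * v / q = 1 - b * q * V" "1 - b * v / q\<^sup>2 = 1 - b * V"
    "b\<^sup>2 * (t * \<tau>)\<^sup>2 / t\<^sup>2 * (1 - t\<^sup>2 * v / b) * (1 - t\<^sup>2 * v / (q * b))
      = \<tau>\<^sup>2 * ((b - t\<^sup>2 * q\<^sup>2 * V) * (b - t\<^sup>2 * q * V))"
    "b\<^sup>2 * (t * \<tau>) / t\<^sup>2 = b\<^sup>2 * \<tau> / t" for X
    using nz by (simp_all add: v field_simps power2_eq_square)
  define N0 N1 N2 M0 M1 M2 where N: "N0 = b - t\<^sup>2 * q * V" "N1 = b - t\<^sup>2 * q\<^sup>2 * V" "N2 = b - t\<^sup>2 * V"
      "M0 = 1 - b * q * V" "M1 = 1 - b * q\<^sup>2 * V" "M2 = 1 - b * V"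
  have TS1: "TS = (\<tau> * N1 * Pp + M1 * P) / d1"
    using TS d_nz(2) unfolding dv e N[symmetric] by (simp add: eq_divide_eq mult.commute)
  have TS2: "TS' = (\<tau> * N2 * P + M2 * Pm) / d2"
    using TS' d_nz(3) unfolding dv e N[symmetric] by (simp add: eq_divide_eq mult.commute)
  have SS1: "SS = (\<tau> * N0 * TS + M0 * TS') / d0"
    using SS d_nz(1) unfolding dv e N[symmetric] by (simp add: eq_divide_eq mult.commute)
  have mid: "\<tau> * N0 * M1 / (d0 * d1) + M0 * (\<tau> * N2) / (d0 * d2) - (1 + b * \<tau>)\<^sup>2
    = - (\<tau> * N1 * N0 / (t * (d1 * d0))) - t * \<tau> * M2 * M0 / (d2 * d0) + (t * \<tau> - 1) * (1 - b\<^sup>2 * \<tau> / t)"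
    using middle_coefficient[of t q V \<tau> b] nz d_nz unfolding N dd by blast
  have "SS - (1 + b * \<tau>)\<^sup>2 * P = \<tau>\<^sup>2 * (N1 * N0) / (d1 * d0) * Pp + M2 * M0 / (d2 * d0) * Pm
     + (\<tau> * N0 * M1 / (d0 * d1) + M0 * (\<tau> * N2) / (d0 * d2) - (1 + b * \<tau>)\<^sup>2) * P"
  proof -
    have "SS = \<tau>\<^sup>2 * (N1 * N0) / (d1 * d0) * Pp + M2 * M0 / (d2 * d0) * Pm
     + (\<tau> * N0 * M1 / (d0 * d1) + M0 * (\<tau> * N2) / (d0 * d2)) * P"
      unfolding SS1 TS1 TS2 using d_nz by (simp add: divide_simps) (simp add: algebra_simps power2_eq_square)
    then show ?thesis by (simp add: algebra_simps)
  qed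
  also have "\<dots> = \<tau>\<^sup>2 * (N1 * N0) / (d1 * d0) * (Pp - P / (t * \<tau>)) + M2 * M0 / (d2 * d0) * (Pm - t * \<tau> * P)
     + (t * \<tau> - 1) * (1 - b\<^sup>2 * \<tau> / t) * P"
  proof -
    have "\<tau> * N1 * N0 / (t * (d1 * d0)) * P = \<tau>\<^sup>2 * (N1 * N0) / (d1 * d0) * (P / (t * \<tau>))"
      by (simp add: power2_eq_square mult_ac)
    then show ?thesis unfolding mid
      by (simp add: left_diff_distrib right_diff_distrib distrib_right diff_divide_distrib)
  qed
  finally show ?thesis unfolding dv e N[symmetric] .
qed

text \<open>One rational function of z serves both sums of D_x: z = x_i gives the coefficient of the
  shift by q and z = 1/x_i that of the inverse shift. The common scalar prefactor is left
  out.\<close>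

definition coeff_C ::
  "complex \<Rightarrow> complex \<Rightarrow> complex \<Rightarrow> nat \<Rightarrow> (nat \<Rightarrow> complex) \<Rightarrow> nat \<Rightarrow> complex \<Rightarrow> complex" where
  "coeff_C b q t n x i z = (1 - b * z\<^sup>2) * (1 - q * b * z\<^sup>2) / ((1 - z\<^sup>2) * (1 - q * z\<^sup>2))
     * (\<Prod>j\<in>{..<n} - {i}. poly (kern t (x j)) z / poly (kern 1 (x j)) z)"

text \<open>The parameters come in pairs of opposite sign, which merge into 1 - b z^2 and 1 - q b
  z^2. Their product over q is b^2, so \<alpha> is \<open>csqrt (b\<^sup>2)\<close>, equal to b only
  up to sign.\<close>

lemma koornwinder_op_C:
  assumes q: "q \<noteq> 0" and reg: "regular_point n q x"
  shows "koornwinder_op n (- csqrt b) (csqrt b) (- (csqrt q * csqrt b)) (csqrt q * csqrt b) q t f x =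
    (\<Sum>i<n. coeff_C b q t n x i (x i) * (f (x(i := q * x i)) - f x)
        + coeff_C b q t n x i (1 / x i) * (f (x(i := x i / q)) - f x)) / (csqrt (b\<^sup>2) * t ^ (n - 1))"
proof -
  have a: "- csqrt b * csqrt b * - (csqrt q * csqrt b) * (csqrt q * csqrt b) / q = b\<^sup>2"
  proof -
    have "- csqrt b * csqrt b * - (csqrt q * csqrt b) * (csqrt q * csqrt b) = (csqrt b)\<^sup>2 * (csqrt b)\<^sup>2 * (csqrt q)\<^sup>2"
      by (simp add: power2_eq_square)
    also have "\<dots> = b\<^sup>2 * q" by (simp only: power2_csqrt power2_eq_square[of b])
    finally show ?thesis using q by simp
  qed
  have num: "(1 - (- csqrt b) * z) * (1 - csqrt b * z) * (1 - (- (csqrt q * csqrt b)) * z) * (1 - csqrt q * csqrt b * z)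
      = (1 - b * z\<^sup>2) * (1 - q * b * z\<^sup>2)" for z
  proof -
    have "(1 - (- csqrt b) * z) * (1 - csqrt b * z) * (1 - (- (csqrt q * csqrt b)) * z) * (1 - csqrt q * csqrt b * z)
      = (1 - (csqrt b)\<^sup>2 * z\<^sup>2) * (1 - (csqrt q)\<^sup>2 * (csqrt b)\<^sup>2 * z\<^sup>2)"
      by (simp add: algebra_simps power2_eq_square)
    then show ?thesis by simp
  qed
  have x0: "x i \<noteq> 0" if "i < n" for i using reg that by (auto simp: regular_point_def)
  have plus: "(\<Prod>j \<in> {..<n} - {i}. (1 - t * x i * x j) * (1 - t * x i / x j)
            / ((1 - x i * x j) * (1 - x i / x j)))
      = (\<Prod>j\<in>{..<n} - {i}. poly (kern t (x j)) (x i) / poly (kern 1 (x j)) (x i))" for i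
    by (rule prod.cong) (auto simp: poly_kern x0)
  have minus: "(\<Prod>j \<in> {..<n} - {i}. (1 - t * x j / x i) * (1 - t / (x i * x j))
            / ((1 - x j / x i) * (1 - 1 / (x i * x j))))
      = (\<Prod>j\<in>{..<n} - {i}. poly (kern t (x j)) (1 / x i) / poly (kern 1 (x j)) (1 / x i))" for i
    by (rule prod.cong) (auto simp: poly_kern x0)
  have num': "(1 - (- csqrt b) / z) * (1 - csqrt b / z) * (1 - (- (csqrt q * csqrt b)) / z) * (1 - csqrt q * csqrt b / z)
      = (1 - b * (1 / z)\<^sup>2) * (1 - q * b * (1 / z)\<^sup>2)" for z
    using num[of "1 / z"] by simp
  show ?thesis
    unfolding koornwinder_op_def Let_def a num num' plus minus coeff_C_def sum.distrib sum_divide_distrib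
      add_divide_distrib
    by (intro arg_cong2[where f = "(+)"] sum.cong) (simp_all add: mult_ac power_divide)
qed

section \<open>The variable u as generator of the field of formal Laurent series\<close>

lemma fls_const_mult_X_power_neq:
  fixes a c :: complex
  assumes "a \<noteq> 0" "k > 0"
  shows "fls_const a * fls_X ^ k \<noteq> fls_const c"
proof
  assume "fls_const a * fls_X ^ k = fls_const c"
  then have "fps_to_fls (fps_const a * fps_X ^ k) = fps_to_fls (fps_const c)"
    by (simp add: fls_times_fps_to_fls fps_to_fls_power)
  then have "fps_const a * fps_X ^ k = fps_const c" by (simp only: fps_to_fls_eq_iff)
  then have "fps_nth (fps_const a * fps_X ^ k) k = fps_nth (fps_const c) k" by (rule arg_cong)
  then show False using assms by (simp add: fps_X_power_nth del: fps_const_mult_left)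
qed

lemma fls_const_X_assoc:
  "fls_const (a :: complex) * fls_X * fls_const c = fls_const (a * c) * fls_X"
  by (simp only: fls_const_mult_const[symmetric] mult_ac)

lemma fls_linear_nonzero: "1 - fls_const (a :: complex) * fls_X \<noteq> 0"
proof (cases "a = 0")
  case False
  then show ?thesis using fls_const_mult_X_power_neq[of a 1 1] by auto
qed auto

lemma qbin_fls_step:
  assumes q: "norm q < 1"
  shows "fps_to_fls (qbin_fps q t (q * c)) =
    fps_to_fls (qbin_fps q t c) * (1 - fls_X * fls_const c) / (1 - fls_const t * fls_X * fls_const c)"
proof -
  have "fps_to_fls ((1 - fps_const c * fps_X) * qbin_fps q t c) =
    fps_to_fls ((1 - fps_const (t * c) * fps_X) * qbin_fps q t (q * c))"
    by (simp only: qbin_fps_step[OF q])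
  then have "(1 - fls_const c * fls_X) * fps_to_fls (qbin_fps q t c) =
     (1 - fls_const (t * c) * fls_X) * fps_to_fls (qbin_fps q t (q * c))"
    by (simp only: fls_times_fps_to_fls fps_to_fls_minus fps_one_to_fls fps_const_to_fls fps_X_to_fls)
  then show ?thesis
    unfolding fls_const_X_assoc using fls_linear_nonzero[of "t * c"]
    by (simp add: eq_divide_eq mult.commute)
qed

lemma fls_const_prod: "fls_const (\<Prod>i\<in>I. f i :: complex) = (\<Prod>i\<in>I. fls_const (f i))"
  by (induction I rule: infinite_finite_induct) (simp_all flip: fls_const_mult_const)

lemma fps_to_fls_prod: "fps_to_fls (\<Prod>i\<in>I. f i :: complex fps) = (\<Prod>i\<in>I. fps_to_fls (f i))"
  by (induction I rule: infinite_finite_induct) (simp_all add: fls_times_fps_to_fls)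

lemma fls_const_uneq:
  "fls_const (a :: complex) = fls_const b \<longleftrightarrow> a = b"
  by (metis fls_const_nth)

lemma fls_const_hom:
  "fls_const (a * b :: complex) = fls_const a * fls_const b"
  "fls_const (a - b :: complex) = fls_const a - fls_const b"
  "fls_const (a + b :: complex) = fls_const a + fls_const b"
  "fls_const (a / b :: complex) = fls_const a / fls_const b"
  "fls_const (a ^ k :: complex) = fls_const a ^ k"
  by (simp_all add: fls_const_divide_const fls_const_power fls_minus_const fls_plus_const)

lemma fls_const_coeff_C:
  assumes "\<And>j. j < n \<Longrightarrow> x j \<noteq> 0"
  shows "fls_const (coeff_C b q t n x i z) =
    (1 - fls_const b * (fls_const z)\<^sup>2) * (1 - fls_const q * fls_const b * (fls_const z)\<^sup>2)
      / ((1 - (fls_const z)\<^sup>2) * (1 - fls_const q * (fls_const z)\<^sup>2))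
     * (\<Prod>j\<in>{..<n} - {i}. poly (kern (fls_const t) (fls_const (x j))) (fls_const z)
          / poly (kern 1 (fls_const (x j))) (fls_const z))"
proof -
  have "fls_const (poly (kern t (x j)) z / poly (kern 1 (x j)) z) =
      poly (kern (fls_const t) (fls_const (x j))) (fls_const z) / poly (kern 1 (fls_const (x j))) (fls_const z)"
    if "j < n" for j
    using assms[OF that] by (simp only: poly_kern fls_const_eq_0_iff fls_const_hom fls_const_1 not_False_eq_True)
  then have "(\<Prod>j\<in>{..<n} - {i}. fls_const (poly (kern t (x j)) z / poly (kern 1 (x j)) z)) =
      (\<Prod>j\<in>{..<n} - {i}. poly (kern (fls_const t) (fls_const (x j))) (fls_const z)
          / poly (kern 1 (fls_const (x j))) (fls_const z))"
    by (intro prod.cong) auto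
  then show ?thesis
    unfolding coeff_C_def fls_const_hom(1-3,5) fls_const_hom(4)[of "_ * _" "_ * _"] fls_const_prod fls_const_1 by simp
qed

text \<open>The factor acquired by \<Pi>(u) when a variable with value z becomes q z. As \<Pi> is
  invariant under inversion, z = 1/x_i describes x_i -> x_i/q.\<close>

definition shift_ratio :: "complex \<Rightarrow> complex \<Rightarrow> complex \<Rightarrow> complex fls" where
  "shift_ratio q t z = (1 - fls_X * fls_const z) * (1 - fls_const t * fls_X * fls_const (1 / (q * z)))
     / ((1 - fls_const t * fls_X * fls_const z) * (1 - fls_X * fls_const (1 / (q * z))))"

lemma fls_X_linear_nonzero: "1 - fls_X * fls_const (a :: complex) \<noteq> 0"
  using fls_linear_nonzero[of a] by (simp add: mult.commute)

lemma fls_X_linear_nonzero': "1 - fls_const t * fls_X * fls_const (a :: complex) \<noteq> 0"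
  using fls_linear_nonzero[of "t * a"] by (simp only: fls_const_X_assoc not_False_eq_True)

lemma qbin_fls_step_inverse:
  assumes q: "norm q < 1" and "q \<noteq> 0"
  shows "fps_to_fls (qbin_fps q t (c / q)) =
    fps_to_fls (qbin_fps q t c) * (1 - fls_const t * fls_X * fls_const (c / q)) / (1 - fls_X * fls_const (c / q))"
proof -
  have "q * (c / q) = c" using assms by simp
  with qbin_fls_step[OF q, of t "c / q"] show ?thesis
    using fls_X_linear_nonzero[of "c / q"] fls_X_linear_nonzero'[of t "c / q"]
    by (simp add: divide_simps)
qed

lemma qbin_pair_shift:
  assumes q: "norm q < 1" and "q \<noteq> 0"
  shows "fps_to_fls (qbin_fps q t (q * z)) * fps_to_fls (qbin_fps q t (1 / (q * z))) =
    fps_to_fls (qbin_fps q t z) * fps_to_fls (qbin_fps q t (1 / z)) * shift_ratio q t z"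
proof -
  have z: "1 / z / q = 1 / (q * z)" by simp
  show ?thesis
    unfolding shift_ratio_def qbin_fls_step[OF q] qbin_fls_step_inverse[OF assms, of t "1 / z", unfolded z]
    by (simp only: times_divide_times_eq times_divide_eq_right
        times_divide_eq_left divide_divide_eq_left divide_divide_eq_right mult_ac)
qed

lemma kernel_fps_update:
  assumes "norm q < 1" "q \<noteq> 0" "i < n"
  shows "fps_to_fls (kernel_fps n q t (x(i := q * x i))) = fps_to_fls (kernel_fps n q t x) * shift_ratio q t (x i)"
    and "fps_to_fls (kernel_fps n q t (x(i := x i / q))) = fps_to_fls (kernel_fps n q t x) * shift_ratio q t (1 / x i)"
proof -
  define R where "R = fps_to_fls (\<Prod>j\<in>{..<n} - {i}. qbin_fps q t (x j) * qbin_fps q t (1 / x j))"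
  have upd: "fps_to_fls (kernel_fps n q t (x(i := y))) =
      fps_to_fls (qbin_fps q t y) * fps_to_fls (qbin_fps q t (1 / y)) * R" for y
  proof -
    have "kernel_fps n q t (x(i := y)) = qbin_fps q t y * qbin_fps q t (1 / y) *
       (\<Prod>j\<in>{..<n} - {i}. qbin_fps q t ((x(i := y)) j) * qbin_fps q t (1 / (x(i := y)) j))"
      unfolding kernel_fps_def using assms(3) by (subst prod.remove[of _ i]) auto
    also have "(\<Prod>j\<in>{..<n} - {i}. qbin_fps q t ((x(i := y)) j) * qbin_fps q t (1 / (x(i := y)) j)) =
      (\<Prod>j\<in>{..<n} - {i}. qbin_fps q t (x j) * qbin_fps q t (1 / x j))"
      by (rule prod.cong) auto
    finally show ?thesis by (simp only: R_def fls_times_fps_to_fls)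
  qed
  have same: "fps_to_fls (kernel_fps n q t x) =
      fps_to_fls (qbin_fps q t (x i)) * fps_to_fls (qbin_fps q t (1 / x i)) * R"
    using upd[of "x i"] by simp
  show "fps_to_fls (kernel_fps n q t (x(i := q * x i))) = fps_to_fls (kernel_fps n q t x) * shift_ratio q t (x i)"
    unfolding upd same qbin_pair_shift[OF assms(1,2)] by (simp only: mult_ac)
  have "fps_to_fls (qbin_fps q t (x i / q)) * fps_to_fls (qbin_fps q t (1 / (x i / q))) =
    fps_to_fls (qbin_fps q t (x i)) * fps_to_fls (qbin_fps q t (1 / x i)) * shift_ratio q t (1 / x i)"
    using qbin_pair_shift[OF assms(1,2), of t "1 / x i"] by (simp add: mult_ac)
  then show "fps_to_fls (kernel_fps n q t (x(i := x i / q))) = fps_to_fls (kernel_fps n q t x) * shift_ratio q t (1 / x i)"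
    unfolding upd same by (simp only: mult_ac)
qed

text \<open>The factor 1 - q z^2 extracted here cancels the same factor in the denominator of
  \<open>coeff_C\<close>; the rest is the last factor of \<open>F\<close> in
  \<open>kernel_identity\<close>.\<close>

lemma shift_ratio_minus_1:
  assumes "q \<noteq> 0" "z \<noteq> 0"
  shows "shift_ratio q t z - 1 = (1 - fls_const q * (fls_const z)\<^sup>2) * (fls_X * (1 - fls_const t)
    / (fls_const q * fls_const z * (1 - fls_const t * fls_X * fls_const z) * (1 - fls_X / (fls_const q * fls_const z))))"
proof -
  define d1 d2 where "d1 = 1 - fls_const t * fls_X * fls_const z" and "d2 = 1 - fls_X / (fls_const q * fls_const z)"
  have e: "fls_const (1 / (q * z)) = 1 / (fls_const q * fls_const z)" by (simp only: fls_const_hom fls_const_1)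
  have d: "d1 \<noteq> 0" "d2 \<noteq> 0"
    using fls_X_linear_nonzero[of "1 / (q * z)"] fls_X_linear_nonzero'[of t z] unfolding d1_def d2_def e by auto
  define Q Z where "Q = fls_const q" and "Z = fls_const z"
  have QZ: "Q \<noteq> 0" "Z \<noteq> 0" using assms by (auto simp: Q_def Z_def)
  have "shift_ratio q t z - 1 = ((1 - fls_X * Z) * (1 - fls_const t * fls_X / (Q * Z)) - d1 * d2) / (d1 * d2)"
    using d unfolding shift_ratio_def e by (simp add: d1_def d2_def Q_def Z_def diff_divide_distrib)
  also have "(1 - fls_X * Z) * (1 - fls_const t * fls_X / (Q * Z)) - d1 * d2
     = (1 - Q * Z\<^sup>2) * (fls_X * (1 - fls_const t)) / (Q * Z)"
    unfolding d1_def d2_def Q_def[symmetric] Z_def[symmetric] using QZ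
    by (simp add: field_simps power2_eq_square)
  finally show ?thesis
    by (simp add: d1_def d2_def Q_def Z_def mult_ac)
qed

text \<open>Dilating u by q multiplies the parameter of every factor by q, those of x_i and of 1/x_i
  alike. The products are \<open>Rp\<close> and \<open>Rm\<close> of \<open>kernel_identity\<close>
  at u = \<open>fls_X\<close>.\<close>

lemma fps_dil_kernel: 
  assumes "norm q < 1" "q \<noteq> 0"
  shows "fps_to_fls (fps_dil q (kernel_fps n q t x)) = fps_to_fls (kernel_fps n q t x) *
    (\<Prod>i<n. (1 - fls_X * fls_const (x i)) * (1 - fls_X / fls_const (x i))
       / ((1 - fls_const t * fls_X * fls_const (x i)) * (1 - fls_const t * fls_X / fls_const (x i))))"
    and "fps_to_fls (fps_dil (1 / q) (kernel_fps n q t x)) = fps_to_fls (kernel_fps n q t x) *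
    (\<Prod>i<n. (1 - fls_const t * (fls_X / fls_const q) * fls_const (x i)) * (1 - fls_const t * (fls_X / fls_const q) / fls_const (x i))
       / ((1 - (fls_X / fls_const q) * fls_const (x i)) * (1 - (fls_X / fls_const q) / fls_const (x i))))"
proof -
  have e: "fls_const (1 / y) = 1 / fls_const y" "fls_const (y / q) = fls_const y / fls_const q" for y
    by (simp_all only: fls_const_hom fls_const_1)
  show "fps_to_fls (fps_dil q (kernel_fps n q t x)) = fps_to_fls (kernel_fps n q t x) *
    (\<Prod>i<n. (1 - fls_X * fls_const (x i)) * (1 - fls_X / fls_const (x i))
       / ((1 - fls_const t * fls_X * fls_const (x i)) * (1 - fls_const t * fls_X / fls_const (x i))))"
    unfolding kernel_fps_def fps_dil_prod fps_dil_mult fps_dil_qbin fps_to_fls_prod fls_times_fps_to_fls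
      prod.distrib[symmetric] qbin_fls_step[OF assms(1)] e
    by (rule prod.cong) (simp_all add: mult_ac)
  have q1: "1 / q * y = y / q" for y by simp
  show "fps_to_fls (fps_dil (1 / q) (kernel_fps n q t x)) = fps_to_fls (kernel_fps n q t x) *
    (\<Prod>i<n. (1 - fls_const t * (fls_X / fls_const q) * fls_const (x i)) * (1 - fls_const t * (fls_X / fls_const q) / fls_const (x i))
       / ((1 - (fls_X / fls_const q) * fls_const (x i)) * (1 - (fls_X / fls_const q) / fls_const (x i))))"
    unfolding kernel_fps_def fps_dil_prod fps_dil_mult fps_dil_qbin fps_to_fls_prod fls_times_fps_to_fls
      prod.distrib[symmetric] q1 qbin_fls_step_inverse[OF assms] e
    by (rule prod.cong) (simp_all add: mult_ac)
qed

text \<open>The equation defining S is also dilated by p and by 1/p. Since the dilations compose to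
  q, 1 and 1/q, no half power of q survives, and the three equations are those required by
  \<open>half_shift_square_field\<close>.\<close>

lemma half_shift_square:
  fixes b t q p :: complex and n :: nat and f :: "complex fps"
  assumes nz: "b \<noteq> 0" "t \<noteq> 0" "q \<noteq> 0" "p \<noteq> 0" and p: "p\<^sup>2 = q" and n: "n \<ge> 1"
  defines "\<beta> \<equiv> b * t ^ (n - 1)" and "B \<equiv> fls_const b" and "T \<equiv> fls_const t" and "Q \<equiv> fls_const q"
    and "v \<equiv> fls_X\<^sup>2 :: complex fls" and "P \<equiv> fps_to_fls f"
  shows "fps_to_fls (half_shift \<beta> b t q p (half_shift \<beta> b t q p f) - fps_const ((1 + \<beta>)\<^sup>2) * f) =
     B\<^sup>2 * T ^ (2 * n) / T\<^sup>2 * (1 - T\<^sup>2 * v / B) * (1 - T\<^sup>2 * v / (Q * B)) / ((1 - T * v) * (1 - T * v / Q))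
        * (fps_to_fls (fps_dil q f) - P / T ^ n)
   + (1 - B * v / Q\<^sup>2) * (1 - B * v / Q) / ((1 - T * v / Q\<^sup>2) * (1 - T * v / Q)) * (fps_to_fls (fps_dil (1 / q) f) - T ^ n * P)
   + (T ^ n - 1) * (1 - B\<^sup>2 * T ^ n / T\<^sup>2) * P"
proof -
  define g where "g = half_shift \<beta> b t q p f"
  have hom: "fps_to_fls (fps_const c * h) = fls_const c * fps_to_fls h"
    "fps_to_fls ((1 - fps_const c * fps_X\<^sup>2) * h) = (1 - fls_const c * v) * fps_to_fls h" for c h
    by (simp_all only: v_def fls_times_fps_to_fls fps_to_fls_minus fps_one_to_fls fps_const_to_fls
        fps_X_to_fls fps_to_fls_power)
  have dil_quad: "fps_dil s ((1 - fps_const c * fps_X\<^sup>2) * h) = (1 - fps_const (c * s\<^sup>2) * fps_X\<^sup>2) * fps_dil s h" for s c h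
    by (simp only: fps_dil_mult fps_dil_quadratic)
  have p2: "p * p = q" "p * (1 / p) = 1" "1 / p * p = 1" "1 / p * (1 / p) = 1 / q" "(1 / p)\<^sup>2 = 1 / q"
    using p nz by (auto simp: power2_eq_square)
  have S0: "(1 - fps_const (t / q) * fps_X\<^sup>2) * half_shift \<beta> b t q p g =
     fps_const \<beta> * ((1 - fps_const (t\<^sup>2 / (b * q)) * fps_X\<^sup>2) * fps_dil p g)
      + (1 - fps_const (b / q) * fps_X\<^sup>2) * fps_dil (1 / p) g"
    by (rule half_shift_mult)
  have S1: "(1 - fps_const (t / q * q) * fps_X\<^sup>2) * fps_dil p g =
     fps_const \<beta> * ((1 - fps_const (t\<^sup>2 / (b * q) * q) * fps_X\<^sup>2) * fps_dil q f)
      + (1 - fps_const (b / q * q) * fps_X\<^sup>2) * f"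
    using arg_cong[OF half_shift_mult[of t q \<beta> b p f], of "fps_dil p"]
    unfolding g_def[symmetric] fps_dil_add fps_dil_const_mult dil_quad fps_dil_dil p p2 fps_dil_1 .
  have S2: "(1 - fps_const (t / q * (1 / q)) * fps_X\<^sup>2) * fps_dil (1 / p) g =
     fps_const \<beta> * ((1 - fps_const (t\<^sup>2 / (b * q) * (1 / q)) * fps_X\<^sup>2) * f)
      + (1 - fps_const (b / q * (1 / q)) * fps_X\<^sup>2) * fps_dil (1 / q) f"
    using arg_cong[OF half_shift_mult[of t q \<beta> b p f], of "fps_dil (1 / p)"]
    unfolding g_def[symmetric] fps_dil_add fps_dil_const_mult dil_quad fps_dil_dil p p2 fps_dil_1 .
  define \<tau> where "\<tau> = T ^ (n - 1)"
  have Tn: "T ^ n = T * \<tau>" using n by (simp add: \<tau>_def power_eq_if)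
  have T2n: "T ^ (2 * n) = (T * \<tau>)\<^sup>2" by (simp only: Tn[symmetric] power_mult[symmetric] mult.commute)
  have \<beta>: "fls_const \<beta> = B * \<tau>" by (simp only: \<beta>_def B_def \<tau>_def T_def fls_const_hom)
  have c1: "fls_const (t / q) = T / Q" "fls_const (t\<^sup>2 / (b * q)) = T\<^sup>2 / (B * Q)" "fls_const (b / q) = B / Q"
    "fls_const (t / q * q) = T" "fls_const (t\<^sup>2 / (b * q) * q) = T\<^sup>2 / B" "fls_const (b / q * q) = B"
    "fls_const (t / q * (1 / q)) = T / Q\<^sup>2" "fls_const (t\<^sup>2 / (b * q) * (1 / q)) = T\<^sup>2 / (B * Q\<^sup>2)"
    "fls_const (b / q * (1 / q)) = B / Q\<^sup>2"
    using nz by (simp_all add: T_def Q_def B_def fls_const_hom power2_eq_square del: fls_const_mult_const)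
  have c2: "fls_const ((1 + \<beta>)\<^sup>2) = (1 + B * \<tau>)\<^sup>2"
    by (simp only: fls_const_hom fls_const_1 \<beta>)
  have BTQ: "B \<noteq> 0" "T \<noteq> 0" "Q \<noteq> 0" using nz by (auto simp: B_def T_def Q_def)
  have nz1: "1 - fls_const c * v \<noteq> 0" for c :: complex
  proof (cases "c = 0")
    case False
    then show ?thesis using fls_const_mult_X_power_neq[of c 2 1] by (auto simp: v_def)
  qed auto
  show ?thesis
    unfolding T2n Tn fps_to_fls_minus hom c2 P_def g_def[symmetric]
  proof (rule half_shift_square_field)
    show "(1 - T / Q * v) * fps_to_fls (half_shift \<beta> b t q p g) =
       B * \<tau> * ((1 - T\<^sup>2 / (B * Q) * v) * fps_to_fls (fps_dil p g)) + (1 - B / Q * v) * fps_to_fls (fps_dil (1 / p) g)"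
      using arg_cong[OF S0, of fps_to_fls] unfolding fps_to_fls_plus hom c1 \<beta> .
    show "(1 - T * v) * fps_to_fls (fps_dil p g) =
       B * \<tau> * ((1 - T\<^sup>2 / B * v) * fps_to_fls (fps_dil q f)) + (1 - B * v) * fps_to_fls f"
      using arg_cong[OF S1, of fps_to_fls] unfolding fps_to_fls_plus hom c1 \<beta> .
    show "(1 - T / Q\<^sup>2 * v) * fps_to_fls (fps_dil (1 / p) g) =
       B * \<tau> * ((1 - T\<^sup>2 / (B * Q\<^sup>2) * v) * fps_to_fls f) + (1 - B / Q\<^sup>2 * v) * fps_to_fls (fps_dil (1 / q) f)"
      using arg_cong[OF S2, of fps_to_fls] unfolding fps_to_fls_plus hom c1 \<beta> .
  qed (use BTQ nz1[of "t / q"] nz1[of "t / q * (1 / q)"] nz1[of t] in \<open>simp_all only: c1 T_def[symmetric] not_False_eq_True\<close>)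
qed

section \<open>The action of the operator on the generating function\<close>

text \<open>The kernel function identity: D_x acting on \<Pi> in x, without its scalar prefactor,
  equals S^2 minus a constant acting on \<Pi> in u. Both sides are \<Pi>(u) times an element of the
  Laurent series field, and \<open>kernel_identity\<close> and \<open>half_shift_square\<close>
  compute the same element.\<close>

lemma kernel_operator:
  fixes b t q p :: complex and n :: nat
  assumes nz: "b \<noteq> 0" "t \<noteq> 0" "q \<noteq> 0" "p \<noteq> 0" and p: "p\<^sup>2 = q" and n: "n \<ge> 1"
    and q1: "norm q < 1" and reg: "regular_point n q x"
  defines "\<beta> \<equiv> b * t ^ (n - 1)" and "f \<equiv> kernel_fps n q t x"
  shows "(\<Sum>i<n. fps_const (coeff_C b q t n x i (x i)) * (kernel_fps n q t (x(i := q * x i)) - f)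
        + fps_const (coeff_C b q t n x i (1 / x i)) * (kernel_fps n q t (x(i := x i / q)) - f))
    = half_shift \<beta> b t q p (half_shift \<beta> b t q p f) - fps_const ((1 + \<beta>)\<^sup>2) * f"
proof -
  have x0: "x i \<noteq> 0" "(x i)\<^sup>2 \<noteq> 1" "q * (x i)\<^sup>2 \<noteq> 1" "(x i)\<^sup>2 \<noteq> q" if "i < n" for i
    using reg that by (auto simp: regular_point_def)
  have xx: "x i \<noteq> x j" "x i * x j \<noteq> 1" if "i < n" "j < n" "i \<noteq> j" for i j
    using reg that by (auto simp: regular_point_def)
  define P where "P = fps_to_fls f"
  define B T Q where "B = fls_const b" and "T = fls_const t" and "Q = fls_const q"
  define X where "X i = fls_const (x i)" for i
  define W where "W = (\<lambda>i z. (1 - B * z\<^sup>2) * (1 - Q * B * z\<^sup>2) / (1 - z\<^sup>2)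
      * (\<Prod>j\<in>{..<n} - {i}. poly (kern T (X j)) z / poly (kern 1 (X j)) z)
      * (fls_X * (1 - T) / (Q * z * (1 - T * fls_X * z) * (1 - fls_X / (Q * z)))))"
  have term_eq: "fls_const (coeff_C b q t n x i z) * (P * shift_ratio q t z - P) = P * W i (fls_const z)"
    if "z \<noteq> 0" "q * z\<^sup>2 \<noteq> 1" for i z
  proof -
    have "1 - Q * (fls_const z)\<^sup>2 \<noteq> 0"
      using that(2) fls_const_uneq[of 1 "q * z\<^sup>2"] by (simp add: Q_def fls_const_hom del: fls_const_mult_const)
    then have cancel: "N / (D * (1 - Q * (fls_const z)\<^sup>2)) * R * ((1 - Q * (fls_const z)\<^sup>2) * Y) = N / D * R * Y"
      for N D R Y :: "complex fls"
      by simp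
    have "fls_const (coeff_C b q t n x i z) * (shift_ratio q t z - 1) = W i (fls_const z)"
      unfolding shift_ratio_minus_1[OF nz(3) that(1)]
      by (subst fls_const_coeff_C) (use x0 in \<open>simp_all only: W_def X_def B_def T_def Q_def[symmetric] cancel not_False_eq_True\<close>)
    then show ?thesis by (simp add: algebra_simps)
  qed
  have W_inv: "W i (1 / X i) = W i (fls_const (1 / x i))" for i
    by (simp only: X_def fls_const_hom fls_const_1)
  have X_uneq: "fls_const a * fls_X ^ k \<noteq> fls_const c" if "a \<noteq> 0" "k > 0" for a c :: complex and k
    using fls_const_mult_X_power_neq that .
  have "(\<Sum>i<n. W i (X i) + W i (1 / X i)) =
     B\<^sup>2 * T ^ (2 * card {..<n}) / T\<^sup>2 * (1 - T\<^sup>2 * fls_X\<^sup>2 / B) * (1 - T\<^sup>2 * fls_X\<^sup>2 / (Q * B))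
        / ((1 - T * fls_X\<^sup>2) * (1 - T * fls_X\<^sup>2 / Q))
        * ((\<Prod>i<n. (1 - fls_X * X i) * (1 - fls_X / X i) / ((1 - T * fls_X * X i) * (1 - T * fls_X / X i))) - 1 / T ^ card {..<n})
   + (1 - B * fls_X\<^sup>2 / Q\<^sup>2) * (1 - B * fls_X\<^sup>2 / Q) / ((1 - T * fls_X\<^sup>2 / Q\<^sup>2) * (1 - T * fls_X\<^sup>2 / Q))
        * ((\<Prod>i<n. (1 - T * (fls_X / Q) * X i) * (1 - T * (fls_X / Q) / X i)
                / ((1 - (fls_X / Q) * X i) * (1 - (fls_X / Q) / X i))) - T ^ card {..<n})
   + (T ^ card {..<n} - 1) * (1 - B\<^sup>2 * T ^ card {..<n} / T\<^sup>2)"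
    unfolding W_def
  proof (rule kernel_identity)
    show "card {..<n} > 0" using n by simp
    show "X i \<noteq> 0" "(X i)\<^sup>2 \<noteq> 1" if "i \<in> {..<n}" for i
      using x0[of i] that by (auto simp: X_def fls_const_power[symmetric])
    show "X i \<noteq> X j \<and> X i * X j \<noteq> 1" if "i \<in> {..<n}" "j \<in> {..<n}" "i \<noteq> j" for i j
      using xx[of i j] that by (auto simp: X_def fls_const_uneq)
    show "T * fls_X\<^sup>2 \<noteq> 1" "T * fls_X\<^sup>2 \<noteq> Q" "T * fls_X\<^sup>2 \<noteq> Q\<^sup>2"
      using X_uneq[of t 2 1] X_uneq[of t 2 q] X_uneq[of t 2 "q\<^sup>2"] nz
      by (auto simp: T_def Q_def fls_const_power)
    show "fls_X \<noteq> Q * X i \<and> fls_X * X i \<noteq> Q \<and> T * fls_X * X i \<noteq> 1 \<and> T * fls_X \<noteq> X i" if "i \<in> {..<n}" for i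
    proof -
      have i: "x i \<noteq> 0" using x0[of i] that by simp
      then have "t * x i \<noteq> 0" using nz by simp
      from X_uneq[OF this, of 1 1] have "T * fls_X * X i \<noteq> 1"
        unfolding T_def X_def fls_const_X_assoc by simp
      then show ?thesis
        using i X_uneq[of 1 1 "q * x i"] X_uneq[of "x i" 1 q] X_uneq[of t 1 "x i"] nz
        by (auto simp: T_def X_def Q_def mult.commute)
    qed
  qed (use nz in \<open>auto simp: T_def Q_def B_def\<close>)
  moreover have dist: "A' * (P * Rp - P / T') + B' * (P * Rm - T' * P) + C' * P
      = P * (A' * (Rp - 1 / T') + B' * (Rm - T') + C')" for A' B' C' Rp Rm T'
    by (simp add: algebra_simps)
  ultimately have "P * (\<Sum>i<n. W i (X i) + W i (1 / X i)) =
     B\<^sup>2 * T ^ (2 * n) / T\<^sup>2 * (1 - T\<^sup>2 * fls_X\<^sup>2 / B) * (1 - T\<^sup>2 * fls_X\<^sup>2 / (Q * B)) / ((1 - T * fls_X\<^sup>2) * (1 - T * fls_X\<^sup>2 / Q))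
        * (fps_to_fls (fps_dil q f) - P / T ^ n)
   + (1 - B * fls_X\<^sup>2 / Q\<^sup>2) * (1 - B * fls_X\<^sup>2 / Q) / ((1 - T * fls_X\<^sup>2 / Q\<^sup>2) * (1 - T * fls_X\<^sup>2 / Q)) * (fps_to_fls (fps_dil (1 / q) f) - T ^ n * P)
   + (T ^ n - 1) * (1 - B\<^sup>2 * T ^ n / T\<^sup>2) * P"
    unfolding f_def fps_dil_kernel[OF q1 nz(3)] P_def[unfolded f_def, symmetric] T_def[symmetric] Q_def[symmetric] X_def[symmetric]
      card_lessThan dist
    by (simp only:)
  also have "\<dots> = fps_to_fls (half_shift \<beta> b t q p (half_shift \<beta> b t q p f) - fps_const ((1 + \<beta>)\<^sup>2) * f)"
    unfolding \<beta>_def half_shift_square[OF nz p n] P_def B_def T_def Q_def ..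
  finally have main: "P * (\<Sum>i<n. W i (X i) + W i (1 / X i)) = \<dots>" .
  have sumE: "fps_to_fls (\<Sum>i\<in>I. g i) = (\<Sum>i\<in>I. fps_to_fls (g i))" for g :: "nat \<Rightarrow> complex fps" and I
    by (induction I rule: infinite_finite_induct) simp_all
  have "fps_to_fls (\<Sum>i<n. fps_const (coeff_C b q t n x i (x i)) * (kernel_fps n q t (x(i := q * x i)) - f)
        + fps_const (coeff_C b q t n x i (1 / x i)) * (kernel_fps n q t (x(i := x i / q)) - f))
     = (\<Sum>i<n. P * W i (X i) + P * W i (1 / X i))"
    unfolding sumE
  proof (rule sum.cong[OF refl])
    fix i assume "i \<in> {..<n}"
    then have i: "i < n" by simp
    have "q * (1 / x i)\<^sup>2 \<noteq> 1" using x0[OF i] by (auto simp: field_simps)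
    with term_eq[of "1 / x i" i] x0[OF i]
    have t2: "fls_const (coeff_C b q t n x i (1 / x i)) * (P * shift_ratio q t (1 / x i) - P) = P * W i (1 / X i)"
      unfolding W_inv by simp
    have t1: "fls_const (coeff_C b q t n x i (x i)) * (P * shift_ratio q t (x i) - P) = P * W i (X i)"
      unfolding X_def using term_eq x0[OF i] by simp
    show "fps_to_fls (fps_const (coeff_C b q t n x i (x i)) * (kernel_fps n q t (x(i := q * x i)) - f)
        + fps_const (coeff_C b q t n x i (1 / x i)) * (kernel_fps n q t (x(i := x i / q)) - f))
      = P * W i (X i) + P * W i (1 / X i)"
      unfolding fps_to_fls_plus fls_times_fps_to_fls fps_to_fls_minus fps_const_to_fls
        kernel_fps_update[OF q1 nz(3) i] f_def
      by (simp only: t1[unfolded P_def f_def] t2[unfolded P_def f_def] P_def f_def)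
  qed
  also have "\<dots> = fps_to_fls (half_shift \<beta> b t q p (half_shift \<beta> b t q p f) - fps_const ((1 + \<beta>)\<^sup>2) * f)"
    unfolding main[symmetric] by (simp only: sum_distrib_left distrib_left)
  finally show ?thesis by (simp only: fps_to_fls_eq_iff)
qed

section \<open>Laurent polynomials and existence\<close>

text \<open>Vanishing outside \<open>I\<close> makes each function determined by its values on
  \<open>I\<close>, so that sums over this set are finite.\<close>

definition compositions :: "'i set \<Rightarrow> nat \<Rightarrow> ('i \<Rightarrow> nat) set" where
  "compositions I m = {k. (\<forall>i. i \<notin> I \<longrightarrow> k i = 0) \<and> sum k I = m}"

lemma finite_compositions:
  assumes "finite I"
  shows "finite (compositions I m)"
proof (rule finite_subset)
  show "compositions I m \<subseteq> {k. \<forall>i. (i \<in> I \<longrightarrow> k i \<in> {..m}) \<and> (i \<notin> I \<longrightarrow> k i = 0)}"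
    using assms by (auto simp: compositions_def intro!: member_le_sum)
  show "finite {k. \<forall>i. (i \<in> I \<longrightarrow> k i \<in> {..m}) \<and> (i \<notin> I \<longrightarrow> k i = (0::nat))}"
    by (rule finite_set_of_finite_funs) (use assms in auto)
qed

lemma fps_nth_prod_compositions:
  fixes F :: "'i \<Rightarrow> 'a::comm_ring_1 fps"
  assumes "finite I"
  shows "fps_nth (\<Prod>i\<in>I. F i) m = (\<Sum>k\<in>compositions I m. \<Prod>i\<in>I. fps_nth (F i) (k i))"
  using assms
proof (induction I arbitrary: m rule: finite_induct)
  case empty
  have "compositions ({} :: 'i set) m = (if m = 0 then {\<lambda>_. 0} else {})" for m
    by (auto simp: compositions_def)
  then show ?case by simp
next
  case (insert a I)
  have "(\<Sum>k\<in>compositions (insert a I) m. \<Prod>i\<in>insert a I. fps_nth (F i) (k i))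
      = (\<Sum>(j, k)\<in>(SIGMA j:{0..m}. compositions I (m - j)). fps_nth (F a) j * (\<Prod>i\<in>I. fps_nth (F i) (k i)))"
  proof (rule sum.reindex_bij_witness[of _ "\<lambda>(j, k). k(a := j)" "\<lambda>k. (k a, k(a := 0))"])
    fix k assume k: "k \<in> compositions (insert a I) m"
    have s: "sum (k(a := 0)) I = sum k I"
      by (rule sum.cong) (use insert in auto)
    show "(case (k a, k(a := 0)) of (j, k) \<Rightarrow> k(a := j)) = k" by simp
    show "(k a, k(a := 0)) \<in> (SIGMA j:{0..m}. compositions I (m - j))"
      using k s insert(1,2) by (auto simp: compositions_def)
    have "(\<Prod>i\<in>I. fps_nth (F i) ((k(a := 0)) i)) = (\<Prod>i\<in>I. fps_nth (F i) (k i))"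
      by (rule prod.cong) (use insert in auto)
    then show "(case (k a, k(a := 0)) of (j, k) \<Rightarrow> fps_nth (F a) j * (\<Prod>i\<in>I. fps_nth (F i) (k i)))
       = (\<Prod>i\<in>insert a I. fps_nth (F i) (k i))"
      using insert by simp
  next
    fix jk assume "jk \<in> (SIGMA j:{0..m}. compositions I (m - j))"
    then obtain j k where jk: "jk = (j, k)" and j: "j \<le> m" and k: "k \<in> compositions I (m - j)" by auto
    have ka: "k a = 0" using k insert(2) by (auto simp: compositions_def)
    then show "((case jk of (j, k) \<Rightarrow> k(a := j)) a, (case jk of (j, k) \<Rightarrow> k(a := j))(a := 0)) = jk"
      by (simp add: jk fun_upd_idem)
    have "sum (k(a := j)) I = sum k I"
      by (rule sum.cong) (use insert in auto)
    then show "(case jk of (j, k) \<Rightarrow> k(a := j)) \<in> compositions (insert a I) m"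
      using k j insert(1,2) by (auto simp: jk compositions_def)
  qed
  also have "\<dots> = (\<Sum>j=0..m. \<Sum>k\<in>compositions I (m - j). fps_nth (F a) j * (\<Prod>i\<in>I. fps_nth (F i) (k i)))"
    by (rule sum.Sigma[symmetric]) (auto intro: finite_compositions insert)
  finally show ?case
    using insert by (simp add: fps_mult_nth sum_distrib_left)
qed

text \<open>The factors of the generating function are indexed by \<open>(i, True)\<close> for \<open>x\<^sub>i\<close> and
  \<open>(i, False)\<close> for its inverse, so that the hyperoctahedral group acts by permuting indices.\<close>

definition exponent :: "(nat \<times> bool \<Rightarrow> nat) \<Rightarrow> nat \<Rightarrow> int" where
  "exponent k = (\<lambda>i. int (k (i, True)) - int (k (i, False)))"

definition weight :: "nat \<Rightarrow> complex \<Rightarrow> complex \<Rightarrow> (nat \<times> bool \<Rightarrow> nat) \<Rightarrow> complex" where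
  "weight n q t k = (\<Prod>p\<in>{..<n} \<times> UNIV. qpoch t q (k p) / qpoch q q (k p))"

text \<open>The Laurent polynomial a G_m. Different \<open>k\<close> can have the same exponent,
  because x_i and 1/x_i cancel; their contributions then add up in the sum.\<close>

definition G_laurent :: "nat \<Rightarrow> complex \<Rightarrow> complex \<Rightarrow> nat \<Rightarrow> complex \<Rightarrow> laurent" where
  "G_laurent n q t m a = (\<Sum>k\<in>compositions ({..<n} \<times> UNIV) m. Poly_Mapping.single (exponent k) (a * weight n q t k))"

lemma leval_eq_sum:
  assumes "finite S" "Poly_Mapping.keys p \<subseteq> S"
  shows "leval n p x = (\<Sum>e\<in>S. Poly_Mapping.lookup p e * (\<Prod>i<n. x i powi e i))"
  unfolding leval_def using assms by (intro sum.mono_neutral_left) (auto simp: in_keys_iff)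

lemma leval_add: "leval n (p + p') x = leval n p x + leval n p' x"
proof -
  let ?S = "Poly_Mapping.keys p \<union> Poly_Mapping.keys p'"
  have "Poly_Mapping.keys (p + p') \<subseteq> ?S" by (rule keys_add)
  then show ?thesis
    by (subst (1 2 3) leval_eq_sum[of ?S]) (auto simp: lookup_add distrib_right sum.distrib)
qed

lemma leval_zero [simp]: "leval n 0 x = 0"
  by (simp add: leval_def)

lemma leval_sum: "leval n (\<Sum>a\<in>A. p a) x = (\<Sum>a\<in>A. leval n (p a) x)"
  by (induction A rule: infinite_finite_induct) (simp_all add: leval_add)

lemma leval_single: "leval n (Poly_Mapping.single e c) x = c * (\<Prod>i<n. x i powi e i)"
  by (subst leval_eq_sum[of "{e}"]) auto

lemma leval_uminus: "leval n (- p) x = - leval n p x"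
  using leval_add[of n p "- p" x] by (simp add: eq_neg_iff_add_eq_0 add.commute)

lemma leval_diff: "leval n (p - p') x = leval n p x - leval n p' x"
  using leval_add[of n p "- p'" x] by (simp add: leval_uminus)

lemma kernel_fps_eq_prod:
  "kernel_fps n q t x = (\<Prod>p\<in>{..<n} \<times> UNIV. qbin_fps q t (if snd p then x (fst p) else 1 / x (fst p)))"
proof -
  have "kernel_fps n q t x = (\<Prod>i<n. \<Prod>s\<in>UNIV. qbin_fps q t (if s then x i else 1 / x i))"
    by (simp add: kernel_fps_def UNIV_bool mult.commute)
  then show ?thesis by (simp only: prod.cartesian_product case_prod_unfold)
qed

lemma leval_G_laurent:
  assumes "\<And>i. i < n \<Longrightarrow> x i \<noteq> 0"
  shows "leval n (G_laurent n q t m a) x = a * fps_nth (kernel_fps n q t x) m"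
proof -
  have mono: "(\<Prod>i<n. x i powi exponent k i) = (\<Prod>p\<in>{..<n} \<times> UNIV. (if snd p then x (fst p) else 1 / x (fst p)) ^ k p)" for k
  proof -
    have "(\<Prod>p\<in>{..<n} \<times> (UNIV :: bool set). (if snd p then x (fst p) else 1 / x (fst p)) ^ k p)
        = (\<Prod>i<n. \<Prod>s\<in>UNIV. (if s then x i else 1 / x i) ^ k (i, s))"
      by (simp only: prod.cartesian_product case_prod_unfold prod.collapse)
    also have "\<dots> = (\<Prod>i<n. x i powi exponent k i)"
      using assms by (intro prod.cong) (auto simp: UNIV_bool exponent_def power_int_diff power_divide)
    finally show ?thesis by simp
  qed
  have "fps_nth (kernel_fps n q t x) m = (\<Sum>k\<in>compositions ({..<n} \<times> UNIV) m. weight n q t k * (\<Prod>i<n. x i powi exponent k i))"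
    unfolding kernel_fps_eq_prod mono weight_def prod.distrib[symmetric]
    by (subst fps_nth_prod_compositions) (auto simp: qbin_fps_def)
  then show ?thesis
    by (simp add: G_laurent_def leval_sum leval_single sum_distrib_left mult.assoc)
qed

lemma lookup_sum: "Poly_Mapping.lookup (\<Sum>a\<in>A. p a) e = (\<Sum>a\<in>A. Poly_Mapping.lookup (p a) e)"
  by (induction A rule: infinite_finite_induct) (simp_all add: lookup_add)

lemma lookup_G_laurent:
  "Poly_Mapping.lookup (G_laurent n q t m a) e =
     (\<Sum>k\<in>compositions ({..<n} \<times> UNIV) m. if exponent k = e then a * weight n q t k else 0)"
  unfolding G_laurent_def lookup_sum by (rule sum.cong) (auto simp: lookup_single when_def)

text \<open>\<open>weight\<close> is symmetric in all 2n factors, so a permutation of the factors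
  that induces \<open>h\<close> on exponents carries the compositions with exponent \<open>e\<close>
  bijectively, with equal weights, to those with exponent \<open>h e\<close>.\<close>

lemma lookup_G_laurent_permute:
  assumes \<pi>: "\<pi> permutes {..<n} \<times> UNIV"
    and h: "\<And>k. exponent (k \<circ> \<pi>) = h (exponent k)" and inj: "inj h"
  shows "Poly_Mapping.lookup (G_laurent n q t m a) (h e) = Poly_Mapping.lookup (G_laurent n q t m a) e"
proof -
  let ?I = "{..<n} \<times> (UNIV :: bool set)"
  have comp: "k \<circ> \<pi>' \<in> compositions ?I m" if "k \<in> compositions ?I m" "\<pi>' permutes ?I" for k \<pi>'
    using that sum.permute[OF that(2), of k] unfolding compositions_def
    by (auto simp: permutes_not_in)
  have w: "weight n q t (k \<circ> \<pi>) = weight n q t k" for k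
    unfolding weight_def using prod.permute[OF \<pi>, of "\<lambda>p. qpoch t q (k p) / qpoch q q (k p)"] by (simp add: o_def)
  show ?thesis unfolding lookup_G_laurent
  proof (rule sum.reindex_bij_witness[of _ "\<lambda>k. k \<circ> \<pi>" "\<lambda>k. k \<circ> inv \<pi>"])
    fix k assume k: "k \<in> compositions ?I m"
    show i1: "(k \<circ> inv \<pi>) \<circ> \<pi> = k" using permutes_inv_o(2)[OF \<pi>] by (simp add: o_assoc[symmetric])
    show "(k \<circ> \<pi>) \<circ> inv \<pi> = k" using permutes_inv_o(1)[OF \<pi>] by (simp add: o_assoc[symmetric])
    show "k \<circ> inv \<pi> \<in> compositions ?I m" "k \<circ> \<pi> \<in> compositions ?I m"
      using comp[OF k] \<pi> permutes_inv[OF \<pi>] by auto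
    have "exponent k = h (exponent (k \<circ> inv \<pi>))" using h[of "k \<circ> inv \<pi>"] i1 by simp
    then show "(if exponent (k \<circ> inv \<pi>) = e then a * weight n q t (k \<circ> inv \<pi>) else 0)
      = (if exponent k = h e then a * weight n q t k else 0)"
      using w[of "k \<circ> inv \<pi>"] i1 injD[OF inj] by auto
  qed
qed

lemma G_laurent_weyl_invariant: "weyl_invariant n (G_laurent n q t m a)"
  unfolding weyl_invariant_def
proof (intro conjI allI impI)
  fix \<sigma> :: "nat \<Rightarrow> nat" and e :: "nat \<Rightarrow> int" assume \<sigma>: "\<sigma> permutes {..<n}"
  define \<pi> where "\<pi> = (\<lambda>p :: nat \<times> bool. (\<sigma> (fst p), snd p))"
  have "\<pi> permutes {..<n} \<times> UNIV"
    unfolding permutes_def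
  proof (intro conjI allI impI)
    fix p assume "p \<notin> {..<n} \<times> (UNIV :: bool set)"
    then show "\<pi> p = p" using \<sigma> by (cases p) (auto simp: \<pi>_def permutes_not_in)
  next
    fix p :: "nat \<times> bool"
    show "\<exists>!p'. \<pi> p' = p"
    proof (rule ex1I[of _ "(inv \<sigma> (fst p), snd p)"])
      show "\<pi> (inv \<sigma> (fst p), snd p) = p" using \<sigma> by (simp add: \<pi>_def permutes_inverses)
      fix p' assume "\<pi> p' = p"
      then show "p' = (inv \<sigma> (fst p), snd p)" using \<sigma> by (auto simp: \<pi>_def permutes_inverses)
    qed
  qed
  moreover have "inj (\<lambda>e :: nat \<Rightarrow> int. e \<circ> \<sigma>)"
    using permutes_surj[OF \<sigma>] by (auto intro!: injI simp: fun_eq_iff) (metis surjD)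
  ultimately show "Poly_Mapping.lookup (G_laurent n q t m a) (e \<circ> \<sigma>) = Poly_Mapping.lookup (G_laurent n q t m a) e"
    by (intro lookup_G_laurent_permute[where h = "\<lambda>e. e \<circ> \<sigma>"]) (auto simp: exponent_def \<pi>_def)
next
  fix i and e :: "nat \<Rightarrow> int" assume i: "i < n"
  define \<pi> where "\<pi> = Transposition.transpose (i, True) (i, False)"
  show "Poly_Mapping.lookup (G_laurent n q t m a) (e(i := - e i)) = Poly_Mapping.lookup (G_laurent n q t m a) e"
  proof (rule lookup_G_laurent_permute[where h = "\<lambda>e. e(i := - e i)"])
    show "\<pi> permutes {..<n} \<times> UNIV" unfolding \<pi>_def by (rule permutes_swap_id) (use i in auto)
    show "exponent (k \<circ> \<pi>) = (exponent k)(i := - exponent k i)" for k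
      by (auto simp: exponent_def \<pi>_def Transposition.transpose_def fun_eq_iff)
    show "inj (\<lambda>e :: nat \<Rightarrow> int. e(i := - e i))"
      by (rule injI) (metis fun_upd_same fun_upd_triv fun_upd_upd minus_minus)
  qed
qed

lemma weyl_invariant_sum: "(\<And>a. a \<in> A \<Longrightarrow> weyl_invariant n (p a)) \<Longrightarrow> weyl_invariant n (\<Sum>a\<in>A. p a)"
  unfolding weyl_invariant_def lookup_sum by (auto intro!: sum.cong)

definition row_laurent :: "nat \<Rightarrow> complex \<Rightarrow> complex \<Rightarrow> nat \<Rightarrow> (nat \<Rightarrow> complex) \<Rightarrow> laurent" where
  "row_laurent n q t r a = (\<Sum>j\<le>r div 2. G_laurent n q t (r - 2 * j) (a j))"

lemma leval_row_laurent:
  assumes "\<And>i. i < n \<Longrightarrow> x i \<noteq> 0"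
  shows "leval n (row_laurent n q t r a) x = (\<Sum>j\<le>r div 2. a j * fps_nth (kernel_fps n q t x) (r - 2 * j))"
  by (simp add: row_laurent_def leval_sum leval_G_laurent assms)

lemma row_laurent_weyl_invariant: "weyl_invariant n (row_laurent n q t r a)"
  unfolding row_laurent_def by (intro weyl_invariant_sum G_laurent_weyl_invariant)

lemma sum_abs_exponent_le: "(\<Sum>i<n. nat \<bar>exponent k i\<bar>) \<le> sum k ({..<n} \<times> UNIV)"
proof -
  have "sum k ({..<n} \<times> UNIV) = (\<Sum>i<n. \<Sum>s\<in>UNIV. k (i, s))"
    by (simp only: sum.cartesian_product case_prod_unfold prod.collapse)
  also have "\<dots> \<ge> (\<Sum>i<n. nat \<bar>exponent k i\<bar>)"
    by (rule sum_mono) (auto simp: UNIV_bool exponent_def)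
  finally show ?thesis .
qed

lemma keys_row_laurent:
  assumes "e \<in> Poly_Mapping.keys (row_laurent n q t r a)"
  shows "\<forall>i\<ge>n. e i = 0" and "(\<Sum>i<n. nat \<bar>e i\<bar>) \<le> r"
proof -
  have "(\<Sum>j\<le>r div 2. Poly_Mapping.lookup (G_laurent n q t (r - 2 * j) (a j)) e) \<noteq> 0"
    using assms unfolding row_laurent_def by (simp add: in_keys_iff lookup_sum)
  then obtain j where "Poly_Mapping.lookup (G_laurent n q t (r - 2 * j) (a j)) e \<noteq> 0"
    by (rule sum.not_neutral_contains_not_neutral)
  then obtain k where k: "k \<in> compositions ({..<n} \<times> UNIV) (r - 2 * j)"
    "(if exponent k = e then a j * weight n q t k else 0) \<noteq> 0"
    unfolding lookup_G_laurent by (rule sum.not_neutral_contains_not_neutral)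
  then have k: "k \<in> compositions ({..<n} \<times> UNIV) (r - 2 * j)" "exponent k = e"
    by (auto split: if_splits)
  show "\<forall>i\<ge>n. e i = 0" using k by (auto simp: compositions_def exponent_def)
  show "(\<Sum>i<n. nat \<bar>e i\<bar>) \<le> r"
    using sum_abs_exponent_le[of k n] k by (simp add: compositions_def)
qed

lemma one_row_orbitE:
  assumes "e \<in> weyl_orbit n (one_row r)" and n: "n \<ge> 1"
  obtains i0 S where "i0 < n" "exponent (\<lambda>p. if p = (i0, S) then r else 0) = e"
proof -
  obtain \<sigma> s where \<sigma>: "\<sigma> permutes {..<n}" and s: "\<forall>i. s i \<in> {1, - 1 :: int}"
    and e: "e = (\<lambda>i. s i * int (one_row r (\<sigma> i)))"
    using assms by (auto simp: weyl_orbit_def)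
  define i0 where "i0 = inv \<sigma> 0"
  have \<sigma>0: "\<sigma> i = 0 \<longleftrightarrow> i = i0" for i
    unfolding i0_def using permutes_inv_eq[OF \<sigma>, of 0 i] by auto
  have "i0 < n"
    using permutes_in_image[OF permutes_inv[OF \<sigma>], of 0] n by (auto simp: i0_def)
  moreover have "exponent (\<lambda>p. if p = (i0, s i0 = 1) then r else 0) = e"
    unfolding e exponent_def one_row_def \<sigma>0 using s[rule_format, of i0] by (auto simp: fun_eq_iff)
  ultimately show ?thesis using that by blast
qed

text \<open>An exponent of size r concentrated in one variable arises only by putting all of r into
  one factor of \<Pi>, hence only from j = 0. The prefactor (q;q)_r / (t;q)_r of the theorem is the
  inverse of the coefficient found here.\<close>

lemma lookup_row_laurent_leading:
  assumes "e \<in> weyl_orbit n (one_row r)" and n: "n \<ge> 1"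
  shows "Poly_Mapping.lookup (row_laurent n q t r a) e = a 0 * (qpoch t q r / qpoch q q r)"
proof -
  obtain i0 S where i0: "i0 < n" and e: "exponent (\<lambda>p. if p = (i0, S) then r else 0) = e"
    using one_row_orbitE[OF assms] .
  define k0 where "k0 = (\<lambda>p. if p = (i0, S) then r else 0)"
  let ?I = "{..<n} \<times> (UNIV :: bool set)"
  have mem: "(i0, S) \<in> ?I" using i0 by simp
  have uniq: "m = r \<and> k = k0" if k: "k \<in> compositions ?I m" and m: "m \<le> r" and ek: "exponent k = e" for k m
  proof -
    have "exponent k i0 = exponent k0 i0" using ek e by (simp add: k0_def)
    then have "k (i0, S) \<ge> r" by (cases S) (auto simp: exponent_def k0_def)
    moreover have "sum k ?I = k (i0, S) + sum k (?I - {(i0, S)})"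
      by (rule sum.remove) (use mem in auto)
    moreover have "sum k ?I = m" using k by (simp add: compositions_def)
    ultimately have *: "k (i0, S) = r" "sum k (?I - {(i0, S)}) = 0" "m = r" using m by linarith+
    then have 1: "k p = 0" if "p \<in> ?I - {(i0, S)}" for p using that by simp
    have 2: "k p = 0" if "p \<notin> ?I" for p using that k unfolding compositions_def by blast
    have "k p = k0 p" for p
      using *(1) 1[of p] 2[of p] by (cases "p = (i0, S)"; cases "p \<in> ?I") (simp_all add: k0_def)
    then show ?thesis using * by auto
  qed
  have k0: "k0 \<in> compositions ?I r"
    using mem by (auto simp: compositions_def k0_def)
  have "weight n q t k0 = (\<Prod>p\<in>?I. if p = (i0, S) then qpoch t q r / qpoch q q r else 1)"
    unfolding weight_def by (rule prod.cong) (auto simp: k0_def)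
  also have "\<dots> = qpoch t q r / qpoch q q r" using mem by (subst prod.delta) auto
  finally have w: "weight n q t k0 = qpoch t q r / qpoch q q r" .
  have summand: "Poly_Mapping.lookup (G_laurent n q t (r - 2 * j) (a j)) e =
      (if j = 0 then a 0 * (qpoch t q r / qpoch q q r) else 0)" if "j \<le> r div 2" for j
  proof (cases "j = 0")
    case True
    have "(\<Sum>k\<in>compositions ?I r. if exponent k = e then a 0 * weight n q t k else 0)
        = (\<Sum>k\<in>compositions ?I r. if k = k0 then a 0 * weight n q t k0 else 0)"
    proof (rule sum.cong[OF refl])
      fix k assume k: "k \<in> compositions ?I r"
      have "exponent k = e \<longleftrightarrow> k = k0"
        using uniq[OF k order_refl] e[folded k0_def] by blast
      then show "(if exponent k = e then a 0 * weight n q t k else 0) = (if k = k0 then a 0 * weight n q t k0 else 0)"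
        by simp
    qed
    also have "\<dots> = a 0 * weight n q t k0" using k0 by (simp add: finite_compositions)
    finally show ?thesis by (simp add: True lookup_G_laurent w)
  next
    case False
    then have "r - 2 * j < r" using that by auto
    then have "exponent k \<noteq> e" if "k \<in> compositions ?I (r - 2 * j)" for k
      using uniq[OF that] by linarith
    then show ?thesis using False unfolding lookup_G_laurent by (simp add: sum.neutral)
  qed
  have "Poly_Mapping.lookup (row_laurent n q t r a) e =
      (\<Sum>j\<le>r div 2. if j = 0 then a 0 * (qpoch t q r / qpoch q q r) else 0)"
    unfolding row_laurent_def lookup_sum by (rule sum.cong) (auto simp: summand)
  then show ?thesis by simp
qed

lemma finite_weyl_orbit_one_row:
  assumes "n \<ge> 1"
  shows "finite (weyl_orbit n (one_row r))"
proof (rule finite_subset)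
  show "weyl_orbit n (one_row r) \<subseteq> {e. \<forall>i. (i \<in> {..<n} \<longrightarrow> e i \<in> {- int r..int r}) \<and> (i \<notin> {..<n} \<longrightarrow> e i = 0)}"
  proof
    fix e assume "e \<in> weyl_orbit n (one_row r)"
    from one_row_orbitE[OF this assms] obtain i0 S where
      "i0 < n" "exponent (\<lambda>p. if p = (i0, S) then r else 0) = e" .
    then show "e \<in> {e. \<forall>i. (i \<in> {..<n} \<longrightarrow> e i \<in> {- int r..int r}) \<and> (i \<notin> {..<n} \<longrightarrow> e i = 0)}"
      by (auto simp: exponent_def)
  qed
  show "finite {e. \<forall>i. (i \<in> {..<n} \<longrightarrow> e i \<in> {- int r..int r}) \<and> (i \<notin> {..<n} \<longrightarrow> e i = 0)}"
    by (rule finite_set_of_finite_funs) auto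
qed

lemma lookup_orbit_sum:
  assumes "finite (weyl_orbit n \<mu>)"
  shows "Poly_Mapping.lookup (orbit_sum n \<mu>) e = (if e \<in> weyl_orbit n \<mu> then 1 else 0)"
  unfolding orbit_sum_def lookup_sum using assms by (simp add: lookup_single when_def)

lemma weyl_orbit_of_exponent:
  fixes e :: "nat \<Rightarrow> int"
  assumes "\<forall>i\<ge>n. e i = 0"
  obtains \<nu> where "is_partition n \<nu>" "e \<in> weyl_orbit n \<nu>" "(\<Sum>i<n. \<nu> i) = (\<Sum>i<n. nat \<bar>e i\<bar>)"
proof -
  define xs where "xs = map (\<lambda>i. nat \<bar>e i\<bar>) [0..<n]"
  define ys where "ys = rev (sort xs)"
  have len: "length xs = n" "length ys = n" by (auto simp: xs_def ys_def)
  have "mset xs = mset ys" by (simp add: ys_def)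
  then obtain \<sigma> where \<sigma>: "\<sigma> permutes {..<length ys}" "permute_list \<sigma> ys = xs"
    by (rule mset_eq_permutation)
  define \<nu> where "\<nu> i = (if i < n then ys ! i else 0)" for i
  have val: "\<nu> (\<sigma> i) = nat \<bar>e i\<bar>" for i
  proof (cases "i < n")
    case True
    then have "\<sigma> i < n" using permutes_in_image[OF \<sigma>(1), of i] len by simp
    moreover have "ys ! \<sigma> i = xs ! i" using \<sigma> True len by (metis permute_list_nth)
    ultimately show ?thesis using True by (simp add: \<nu>_def xs_def)
  next
    case False
    then show ?thesis using \<sigma>(1) assms len by (simp add: \<nu>_def permutes_not_in)
  qed
  show ?thesis
  proof
    have "\<nu> j \<le> \<nu> i" if "i \<le> j" for i j
      using that sorted_rev_nth_mono[of ys i j] len by (auto simp: \<nu>_def ys_def)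
    then show "is_partition n \<nu>" by (auto simp: is_partition_def \<nu>_def intro!: antimonoI)
    have "e = (\<lambda>i. (if e i < 0 then - 1 else 1) * int (\<nu> (\<sigma> i)))"
      unfolding val by auto
    then show "e \<in> weyl_orbit n \<nu>"
      unfolding weyl_orbit_def mem_Collect_eq
      by (intro exI[of _ \<sigma>] exI[of _ "\<lambda>i. if e i < 0 then - 1 else 1"]) (use \<sigma>(1) len in auto)
    show "(\<Sum>i<n. \<nu> i) = (\<Sum>i<n. nat \<bar>e i\<bar>)"
      unfolding val[symmetric] using sum.permute[OF \<sigma>(1), of \<nu>] len by (simp add: o_def)
  qed
qed

lemma sum_one_row: "(\<Sum>i<k. one_row r i) = (if k = 0 then 0 else r)"
  by (simp add: one_row_def)

text \<open>The partial sums of (r) equal r from the first one on, so bounding the total size bounds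
  every partial sum.\<close>

lemma dominance_less_one_rowI:
  assumes "\<nu> \<noteq> one_row r" "(\<Sum>i<n. \<nu> i) \<le> r"
  shows "dominance_less n \<nu> (one_row r)"
  unfolding dominance_less_def sum_one_row
proof (intro conjI allI impI)
  fix k assume "k \<le> n"
  then have "(\<Sum>i<k. \<nu> i) \<le> (\<Sum>i<n. \<nu> i)" by (intro sum_mono2) auto
  then show "(\<Sum>i<k. \<nu> i) \<le> (if k = 0 then 0 else r)" using assms(2) by auto
qed (rule assms)

text \<open>The polynomial is \<psi>(\<Pi>) for a linear functional \<psi> on series in u. As D_x
  acts on x alone, it passes through \<psi>, becomes S^2 minus a constant by
  \<open>kernel_operator\<close>, and \<psi> composed with S is a multiple of \<psi> by
  \<open>functional_eigen\<close>.\<close>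

lemma row_laurent_is_koornwinder:
  fixes b q t :: complex and n r :: nat
  assumes n: "n \<ge> 1" and q1: "norm q < 1" and nz: "b \<noteq> 0" "q \<noteq> 0" "t \<noteq> 0"
    and t_nz: "qpoch t q r \<noteq> 0"
    and s: "t ^ n * q ^ r * s = 1" and s1: "s \<noteq> 1"
    and den: "qpoch (s * t * q / b) q (r div 2) \<noteq> 0"
    and a: "\<And>j. a j = qpoch q q r / qpoch t q r * (qpoch (b / t) q j * qpoch s q j /
      (qpoch q q j * qpoch (s * t * q / b) q j) * ((1 - s * q ^ (2 * j)) / (1 - s)) * (t\<^sup>2 / (q * b)) ^ j)"
  shows "is_koornwinder n (- csqrt b) (csqrt b) (- (csqrt q * csqrt b)) (csqrt q * csqrt b) q t
    (one_row r) (row_laurent n q t r a)"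
  unfolding is_koornwinder_def
proof (intro conjI ballI)
  let ?P = "row_laurent n q t r a"
  show "in_vars n ?P" using keys_row_laurent(1) unfolding in_vars_def by blast
  show "weyl_invariant n ?P" by (rule row_laurent_weyl_invariant)
  have a0: "a 0 * (qpoch t q r / qpoch q q r) = 1"
    using s1 t_nz qpoch_q_nonzero[OF q1] by (simp add: a)
  fix e assume e: "e \<in> Poly_Mapping.keys (?P - orbit_sum n (one_row r))"
  then have ne: "Poly_Mapping.lookup ?P e \<noteq> Poly_Mapping.lookup (orbit_sum n (one_row r)) e"
    by (simp add: in_keys_iff lookup_minus)
  then have orb: "e \<notin> weyl_orbit n (one_row r)"
    using lookup_row_laurent_leading[OF _ n, of e r q t a] a0
      lookup_orbit_sum[OF finite_weyl_orbit_one_row[OF n], of r e] by auto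
  then have "e \<in> Poly_Mapping.keys ?P"
    using ne lookup_orbit_sum[OF finite_weyl_orbit_one_row[OF n], of r e] by (simp add: in_keys_iff)
  note keys = keys_row_laurent[OF this]
  obtain \<nu> where \<nu>: "is_partition n \<nu>" "e \<in> weyl_orbit n \<nu>" "(\<Sum>i<n. \<nu> i) = (\<Sum>i<n. nat \<bar>e i\<bar>)"
    using weyl_orbit_of_exponent[OF keys(1)] .
  moreover have "dominance_less n \<nu> (one_row r)"
    by (rule dominance_less_one_rowI) (use \<nu> keys(2) orb in auto)
  ultimately show "\<exists>\<nu>. is_partition n \<nu> \<and> dominance_less n \<nu> (one_row r) \<and> e \<in> weyl_orbit n \<nu>" by blast
next
  let ?P = "row_laurent n q t r a"
  define \<beta> where "\<beta> = b * t ^ (n - 1)"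
  define p where "p = csqrt q"
  have p: "p\<^sup>2 = q" "p \<noteq> 0" using nz by (auto simp: p_def)
  define ev where "ev = \<beta> * p ^ r + 1 / p ^ r"
  define S where "S = half_shift \<beta> b t q p"
  define \<psi> where "\<psi> f = (\<Sum>j\<le>r div 2. a j * fps_nth f (r - 2 * j))" for f :: "complex fps"
  have tn: "\<beta> * t * q ^ r * s = b"
  proof -
    have "t ^ (n - 1) * t = t ^ n" using n by (simp add: power_eq_if)
    then have "\<beta> * t * q ^ r * s = b * (t ^ n * q ^ r * s)" by (simp add: \<beta>_def mult_ac)
    then show ?thesis using s by simp
  qed
  have \<psi>_eigen: "\<psi> (S f) = ev * \<psi> f" for f
    using functional_eigen[OF nz(1,3,2) p(2,1) q1 tn s1 den, of f]
    unfolding \<psi>_def a S_def ev_def mult.assoc sum_distrib_left[symmetric] by (simp add: mult.left_commute)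
  have \<psi>_add: "\<psi> (f + g) = \<psi> f + \<psi> g" and \<psi>_diff: "\<psi> (f - g) = \<psi> f - \<psi> g" and \<psi>_scale: "\<psi> (fps_const c * f) = c * \<psi> f" for f g c
    by (simp_all add: \<psi>_def distrib_left right_diff_distrib sum.distrib sum_subtractf sum_distrib_left mult.left_commute)
  have \<psi>_sum: "\<psi> (\<Sum>i\<in>A. f i) = (\<Sum>i\<in>A. \<psi> (f i))" for A and f :: "nat \<Rightarrow> complex fps"
    by (induction A rule: infinite_finite_induct) (simp_all add: \<psi>_add, simp_all add: \<psi>_def)
  \<comment> \<open>The numerator is \<beta>^2 (q^r - 1) + q^(-r) - 1, so up to the sign of
    \<open>csqrt (b\<^sup>2)\<close> this is the value of \<open>eigenvalue_C\<close> at
    (r).\<close>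
  define E where "E = (ev\<^sup>2 - (1 + \<beta>)\<^sup>2) / (csqrt (b\<^sup>2) * t ^ (n - 1))"
  show "\<exists>E. \<forall>x. regular_point n q x \<longrightarrow>
        koornwinder_op n (- csqrt b) (csqrt b) (- (csqrt q * csqrt b)) (csqrt q * csqrt b) q t (leval n ?P) x
      = E * leval n ?P x"
  proof (intro exI[of _ E] allI impI)
    fix x assume reg: "regular_point n q x"
    have x0: "x i \<noteq> 0" if "i < n" for i using reg that by (auto simp: regular_point_def)
    let ?K = "kernel_fps n q t"
    have lev: "leval n ?P y = \<psi> (?K y)" if "\<And>i. i < n \<Longrightarrow> y i \<noteq> 0" for y
      using leval_row_laurent[OF that] by (simp add: \<psi>_def)
    have lev_x: "leval n ?P x = \<psi> (?K x)" by (rule lev) (rule x0)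
    have lev_up: "leval n ?P (x(i := q * x i)) = \<psi> (?K (x(i := q * x i)))"
      and lev_down: "leval n ?P (x(i := x i / q)) = \<psi> (?K (x(i := x i / q)))" if "i < n" for i
      by (rule lev; use x0 nz that in auto)+
    have "(\<Sum>i<n. coeff_C b q t n x i (x i) * (leval n ?P (x(i := q * x i)) - leval n ?P x)
        + coeff_C b q t n x i (1 / x i) * (leval n ?P (x(i := x i / q)) - leval n ?P x))
      = \<psi> (\<Sum>i<n. fps_const (coeff_C b q t n x i (x i)) * (?K (x(i := q * x i)) - ?K x)
        + fps_const (coeff_C b q t n x i (1 / x i)) * (?K (x(i := x i / q)) - ?K x))"
      unfolding \<psi>_sum \<psi>_add \<psi>_scale \<psi>_diff lev_x
      by (rule sum.cong) (auto simp: lev_up lev_down)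
    also have "\<dots> = \<psi> (S (S (?K x)) - fps_const ((1 + \<beta>)\<^sup>2) * ?K x)"
      unfolding kernel_operator[OF nz(1,3,2) p(2,1) n q1 reg] S_def \<beta>_def ..
    also have "\<dots> = (ev\<^sup>2 - (1 + \<beta>)\<^sup>2) * \<psi> (?K x)"
      unfolding \<psi>_diff \<psi>_scale \<psi>_eigen by (simp add: power2_eq_square algebra_simps)
    finally show "koornwinder_op n (- csqrt b) (csqrt b) (- (csqrt q * csqrt b)) (csqrt q * csqrt b) q t (leval n ?P) x
      = E * leval n ?P x"
      unfolding koornwinder_op_C[OF nz(2) reg] E_def lev_x by simp
  qed
qed

section \<open>Leading exponents and uniqueness\<close>

lemma tendsto_power_at_0:
  fixes k :: nat
  assumes "k > 0"
  shows "((\<lambda>z::complex. z ^ k) \<longlongrightarrow> 0) (at 0)"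
proof -
  have "((\<lambda>z::complex. z ^ k) \<longlongrightarrow> 0 ^ k) (at 0)" by (intro tendsto_intros)
  moreover have "(0::complex) ^ k = 0" using assms by simp
  ultimately show ?thesis by (simp only:)
qed

lemma eventually_power_neq_at_0:
  assumes "k > 0" "(c::complex) \<noteq> 0"
  shows "eventually (\<lambda>z. z ^ k \<noteq> c) (at 0)"
  using tendsto_imp_eventually_ne[OF tendsto_power_at_0[OF assms(1)], of c] assms(2) by simp

text \<open>The building block of the products in D_x. Along the curve below its argument tends to 0
  or to infinity, so only the limits 1 and t occur.\<close>

definition ratio :: "complex \<Rightarrow> complex \<Rightarrow> complex" where
  "ratio t w = (1 - t * w) / (1 - w)"

lemma tendsto_ratio_0:
  assumes "k > 0"
  shows "((\<lambda>z. ratio t (z ^ k)) \<longlongrightarrow> 1) (at 0)"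
proof -
  have "((\<lambda>z. ratio t (z ^ k)) \<longlongrightarrow> (1 - t * 0) / (1 - 0)) (at 0)"
    unfolding ratio_def by (intro tendsto_intros tendsto_power_at_0 assms) auto
  then show ?thesis by simp
qed

lemma tendsto_ratio_infinity:
  assumes "k > 0"
  shows "((\<lambda>z. ratio t (1 / z ^ k)) \<longlongrightarrow> t) (at 0)"
proof -
  have "((\<lambda>z. (z ^ k - t) / (z ^ k - 1)) \<longlongrightarrow> (0 - t) / (0 - 1)) (at (0::complex))"
    by (intro tendsto_intros tendsto_power_at_0 assms) auto
  moreover have "eventually (\<lambda>z. (z ^ k - t) / (z ^ k - 1) = ratio t (1 / z ^ k)) (at 0)"
    using eventually_neq_at_within[of "0::complex"] eventually_power_neq_at_0[OF assms one_neq_zero]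
  proof eventually_elim
    case (elim z)
    then show ?case by (simp add: ratio_def divide_simps)
  qed
  ultimately have "((\<lambda>z. ratio t (1 / z ^ k)) \<longlongrightarrow> (0 - t) / (0 - 1)) (at 0)"
    by (rule Lim_transform_eventually)
  then show ?thesis by simp
qed

text \<open>The test curve: as z -> 0 the coordinates tend to infinity at rates set by
  \<open>N\<close>. Integral powers of one complex variable keep all limits at the single point
  0.\<close>

definition scaled_point :: "(nat \<Rightarrow> nat) \<Rightarrow> complex \<Rightarrow> nat \<Rightarrow> complex" where
  "scaled_point N z i = 1 / z ^ N i"

lemma coeff_C_ratio:
  assumes "\<And>j. j < n \<Longrightarrow> x j \<noteq> 0"
  shows "coeff_C b q t n x i z = (1 - b * z\<^sup>2) * (1 - q * b * z\<^sup>2) / ((1 - z\<^sup>2) * (1 - q * z\<^sup>2))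
     * (\<Prod>j\<in>{..<n} - {i}. ratio t (z * x j) * ratio t (z / x j))"
proof -
  have "(\<Prod>j\<in>{..<n} - {i}. poly (kern t (x j)) z / poly (kern 1 (x j)) z)
     = (\<Prod>j\<in>{..<n} - {i}. ratio t (z * x j) * ratio t (z / x j))"
    by (rule prod.cong) (use assms in \<open>auto simp: poly_kern ratio_def mult.assoc\<close>)
  then show ?thesis by (simp only: coeff_C_def)
qed

text \<open>On the curve the monomial x^e equals z^(-height), so the largest height marks the
  dominant monomial.\<close>

definition height :: "nat \<Rightarrow> (nat \<Rightarrow> nat) \<Rightarrow> (nat \<Rightarrow> int) \<Rightarrow> int" where
  "height n N e = (\<Sum>i<n. int (N i) * e i)"

lemma scaled_monomial:
  assumes "z \<noteq> 0" "i < n"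
  shows "(\<Prod>j<n. ((scaled_point N z)(i := c * scaled_point N z i)) j powi e j) = c powi e i * z powi (- height n N e)"
proof -
  have pw: "scaled_point N z j powi e j = z powi (- (int (N j) * e j))" for j
    by (simp add: scaled_point_def power_int_divide_distrib power_int_mult power_int_minus power_int_inverse divide_inverse)
  have sum: "(\<Prod>j\<in>A. z powi (f j)) = z powi (\<Sum>j\<in>A. f j)" for A and f :: "nat \<Rightarrow> int"
    by (induction A rule: infinite_finite_induct) (auto simp: power_int_add assms)
  have "(\<Prod>j<n. ((scaled_point N z)(i := c * scaled_point N z i)) j powi e j)
      = (\<Prod>j<n. (if j = i then c powi e i else 1) * scaled_point N z j powi e j)"
    by (rule prod.cong) (auto simp: power_int_mult_distrib)
  also have "\<dots> = c powi e i * (\<Prod>j<n. scaled_point N z j powi e j)"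
    using assms(2) by (simp add: prod.distrib)
  also have "(\<Prod>j<n. scaled_point N z j powi e j) = z powi (- height n N e)"
    unfolding pw sum height_def by (simp add: sum_negf)
  finally show ?thesis .
qed

text \<open>After normalization every other monomial carries a positive power of z. The scalar
  \<open>c\<close> will be q, 1/q and 1, covering the shifted and unshifted arguments in
  D_x.\<close>

lemma tendsto_leval_scaled:
  assumes i: "i < n" and e0: "e0 \<in> Poly_Mapping.keys p"
    and max: "\<And>e. e \<in> Poly_Mapping.keys p \<Longrightarrow> e \<noteq> e0 \<Longrightarrow> height n N e < height n N e0"
  shows "((\<lambda>z. z powi height n N e0 * leval n p ((scaled_point N z)(i := c * scaled_point N z i)))
     \<longlongrightarrow> Poly_Mapping.lookup p e0 * c powi e0 i) (at 0)"
proof -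
  have lim: "((\<lambda>z::complex. z ^ nat (height n N e0 - height n N e)) \<longlongrightarrow> (if e = e0 then 1 else 0)) (at 0)"
    if "e \<in> Poly_Mapping.keys p" for e
    using max[OF that] by (auto intro!: tendsto_power_at_0)
  have "((\<lambda>z. \<Sum>e\<in>Poly_Mapping.keys p. Poly_Mapping.lookup p e * c powi e i * z ^ nat (height n N e0 - height n N e))
     \<longlongrightarrow> (\<Sum>e\<in>Poly_Mapping.keys p. Poly_Mapping.lookup p e * c powi e i * (if e = e0 then 1 else 0))) (at 0)"
    by (intro tendsto_sum tendsto_mult_left lim)
  also have "(\<Sum>e\<in>Poly_Mapping.keys p. Poly_Mapping.lookup p e * c powi e i * (if e = e0 then 1 else 0))
      = Poly_Mapping.lookup p e0 * c powi e0 i"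
    using e0 by (simp add: sum.remove[of _ e0] mult_delta_right)
  finally have "((\<lambda>z. \<Sum>e\<in>Poly_Mapping.keys p. Poly_Mapping.lookup p e * c powi e i * z ^ nat (height n N e0 - height n N e))
     \<longlongrightarrow> Poly_Mapping.lookup p e0 * c powi e0 i) (at 0)" .
  moreover have "eventually (\<lambda>z. (\<Sum>e\<in>Poly_Mapping.keys p. Poly_Mapping.lookup p e * c powi e i * z ^ nat (height n N e0 - height n N e))
      = z powi height n N e0 * leval n p ((scaled_point N z)(i := c * scaled_point N z i))) (at 0)"
    using eventually_neq_at_within[of "0::complex"]
  proof eventually_elim
    case (elim z)
    have "z ^ nat (height n N e0 - height n N e) = z powi height n N e0 * z powi (- height n N e)" if "e \<in> Poly_Mapping.keys p" for e
    proof -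
      have "height n N e \<le> height n N e0" using max[OF that] by (cases "e = e0") auto
      then have "z ^ nat (height n N e0 - height n N e) = z powi (height n N e0 - height n N e)"
        by (simp add: power_int_def)
      then show ?thesis using elim by (simp add: power_int_add[symmetric])
    qed
    then show ?case
      unfolding leval_def scaled_monomial[OF elim i] sum_distrib_left
      by (intro sum.cong) (simp_all add: mult_ac)
  qed
  ultimately show ?thesis by (rule Lim_transform_eventually)
qed

section \<open>Asymptotics of the operator in the region x_1 >> x_2 >> ... >> x_n >> 1\<close>

context
  fixes n :: nat and N :: "nat \<Rightarrow> nat"
  assumes N_pos: "\<And>i. i < n \<Longrightarrow> N i > 0"
    and N_less: "\<And>i j. i < j \<Longrightarrow> j < n \<Longrightarrow> N j < N i"
begin

lemma tendsto_ratio_quotient: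
  assumes "i < n" "j < n" "i \<noteq> j"
  shows "((\<lambda>z. ratio t (scaled_point N z i / scaled_point N z j)) \<longlongrightarrow> (if i < j then t else 1)) (at 0)"
proof (cases "i < j")
  case True
  then have k: "N j < N i" using N_less assms by simp
  have "eventually (\<lambda>z. ratio t (1 / z ^ (N i - N j)) = ratio t (scaled_point N z i / scaled_point N z j)) (at 0)"
    using eventually_neq_at_within[of "0::complex"]
    by eventually_elim (use k in \<open>simp add: scaled_point_def power_diff\<close>)
  then have "((\<lambda>z. ratio t (scaled_point N z i / scaled_point N z j)) \<longlongrightarrow> t) (at 0)"
    by (rule Lim_transform_eventually[rotated]) (use k in \<open>intro tendsto_ratio_infinity, simp\<close>)
  then show ?thesis using True by simp
next
  case False
  then have k: "N i < N j" using N_less assms by simp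
  have "eventually (\<lambda>z. ratio t (z ^ (N j - N i)) = ratio t (scaled_point N z i / scaled_point N z j)) (at 0)"
    using eventually_neq_at_within[of "0::complex"]
    by eventually_elim (use k in \<open>simp add: scaled_point_def power_diff\<close>)
  then have "((\<lambda>z. ratio t (scaled_point N z i / scaled_point N z j)) \<longlongrightarrow> 1) (at 0)"
    by (rule Lim_transform_eventually[rotated]) (use k in \<open>intro tendsto_ratio_0, simp\<close>)
  then show ?thesis using False by simp
qed

text \<open>On the curve each excluded coincidence reads z^k = c with k > 0 and c nonzero, or z = 0,
  and so fails in a punctured neighbourhood of 0.\<close>

lemma eventually_regular_point:
  assumes "q \<noteq> 0"
  shows "eventually (\<lambda>z. regular_point n q (scaled_point N z)) (at 0)"
proof -
  have 1: "eventually (\<lambda>z. z ^ (2 * N i) \<noteq> 1 \<and> z ^ (2 * N i) \<noteq> q \<and> z ^ (2 * N i) \<noteq> 1 / q) (at 0)" if "i < n" for i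
    using N_pos[OF that] assms by (intro eventually_conj eventually_power_neq_at_0) auto
  have 2: "eventually (\<lambda>z. z ^ (N j + N i) \<noteq> (1::complex)) (at 0)" if "i < n" for i j
    using N_pos[OF that] by (intro eventually_power_neq_at_0) auto
  have 3: "eventually (\<lambda>z. z ^ (N i - N j) \<noteq> (1::complex)) (at 0)" if "i < j" "j < n" for i j
    using N_less[OF that] by (intro eventually_power_neq_at_0) auto
  have "eventually (\<lambda>z::complex. z \<noteq> 0 \<and> (\<forall>i\<in>{..<n}. z ^ (2 * N i) \<noteq> 1 \<and> z ^ (2 * N i) \<noteq> q \<and> z ^ (2 * N i) \<noteq> 1 / q) \<and>
      (\<forall>i\<in>{..<n}. \<forall>j\<in>{..<n}. z ^ (N j + N i) \<noteq> 1 \<and> (i < j \<longrightarrow> z ^ (N i - N j) \<noteq> 1))) (at 0)"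
    using 1 2 3 eventually_neq_at_within[of "0::complex"]
    by (intro eventually_conj eventually_ball_finite ballI) (auto simp: eventually_conj_iff)
  then show ?thesis
  proof eventually_elim
    case (elim z)
    then have z: "z \<noteq> 0" by simp
    have ne: "scaled_point N z i \<noteq> scaled_point N z j" if "i < j" "j < n" for i j
    proof
      assume "scaled_point N z i = scaled_point N z j"
      then have "z ^ (N i - N j) = 1"
        using z N_less[OF that] by (simp add: scaled_point_def power_diff divide_simps)
      then show False using elim that by auto
    qed
    show ?case unfolding regular_point_def
    proof (intro conjI allI impI)
      fix i assume i: "i < n"
      have sq: "(scaled_point N z i)\<^sup>2 = 1 / z ^ (2 * N i)"
        by (simp add: scaled_point_def power_divide power_mult[symmetric] mult.commute)
      have e: "z ^ (2 * N i) \<noteq> 1" "z ^ (2 * N i) \<noteq> q" "z ^ (2 * N i) \<noteq> 1 / q"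
        using elim i by auto
      show "scaled_point N z i \<noteq> 0" using z by (simp add: scaled_point_def)
      show "(scaled_point N z i)\<^sup>2 \<noteq> 1" "q * (scaled_point N z i)\<^sup>2 \<noteq> 1" "(scaled_point N z i)\<^sup>2 \<noteq> q"
        unfolding sq using z e assms by (auto simp: field_simps)
      fix j assume j: "j < n" and ij: "i \<noteq> j"
      show "scaled_point N z i \<noteq> scaled_point N z j" using ne[of i j] ne[of j i] i j ij by (cases "i < j") auto
      have "z ^ (N j + N i) \<noteq> 1" using elim i j by auto
      then show "scaled_point N z i * scaled_point N z j \<noteq> 1"
        using z by (simp add: scaled_point_def power_add mult.commute)
    qed
  qed
qed

text \<open>Each product x_i x_j contributes t, which gives n - 1 factors; the quotient x_i / x_j
  contributes t exactly for j > i, which gives n - 1 - i more. The front fraction tends to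
  b^2.\<close>

lemma tendsto_coeff_plus:
  assumes i: "i < n" and q: "q \<noteq> 0"
  shows "((\<lambda>z. coeff_C b q t n (scaled_point N z) i (scaled_point N z i)) \<longlongrightarrow> b\<^sup>2 * t ^ (n - 1) * t ^ (n - 1 - i)) (at 0)"
proof -
  have "((\<lambda>z::complex. (z ^ (2 * N i) - b) * (z ^ (2 * N i) - q * b) / ((z ^ (2 * N i) - 1) * (z ^ (2 * N i) - q)))
      \<longlongrightarrow> (0 - b) * (0 - q * b) / ((0 - 1) * (0 - q))) (at 0)"
    by (intro tendsto_intros tendsto_power_at_0) (use q N_pos[OF i] in auto)
  then have lim1: "((\<lambda>z::complex. (z ^ (2 * N i) - b) * (z ^ (2 * N i) - q * b) / ((z ^ (2 * N i) - 1) * (z ^ (2 * N i) - q)))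
      \<longlongrightarrow> b\<^sup>2) (at 0)"
    using q by (simp add: power2_eq_square)
  have "((\<lambda>z. \<Prod>j\<in>{..<n} - {i}. ratio t (1 / z ^ (N i + N j)) * ratio t (scaled_point N z i / scaled_point N z j))
      \<longlongrightarrow> (\<Prod>j\<in>{..<n} - {i}. t * (if i < j then t else 1))) (at 0)"
    using i N_pos[OF i] by (intro tendsto_prod tendsto_mult tendsto_ratio_quotient tendsto_ratio_infinity) auto
  also have "(\<Prod>j\<in>{..<n} - {i}. t * (if i < j then t else 1)) = t ^ (n - 1) * t ^ (n - 1 - i)"
  proof -
    have "(\<Prod>j\<in>{..<n} - {i}. if i < j then t else 1) = (\<Prod>j\<in>{j \<in> {..<n} - {i}. i < j}. t)"
      by (rule prod.inter_filter[symmetric]) simp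
    also have "{j \<in> {..<n} - {i}. i < j} = {Suc i..<n}" by auto
    finally show ?thesis using i by (simp add: prod.distrib)
  qed
  finally have "((\<lambda>z. (z ^ (2 * N i) - b) * (z ^ (2 * N i) - q * b) / ((z ^ (2 * N i) - 1) * (z ^ (2 * N i) - q)) *
      (\<Prod>j\<in>{..<n} - {i}. ratio t (1 / z ^ (N i + N j)) * ratio t (scaled_point N z i / scaled_point N z j)))
      \<longlongrightarrow> b\<^sup>2 * (t ^ (n - 1) * t ^ (n - 1 - i))) (at 0)"
    by (intro tendsto_mult lim1)
  moreover have "eventually (\<lambda>z. (z ^ (2 * N i) - b) * (z ^ (2 * N i) - q * b) / ((z ^ (2 * N i) - 1) * (z ^ (2 * N i) - q)) *
      (\<Prod>j\<in>{..<n} - {i}. ratio t (1 / z ^ (N i + N j)) * ratio t (scaled_point N z i / scaled_point N z j))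
      = coeff_C b q t n (scaled_point N z) i (scaled_point N z i)) (at 0)"
    using eventually_neq_at_within[of "0::complex"]
  proof eventually_elim
    case (elim z)
    define y where "y = z ^ (2 * N i)"
    have y: "y \<noteq> 0" using elim by (simp add: y_def)
    have sq: "(scaled_point N z i)\<^sup>2 = 1 / y"
      by (simp add: y_def scaled_point_def power_divide power_mult[symmetric] mult.commute)
    have m: "scaled_point N z i * scaled_point N z j = 1 / z ^ (N i + N j)" for j
      by (simp add: scaled_point_def power_add)
    have fac: "1 - c * (1 / y) = (y - c) / y" for c using y by (simp add: field_simps)
    have "(1 - b * (1 / y)) * (1 - q * b * (1 / y)) / ((1 - 1 / y) * (1 - q * (1 / y)))
        = (y - b) * (y - q * b) / ((y - 1) * (y - q))"
      unfolding fac fac[of 1, unfolded mult_1_left] using y by simp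
    moreover have "scaled_point N z j \<noteq> 0" for j using elim by (simp add: scaled_point_def)
    ultimately show ?case
      unfolding coeff_C_ratio[where x = "scaled_point N z", OF \<open>\<And>j. scaled_point N z j \<noteq> 0\<close>] sq m y_def[symmetric]
      by (simp only:)
  qed
  ultimately show ?thesis unfolding mult.assoc by (rule Lim_transform_eventually)
qed

text \<open>At z = 1/x_i the products tend to 0 and contribute 1; the quotient x_j / x_i contributes
  t exactly for the i indices j < i.\<close>

lemma tendsto_coeff_minus:
  assumes i: "i < n" and q: "q \<noteq> 0"
  shows "((\<lambda>z. coeff_C b q t n (scaled_point N z) i (1 / scaled_point N z i)) \<longlongrightarrow> t ^ i) (at 0)"
proof -
  have "((\<lambda>z::complex. (1 - b * z ^ (2 * N i)) * (1 - q * b * z ^ (2 * N i)) / ((1 - z ^ (2 * N i)) * (1 - q * z ^ (2 * N i))))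
      \<longlongrightarrow> (1 - b * 0) * (1 - q * b * 0) / ((1 - 0) * (1 - q * 0))) (at 0)"
    by (intro tendsto_intros tendsto_power_at_0) (use N_pos[OF i] in auto)
  then have lim1: "((\<lambda>z::complex. (1 - b * z ^ (2 * N i)) * (1 - q * b * z ^ (2 * N i)) / ((1 - z ^ (2 * N i)) * (1 - q * z ^ (2 * N i))))
      \<longlongrightarrow> 1) (at 0)"
    by simp
  have "((\<lambda>z. \<Prod>j\<in>{..<n} - {i}. ratio t (scaled_point N z j / scaled_point N z i) * ratio t (z ^ (N i + N j)))
      \<longlongrightarrow> (\<Prod>j\<in>{..<n} - {i}. (if j < i then t else 1) * 1)) (at 0)"
    using i N_pos[OF i] by (intro tendsto_prod tendsto_mult tendsto_ratio_quotient tendsto_ratio_0) auto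
  also have "(\<Prod>j\<in>{..<n} - {i}. (if j < i then t else 1) * 1) = t ^ i"
  proof -
    have "(\<Prod>j\<in>{..<n} - {i}. if j < i then t else 1) = (\<Prod>j\<in>{j \<in> {..<n} - {i}. j < i}. t)"
      by (rule prod.inter_filter[symmetric]) simp
    also have "{j \<in> {..<n} - {i}. j < i} = {..<i}" using i by auto
    finally show ?thesis by simp
  qed
  finally have "((\<lambda>z. (1 - b * z ^ (2 * N i)) * (1 - q * b * z ^ (2 * N i)) / ((1 - z ^ (2 * N i)) * (1 - q * z ^ (2 * N i))) *
      (\<Prod>j\<in>{..<n} - {i}. ratio t (scaled_point N z j / scaled_point N z i) * ratio t (z ^ (N i + N j))))
      \<longlongrightarrow> 1 * t ^ i) (at 0)"
    by (intro tendsto_mult lim1)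
  moreover have "eventually (\<lambda>z. (1 - b * z ^ (2 * N i)) * (1 - q * b * z ^ (2 * N i)) / ((1 - z ^ (2 * N i)) * (1 - q * z ^ (2 * N i))) *
      (\<Prod>j\<in>{..<n} - {i}. ratio t (scaled_point N z j / scaled_point N z i) * ratio t (z ^ (N i + N j)))
      = coeff_C b q t n (scaled_point N z) i (1 / scaled_point N z i)) (at 0)"
    using eventually_neq_at_within[of "0::complex"]
  proof eventually_elim
    case (elim z)
    have sq: "(1 / scaled_point N z i)\<^sup>2 = z ^ (2 * N i)"
      by (simp add: scaled_point_def power_mult[symmetric] mult.commute)
    have m: "1 / scaled_point N z i / scaled_point N z j = z ^ (N i + N j)"
        "1 / scaled_point N z i * scaled_point N z j = scaled_point N z j / scaled_point N z i" for j
      by (simp_all add: scaled_point_def power_add)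
    have "scaled_point N z j \<noteq> 0" for j using elim by (simp add: scaled_point_def)
    then show ?case
      unfolding coeff_C_ratio[where x = "scaled_point N z", OF \<open>\<And>j. scaled_point N z j \<noteq> 0\<close>] sq m by (simp only:)
  qed
  ultimately have "((\<lambda>z. coeff_C b q t n (scaled_point N z) i (1 / scaled_point N z i)) \<longlongrightarrow> 1 * t ^ i) (at 0)"
    by (rule Lim_transform_eventually)
  then show ?thesis by simp
qed

text \<open>Multiplied by z to the height of \<open>e0\<close>, both sides of the eigenvalue
  equation converge, and the limit is a scalar equation for the nonzero leading coefficient. The
  factor \<open>b / csqrt (b\<^sup>2)\<close> is the sign left open by the branch of the square
  root.\<close>

lemma eigenvalue_of_leading_exponent:
  assumes n: "n \<ge> 1" and nz: "b \<noteq> 0" "q \<noteq> 0" "t \<noteq> 0"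
    and e0: "e0 \<in> Poly_Mapping.keys p"
    and max: "\<And>e. e \<in> Poly_Mapping.keys p \<Longrightarrow> e \<noteq> e0 \<Longrightarrow> height n N e < height n N e0"
    and \<mu>: "\<And>i. i < n \<Longrightarrow> e0 i = int (\<mu> i)"
    and eig: "\<And>x. regular_point n q x \<Longrightarrow>
      koornwinder_op n (- csqrt b) (csqrt b) (- (csqrt q * csqrt b)) (csqrt q * csqrt b) q t (leval n p) x = E * leval n p x"
  shows "E = b / csqrt (b\<^sup>2) * eigenvalue_C n b q t \<mu>"
proof -
  let ?x = "scaled_point N"
  define \<alpha> where "\<alpha> = csqrt (b\<^sup>2)"
  have \<alpha>: "\<alpha> * \<alpha> = b * b" "\<alpha> \<noteq> 0"
    using power2_csqrt[of "b\<^sup>2"] nz by (auto simp: \<alpha>_def power2_eq_square)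
  define c0 where "c0 = Poly_Mapping.lookup p e0"
  have c0: "c0 \<noteq> 0" using e0 by (simp add: c0_def in_keys_iff)
  define h where "h = (\<lambda>z :: complex. z powi height n N e0)"
  have up: "((\<lambda>z. h z * leval n p ((?x z)(i := q * ?x z i))) \<longlongrightarrow> c0 * q ^ \<mu> i) (at 0)"
    and down: "((\<lambda>z. h z * leval n p ((?x z)(i := ?x z i / q))) \<longlongrightarrow> c0 * (1 / q ^ \<mu> i)) (at 0)"
    and same: "((\<lambda>z. h z * leval n p (?x z)) \<longlongrightarrow> c0) (at 0)" if "i < n" for i
    using tendsto_leval_scaled[OF that e0 max, of q] tendsto_leval_scaled[OF that e0 max, of "1 / q"]
      tendsto_leval_scaled[OF that e0 max, of 1] \<mu>[OF that]
    by (simp_all add: h_def c0_def power_divide)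
  define L where "L = (\<Sum>i<n. b\<^sup>2 * t ^ (n - 1) * t ^ (n - 1 - i) * (c0 * q ^ \<mu> i - c0) + t ^ i * (c0 * (1 / q ^ \<mu> i) - c0)) / (\<alpha> * t ^ (n - 1))"
  have "((\<lambda>z. (\<Sum>i<n. coeff_C b q t n (?x z) i (?x z i) * (h z * leval n p ((?x z)(i := q * ?x z i)) - h z * leval n p (?x z))
        + coeff_C b q t n (?x z) i (1 / ?x z i) * (h z * leval n p ((?x z)(i := ?x z i / q)) - h z * leval n p (?x z))) / (\<alpha> * t ^ (n - 1)))
     \<longlongrightarrow> L) (at 0)"
    unfolding L_def using \<alpha> nz
    by (intro tendsto_divide tendsto_const tendsto_sum tendsto_add tendsto_mult tendsto_diff
        tendsto_coeff_plus tendsto_coeff_minus up down same) auto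
  moreover have "eventually (\<lambda>z. (\<Sum>i<n. coeff_C b q t n (?x z) i (?x z i) * (h z * leval n p ((?x z)(i := q * ?x z i)) - h z * leval n p (?x z))
        + coeff_C b q t n (?x z) i (1 / ?x z i) * (h z * leval n p ((?x z)(i := ?x z i / q)) - h z * leval n p (?x z))) / (\<alpha> * t ^ (n - 1))
      = E * (h z * leval n p (?x z))) (at 0)"
    using eventually_regular_point[OF nz(2)]
  proof eventually_elim
    case (elim z)
    have pull: "(\<Sum>i<n. coeff_C b q t n (?x z) i (?x z i) * (h z * leval n p ((?x z)(i := q * ?x z i)) - h z * leval n p (?x z))
        + coeff_C b q t n (?x z) i (1 / ?x z i) * (h z * leval n p ((?x z)(i := ?x z i / q)) - h z * leval n p (?x z)))
      = h z * (\<Sum>i<n. coeff_C b q t n (?x z) i (?x z i) * (leval n p ((?x z)(i := q * ?x z i)) - leval n p (?x z))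
        + coeff_C b q t n (?x z) i (1 / ?x z i) * (leval n p ((?x z)(i := ?x z i / q)) - leval n p (?x z)))"
      unfolding sum_distrib_left by (rule sum.cong) (simp_all add: algebra_simps)
    note eig_z = eig[OF elim, unfolded koornwinder_op_C[OF nz(2) elim] \<alpha>_def[symmetric]]
    show ?case
      unfolding pull times_divide_eq_right[symmetric] eig_z by (rule mult.left_commute)
  qed
  ultimately have "((\<lambda>z. E * (h z * leval n p (?x z))) \<longlongrightarrow> L) (at 0)"
    by (rule Lim_transform_eventually)
  moreover have "((\<lambda>z. E * (h z * leval n p (?x z))) \<longlongrightarrow> E * c0) (at 0)"
    using n by (intro tendsto_mult_left same[of 0]) simp
  ultimately have "E * c0 = L" by (intro tendsto_unique[of "at (0::complex)"]) simp_all
  also have "L = b / \<alpha> * eigenvalue_C n b q t \<mu> * c0"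
  proof -
    have "b\<^sup>2 * t ^ (n - 1) * t ^ (n - 1 - i) * (c0 * q ^ \<mu> i - c0) + t ^ i * (c0 * (1 / q ^ \<mu> i) - c0)
       = b * t ^ (n - 1) * (c0 * (b * t ^ (n - 1 - i) * (q ^ \<mu> i - 1) + (1 / q ^ \<mu> i - 1) / (b * t ^ (n - 1 - i))))"
      if "i < n" for i
    proof -
      have "n - 1 = (n - 1 - i) + i" using that by simp
      then have "t ^ (n - 1) = t ^ (n - 1 - i) * t ^ i" by (metis power_add)
      \<comment> \<open>Rewriting t^i extracts the common factor b t^(n-1), which cancels the
        prefactor of D_x up to sign and leaves the summands of \<open>eigenvalue_C\<close>.\<close>
      then have "t ^ i = b * t ^ (n - 1) / (b * t ^ (n - 1 - i))" using nz by simp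
      then show ?thesis
        by (simp add: algebra_simps power2_eq_square diff_divide_distrib)
    qed
    then have "L = (\<Sum>i<n. b * t ^ (n - 1) * (c0 * (b * t ^ (n - 1 - i) * (q ^ \<mu> i - 1) + (1 / q ^ \<mu> i - 1) / (b * t ^ (n - 1 - i))))) / (\<alpha> * t ^ (n - 1))"
      unfolding L_def by simp
    also have "\<dots> = b * t ^ (n - 1) * (c0 * eigenvalue_C n b q t \<mu>) / (\<alpha> * t ^ (n - 1))"
      unfolding eigenvalue_C_def sum_distrib_left ..
    finally show ?thesis using nz by simp
  qed
  finally have "E = b / \<alpha> * eigenvalue_C n b q t \<mu>"
    using c0 by (subst (asm) mult_right_cancel)
  then show ?thesis by (simp only: \<alpha>_def)
qed

text \<open>The weights are positive and strictly decreasing, so changing the sign of a negative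
  entry, or swapping two entries in increasing order, would raise the height while staying in the
  support by invariance.\<close>

lemma partition_of_max:
  assumes inv: "in_vars n p" "weyl_invariant n p"
    and e0: "e0 \<in> Poly_Mapping.keys p" and max: "\<And>e. e \<in> Poly_Mapping.keys p \<Longrightarrow> height n N e \<le> height n N e0"
  shows "is_partition n (\<lambda>i. nat (e0 i))" and "e0 = (\<lambda>i. int (nat (e0 i)))"
proof -
  have zero: "e0 i = 0" if "i \<ge> n" for i using inv e0 that by (auto simp: in_vars_def)
  have nonneg: "e0 i \<ge> 0" for i
  proof (cases "i < n")
    case True
    have "e0(i := - e0 i) \<in> Poly_Mapping.keys p"
      using inv(2) e0 True by (simp add: weyl_invariant_def in_keys_iff)
    from max[OF this] have le: "height n N (e0(i := - e0 i)) \<le> height n N e0" .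
    have "height n N (e0(i := - e0 i)) = (\<Sum>j<n. int (N j) * e0 j + (if j = i then - 2 * int (N i) * e0 i else 0))"
      unfolding height_def by (rule sum.cong) auto
    also have "\<dots> = height n N e0 - 2 * int (N i) * e0 i"
      using True by (simp add: sum.distrib height_def)
    finally have "0 \<le> int (N i) * e0 i" using le by linarith
    then show ?thesis using N_pos[OF True] by (simp add: zero_le_mult_iff)
  qed (simp add: zero)
  have mono: "e0 j \<le> e0 i" if "i < j" "j < n" for i j
  proof -
    define \<tau> where "\<tau> = Transposition.transpose i j"
    have "\<tau> permutes {..<n}" unfolding \<tau>_def by (rule permutes_swap_id) (use that in auto)
    then have "e0 \<circ> \<tau> \<in> Poly_Mapping.keys p"
      using inv(2) e0 by (simp add: weyl_invariant_def in_keys_iff)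
    from max[OF this] have le: "height n N (e0 \<circ> \<tau>) \<le> height n N e0" .
    have "height n N (e0 \<circ> \<tau>) = (\<Sum>k<n. int (N k) * e0 k + ((if k = i then int (N i) * (e0 j - e0 i) else 0)
        + (if k = j then int (N j) * (e0 i - e0 j) else 0)))"
      unfolding height_def by (rule sum.cong) (use that in \<open>auto simp: \<tau>_def Transposition.transpose_def algebra_simps\<close>)
    also have "\<dots> = height n N e0 + (int (N i) * (e0 j - e0 i) + int (N j) * (e0 i - e0 j))"
      using that by (simp add: sum.distrib height_def)
    also have "\<dots> = height n N e0 + (int (N i) - int (N j)) * (e0 j - e0 i)"
      by (simp add: algebra_simps)
    finally have "(int (N i) - int (N j)) * (e0 j - e0 i) \<le> 0" using le by simp
    then show ?thesis using N_less[OF that] by (simp add: mult_le_0_iff)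
  qed
  have "nat (e0 j) \<le> nat (e0 i)" if "i \<le> j" for i j
    using mono[of i j] that zero[of j] by (cases "i = j"; cases "j < n") auto
  then show "is_partition n (\<lambda>i. nat (e0 i))"
    using zero by (auto simp: is_partition_def intro!: antimonoI)
  show "e0 = (\<lambda>i. int (nat (e0 i)))" using nonneg by simp
qed

end

text \<open>Uniqueness of signed digits: after division by B all terms but the last digit are
  multiples of B, so B divides a digit smaller than B in absolute value, which is therefore
  0.\<close>

lemma base_expansion_eq_0:
  fixes d :: "nat \<Rightarrow> int" and B :: int
  assumes "B > 0" "\<And>i. i < n \<Longrightarrow> \<bar>d i\<bar> < B" "(\<Sum>i<n. B ^ (n - i) * d i) = 0" "i < n"
  shows "d i = 0"
  using assms(2-)
proof (induction n arbitrary: i)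
  case (Suc n)
  have "(\<Sum>i<Suc n. B ^ (Suc n - i) * d i) = B * ((\<Sum>i<n. B ^ (n - i) * d i) + d n)"
  proof -
    have "(\<Sum>i<n. B ^ (Suc n - i) * d i) = (\<Sum>i<n. B * (B ^ (n - i) * d i))"
      by (rule sum.cong) (auto simp: Suc_diff_le)
    then show ?thesis by (simp add: sum_distrib_left distrib_left)
  qed
  then have eq: "(\<Sum>i<n. B ^ (n - i) * d i) + d n = 0" using Suc.prems(2) assms(1) by simp
  have "B dvd (\<Sum>i<n. B ^ (n - i) * d i)"
    by (intro dvd_sum dvd_mult2 dvd_power) auto
  then have "B dvd d n" using eq by (metis add.commute dvd_add_right_iff dvd_0_right)
  then have dn: "d n = 0" using Suc.prems(1)[of n] zdvd_not_zless[of "\<bar>d n\<bar>" B] by force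
  then have "(\<Sum>i<n. B ^ (n - i) * d i) = 0" using eq by simp
  then show ?case using Suc.IH[of i] Suc.prems dn by (cases "i = n") auto
qed simp

text \<open>Entries bounded by r in absolute value differ by at most 2r, which is below the base.
  The summand 2 keeps the base above 1 even for r = 0, so the weights decrease strictly.\<close>

definition base_weights :: "nat \<Rightarrow> nat \<Rightarrow> nat \<Rightarrow> nat" where
  "base_weights n r i = (2 * r + 2) ^ (n - i)"

lemma base_weights_pos: "base_weights n r i > 0"
  by (simp add: base_weights_def)

lemma base_weights_less: "i < j \<Longrightarrow> j < n \<Longrightarrow> base_weights n r j < base_weights n r i"
  by (auto simp: base_weights_def intro!: power_strict_increasing)

text \<open>On exponents of size at most r the height is injective by the uniqueness of digits, so
  its maximum is attained only once, and \<open>partition_of_max\<close> makes the maximizer a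
  partition.\<close>

lemma leading_exponent:
  assumes inv: "in_vars n p" "weyl_invariant n p" and "p \<noteq> 0"
    and bound: "\<And>e. e \<in> Poly_Mapping.keys p \<Longrightarrow> (\<Sum>i<n. nat \<bar>e i\<bar>) \<le> r"
  defines "N \<equiv> base_weights n r"
  obtains \<mu> where "is_partition n \<mu>" "(\<lambda>i. int (\<mu> i)) \<in> Poly_Mapping.keys p"
    "\<And>e. e \<in> Poly_Mapping.keys p \<Longrightarrow> e \<noteq> (\<lambda>i. int (\<mu> i)) \<Longrightarrow>
      height n N e < height n N (\<lambda>i. int (\<mu> i))"
proof -
  have "Poly_Mapping.keys p \<noteq> {}" using assms(3) by simp
  then have "Max (height n N ` Poly_Mapping.keys p) \<in> height n N ` Poly_Mapping.keys p"
    by (intro Max_in) auto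
  then obtain e0 where max: "Max (height n N ` Poly_Mapping.keys p) = height n N e0" and e0: "e0 \<in> Poly_Mapping.keys p"
    by (rule imageE)
  have max: "height n N e \<le> height n N e0" if "e \<in> Poly_Mapping.keys p" for e
    using that unfolding max[symmetric] by (intro Max_ge) auto
  have small: "\<bar>e i\<bar> \<le> int r" if "e \<in> Poly_Mapping.keys p" "i < n" for e i
  proof -
    have "nat \<bar>e i\<bar> \<le> (\<Sum>i<n. nat \<bar>e i\<bar>)"
      using that(2) by (intro member_le_sum) auto
    then show ?thesis using bound[OF that(1)] by linarith
  qed
  have strict: "height n N e < height n N e0" if e: "e \<in> Poly_Mapping.keys p" "e \<noteq> e0" for e
  proof (rule ccontr)
    assume "\<not> height n N e < height n N e0"
    then have "height n N e = height n N e0" using max[OF e(1)] by simp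
    then have eq: "(\<Sum>i<n. (2 * int r + 2) ^ (n - i) * (e i - e0 i)) = 0"
      unfolding height_def by (simp add: N_def base_weights_def right_diff_distrib sum_subtractf add.commute)
    have "e i - e0 i = 0" if "i < n" for i
    proof (rule base_expansion_eq_0[of "2 * int r + 2" n "\<lambda>i. e i - e0 i"])
      show "\<bar>e j - e0 j\<bar> < 2 * int r + 2" if "j < n" for j
        using small[OF e(1) that] small[OF e0 that] by linarith
    qed (use that eq in auto)
    moreover have "e i = 0" "e0 i = 0" if "i \<ge> n" for i
      using inv(1) e(1) e0 that by (auto simp: in_vars_def)
    ultimately have "e = e0" by (metis eq_iff_diff_eq_0 ext linorder_not_less)
    then show False using e(2) by simp
  qed
  note part = partition_of_max[OF base_weights_pos base_weights_less inv e0 max[unfolded N_def]]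
  show ?thesis
    by (rule that[of "\<lambda>i. nat (e0 i)"]) (use part e0 strict in auto)
qed

section \<open>Uniqueness of the one-row eigenfunction\<close>

lemma koornwinder_op_diff:
  assumes "q \<noteq> 0" "regular_point n q x"
  shows "koornwinder_op n (- csqrt b) (csqrt b) (- (csqrt q * csqrt b)) (csqrt q * csqrt b) q t (leval n (p - p')) x =
    koornwinder_op n (- csqrt b) (csqrt b) (- (csqrt q * csqrt b)) (csqrt q * csqrt b) q t (leval n p) x -
    koornwinder_op n (- csqrt b) (csqrt b) (- (csqrt q * csqrt b)) (csqrt q * csqrt b) q t (leval n p') x"
  unfolding koornwinder_op_C[OF assms] leval_diff diff_divide_distrib[symmetric] sum_subtractf[symmetric]
  by (intro arg_cong2[where f = "(/)"] sum.cong) (simp_all add: algebra_simps)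

lemma one_row_exponent_orbit: "(\<lambda>i. int (one_row r i)) \<in> weyl_orbit n (one_row r)"
  unfolding weyl_orbit_def mem_Collect_eq
  by (intro exI[of _ id] exI[of _ "\<lambda>_. 1"]) (auto simp: permutes_id)

lemma sum_abs_weyl_orbit:
  assumes "e \<in> weyl_orbit n \<nu>"
  shows "(\<Sum>i<n. nat \<bar>e i\<bar>) = (\<Sum>i<n. \<nu> i)"
proof -
  obtain \<sigma> s where \<sigma>: "\<sigma> permutes {..<n}" and s: "\<forall>i. s i \<in> {1, - 1 :: int}"
    and e: "e = (\<lambda>i. s i * int (\<nu> (\<sigma> i)))"
    using assms by (auto simp: weyl_orbit_def)
  have "nat \<bar>e i\<bar> = \<nu> (\<sigma> i)" for i
    using s[rule_format, of i] by (auto simp: e)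
  then show ?thesis using sum.permute[OF \<sigma>, of \<nu>] by (simp add: o_def)
qed

text \<open>All parts of \<nu> except the one at \<sigma>(0) vanish. If that one is not in front,
  the front part is 0, monotonicity makes all parts 0, and r = 0.\<close>

lemma partition_eq_one_row:
  assumes \<nu>: "is_partition n \<nu>" and e: "(\<lambda>i. int (one_row r i)) \<in> weyl_orbit n \<nu>"
  shows "\<nu> = one_row r"
proof -
  obtain \<sigma> s where \<sigma>: "\<sigma> permutes {..<n}" and s: "\<forall>i. s i \<in> {1, - 1 :: int}"
    and eq: "(\<lambda>i. int (one_row r i)) = (\<lambda>i. s i * int (\<nu> (\<sigma> i)))"
    using e by (auto simp: weyl_orbit_def)
  have val: "\<nu> (\<sigma> i) = one_row r i" for i
    using fun_cong[OF eq, of i] s[rule_format, of i] by auto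
  have anti: "\<nu> j \<le> \<nu> i" if "i \<le> j" for i j
    using \<nu> that by (auto simp: is_partition_def antimono_def)
  have out: "\<nu> k = 0" if "k \<noteq> \<sigma> 0" for k
  proof -
    obtain i where i: "k = \<sigma> i" using permutes_surj[OF \<sigma>] by (metis surjD)
    with that have "i \<noteq> 0" by metis
    then show ?thesis using val[of i] i by (simp add: one_row_def)
  qed
  have top: "\<nu> (\<sigma> 0) = r" using val[of 0] by (simp add: one_row_def)
  show ?thesis
  proof (cases "\<sigma> 0 = 0")
    case True
    then show ?thesis using out top by (auto simp: one_row_def fun_eq_iff)
  next
    case False
    then have "\<nu> 0 = 0" using out[of 0] by auto
    then have "\<nu> k = 0" for k using anti[of 0 k] by simp
    then show ?thesis using top by (auto simp: one_row_def fun_eq_iff)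
  qed
qed

lemma koornwinder_one_row_keys:
  assumes n: "n \<ge> 1" and K: "is_koornwinder n a b c d q t (one_row r) K"
  shows "\<And>e. e \<in> Poly_Mapping.keys K \<Longrightarrow> (\<Sum>i<n. nat \<bar>e i\<bar>) \<le> r"
    and "Poly_Mapping.lookup K (\<lambda>i. int (one_row r i)) = 1"
proof -
  have lower: "\<exists>\<nu>. is_partition n \<nu> \<and> dominance_less n \<nu> (one_row r) \<and> e \<in> weyl_orbit n \<nu>"
    if "Poly_Mapping.lookup K e \<noteq> Poly_Mapping.lookup (orbit_sum n (one_row r)) e" for e
  proof -
    have "e \<in> Poly_Mapping.keys (K - orbit_sum n (one_row r))"
      using that by (simp add: in_keys_iff lookup_minus)
    then show ?thesis using K unfolding is_koornwinder_def by blast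
  qed
  have orb: "Poly_Mapping.lookup (orbit_sum n (one_row r)) e = (if e \<in> weyl_orbit n (one_row r) then 1 else 0)" for e
    by (rule lookup_orbit_sum[OF finite_weyl_orbit_one_row[OF n]])
  have row: "(\<Sum>i<n. one_row r i) = r" using n by (simp add: sum_one_row)
  show "(\<Sum>i<n. nat \<bar>e i\<bar>) \<le> r" if e: "e \<in> Poly_Mapping.keys K" for e
  proof (cases "e \<in> weyl_orbit n (one_row r)")
    case True
    then show ?thesis using sum_abs_weyl_orbit row by simp
  next
    case False
    then have "Poly_Mapping.lookup K e \<noteq> Poly_Mapping.lookup (orbit_sum n (one_row r)) e"
      using e by (simp add: orb in_keys_iff)
    then obtain \<nu> where "dominance_less n \<nu> (one_row r)" "e \<in> weyl_orbit n \<nu>"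
      using lower by blast
    then show ?thesis using sum_abs_weyl_orbit[of e n \<nu>] row by (auto simp: dominance_less_def)
  qed
  show "Poly_Mapping.lookup K (\<lambda>i. int (one_row r i)) = 1"
  proof (rule ccontr)
    assume "Poly_Mapping.lookup K (\<lambda>i. int (one_row r i)) \<noteq> 1"
    then have "Poly_Mapping.lookup K (\<lambda>i. int (one_row r i)) \<noteq> Poly_Mapping.lookup (orbit_sum n (one_row r)) (\<lambda>i. int (one_row r i))"
      by (simp add: orb one_row_exponent_orbit)
    then obtain \<nu> where "is_partition n \<nu>" "dominance_less n \<nu> (one_row r)" "(\<lambda>i. int (one_row r i)) \<in> weyl_orbit n \<nu>"
      using lower by blast
    then show False using partition_eq_one_row by (auto simp: dominance_less_def)
  qed
qed

text \<open>The definition only asserts that some eigenvalue exists. It can be identified because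
  (r) has the greatest possible height among exponents of size at most r: all of the size sits at
  the largest weight.\<close>

lemma koornwinder_one_row_eigenvalue:
  assumes n: "n \<ge> 1" and nz: "b \<noteq> 0" "q \<noteq> 0" "t \<noteq> 0"
    and K: "is_koornwinder n (- csqrt b) (csqrt b) (- (csqrt q * csqrt b)) (csqrt q * csqrt b) q t (one_row r) K"
    and E: "\<And>x. regular_point n q x \<Longrightarrow>
      koornwinder_op n (- csqrt b) (csqrt b) (- (csqrt q * csqrt b)) (csqrt q * csqrt b) q t (leval n K) x = E * leval n K x"
  shows "E = b / csqrt (b\<^sup>2) * eigenvalue_C n b q t (one_row r)"
proof -
  let ?N = "base_weights n r"
  let ?e = "\<lambda>i. int (one_row r i)"
  note keys = koornwinder_one_row_keys[OF n K]
  have e_key: "?e \<in> Poly_Mapping.keys K" using keys(2) by (simp add: in_keys_iff)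
  have inv: "in_vars n K" "weyl_invariant n K" using K by (auto simp: is_koornwinder_def)
  have "K \<noteq> 0" using e_key by auto
  from leading_exponent[OF inv this keys(1)] obtain \<mu> where \<mu>: "is_partition n \<mu>" "(\<lambda>i. int (\<mu> i)) \<in> Poly_Mapping.keys K"
    and max: "\<And>e. e \<in> Poly_Mapping.keys K \<Longrightarrow> e \<noteq> (\<lambda>i. int (\<mu> i)) \<Longrightarrow> height n ?N e < height n ?N (\<lambda>i. int (\<mu> i))"
    by blast
  have "height n ?N (\<lambda>i. int (\<mu> i)) \<le> int (?N 0) * int r"
  proof -
    have "height n ?N (\<lambda>i. int (\<mu> i)) \<le> (\<Sum>i<n. int (?N 0) * int (\<mu> i))"
      unfolding height_def
    proof (intro sum_mono mult_right_mono)
      fix i assume "i \<in> {..<n}"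
      then show "int (?N i) \<le> int (?N 0)" using base_weights_less[of 0 i n r] by (cases "i = 0") auto
    qed simp
    also have "\<dots> = int (?N 0) * int (\<Sum>i<n. \<mu> i)" by (simp add: sum_distrib_left)
    also have "\<dots> \<le> int (?N 0) * int r" using keys(1)[OF \<mu>(2)]
      by (intro mult_left_mono) (simp_all del: of_nat_sum)
    finally show ?thesis .
  qed
  moreover have "height n ?N ?e = int (?N 0) * int r"
  proof -
    have "height n ?N ?e = (\<Sum>i<n. if i = 0 then int (?N 0) * int r else 0)"
      unfolding height_def by (rule sum.cong) (auto simp: one_row_def)
    then show ?thesis using n by simp
  qed
  ultimately have "?e = (\<lambda>i. int (\<mu> i))" using max[OF e_key] by fastforce
  then have "\<mu> = one_row r" by (auto simp: fun_eq_iff)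
  with eigenvalue_of_leading_exponent[OF base_weights_pos base_weights_less n nz \<mu>(2) max _ E] show ?thesis by simp
qed

text \<open>Two solutions have the same eigenvalue and the same coefficient 1 at (r). A nonzero
  difference would have a strictly smaller partition as leading exponent and yet the eigenvalue of
  (r), against genericity.\<close>

lemma koornwinder_one_row_unique:
  assumes n: "n \<ge> 1" and nz: "b \<noteq> 0" "q \<noteq> 0" "t \<noteq> 0"
    and gen: "\<And>\<nu>. is_partition n \<nu> \<Longrightarrow> dominance_less n \<nu> (one_row r) \<Longrightarrow>
      eigenvalue_C n b q t \<nu> \<noteq> eigenvalue_C n b q t (one_row r)"
    and K: "is_koornwinder n (- csqrt b) (csqrt b) (- (csqrt q * csqrt b)) (csqrt q * csqrt b) q t (one_row r) K"
    and K': "is_koornwinder n (- csqrt b) (csqrt b) (- (csqrt q * csqrt b)) (csqrt q * csqrt b) q t (one_row r) K'"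
  shows "K = K'"
proof (rule ccontr)
  assume "K \<noteq> K'"
  let ?D = "koornwinder_op n (- csqrt b) (csqrt b) (- (csqrt q * csqrt b)) (csqrt q * csqrt b) q t"
  define E where "E = b / csqrt (b\<^sup>2) * eigenvalue_C n b q t (one_row r)"
  have eig: "?D (leval n L) x = E * leval n L x"
    if "is_koornwinder n (- csqrt b) (csqrt b) (- (csqrt q * csqrt b)) (csqrt q * csqrt b) q t (one_row r) L" "regular_point n q x" for L x
    using koornwinder_one_row_eigenvalue[OF n nz that(1)] that unfolding is_koornwinder_def E_def by blast
  define \<Delta> where "\<Delta> = K - K'"
  have eig\<Delta>: "?D (leval n \<Delta>) x = E * leval n \<Delta> x" if "regular_point n q x" for x
    unfolding \<Delta>_def koornwinder_op_diff[OF nz(2) that] eig[OF K that] eig[OF K' that] leval_diff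
    by (simp add: algebra_simps)
  have keys_sub: "Poly_Mapping.keys \<Delta> \<subseteq> Poly_Mapping.keys K \<union> Poly_Mapping.keys K'"
    unfolding \<Delta>_def by (rule keys_diff)
  have inv: "in_vars n \<Delta>" "weyl_invariant n \<Delta>"
    using K K' keys_sub by (auto simp: is_koornwinder_def in_vars_def weyl_invariant_def \<Delta>_def lookup_minus)
  have bound: "(\<Sum>i<n. nat \<bar>e i\<bar>) \<le> r" if "e \<in> Poly_Mapping.keys \<Delta>" for e
    using that keys_sub koornwinder_one_row_keys(1)[OF n K] koornwinder_one_row_keys(1)[OF n K'] by blast
  have "\<Delta> \<noteq> 0" using \<open>K \<noteq> K'\<close> by (simp add: \<Delta>_def)
  from leading_exponent[OF inv \<open>\<Delta> \<noteq> 0\<close> bound] obtain \<mu> where \<mu>: "is_partition n \<mu>" "(\<lambda>i. int (\<mu> i)) \<in> Poly_Mapping.keys \<Delta>"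
    and max: "\<And>e. e \<in> Poly_Mapping.keys \<Delta> \<Longrightarrow> e \<noteq> (\<lambda>i. int (\<mu> i)) \<Longrightarrow> height n (base_weights n r) e < height n (base_weights n r) (\<lambda>i. int (\<mu> i))"
    by blast
  have "E = b / csqrt (b\<^sup>2) * eigenvalue_C n b q t \<mu>"
    using eigenvalue_of_leading_exponent[OF base_weights_pos base_weights_less n nz \<mu>(2) max _ eig\<Delta>] by simp
  then have "eigenvalue_C n b q t \<mu> = eigenvalue_C n b q t (one_row r)"
    using nz by (simp add: E_def)
  moreover have "\<mu> \<noteq> one_row r"
    using \<mu>(2) koornwinder_one_row_keys(2)[OF n K] koornwinder_one_row_keys(2)[OF n K']
    by (auto simp: \<Delta>_def in_keys_iff lookup_minus)
  then have "dominance_less n \<mu> (one_row r)"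
    by (rule dominance_less_one_rowI) (use bound[OF \<mu>(2)] in simp)
  ultimately show False using gen[OF \<mu>(1)] by blast
qed

theorem theorem5p3:
  fixes n r :: nat and b q t :: complex and x :: "nat \<Rightarrow> complex"
  assumes "n \<ge> 1"
    and "norm q < 1"
    and "generic_params n r b q t"
    and "\<And>i. i < n \<Longrightarrow> x i \<noteq> 0"
  shows "leval n (macdonald_C n b q t (one_row r)) x =
    qpoch q q r / qpoch t q r *
    (\<Sum>j\<le>r div 2.
       macdonald_G n q t (r - 2 * j) x *
       (qpoch (b / t) q j * qpoch (t powi (- int n) * q powi (- int r)) q j /
        (qpoch q q j * qpoch (t powi (1 - int n) * q powi (1 - int r) / b) q j)) *
       ((1 - t powi (- int n) * q powi (2 * int j - int r)) /
        (1 - t powi (- int n) * q powi (- int r))) *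
       (t\<^sup>2 / (q * b)) ^ j)"
proof -
  have nz: "b \<noteq> 0" "q \<noteq> 0" "t \<noteq> 0" and t_nz: "qpoch t q r \<noteq> 0" and tq: "t ^ n * q ^ r \<noteq> 1"
    and den: "qpoch (t powi (1 - int n) * q powi (1 - int r) / b) q (r div 2) \<noteq> 0"
    and gen: "\<And>\<nu>. is_partition n \<nu> \<Longrightarrow> dominance_less n \<nu> (one_row r) \<Longrightarrow>
      eigenvalue_C n b q t \<nu> \<noteq> eigenvalue_C n b q t (one_row r)"
    using assms(3) unfolding generic_params_def by auto
  \<comment> \<open>This is the value that \<open>\<beta> * t * q ^ r * s = b\<close> prescribes for
    \<open>\<beta> = b * t ^ (n - 1)\<close>; genericity keeps it different from 1.\<close>
  define s where "s = t powi (- int n) * q powi (- int r)"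
  have s: "t ^ n * q ^ r * s = 1" using nz by (simp add: s_def power_int_minus field_simps)
  have s1: "s \<noteq> 1" using s tq by auto
  have s_shift: "t powi (1 - int n) * q powi (1 - int r) / b = s * t * q / b"
    using nz by (simp add: s_def power_int_diff power_int_minus field_simps)
  have s_pow: "t powi (- int n) * q powi (2 * int j - int r) = s * q ^ (2 * j)" for j
  proof -
    have "q powi (2 * int j - int r) = q powi (- int r + int (2 * j))" by simp
    also have "\<dots> = q powi (- int r) * q ^ (2 * j)"
      by (subst power_int_add) (use nz in \<open>simp_all only: power_int_of_nat\<close>, simp)
    finally show ?thesis by (simp add: s_def)
  qed
  define a where "a j = qpoch q q r / qpoch t q r * (qpoch (b / t) q j * qpoch s q j /
      (qpoch q q j * qpoch (s * t * q / b) q j) * ((1 - s * q ^ (2 * j)) / (1 - s)) * (t\<^sup>2 / (q * b)) ^ j)" for j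
  note exist = row_laurent_is_koornwinder[OF assms(1,2) nz t_nz s s1 den[unfolded s_shift] a_def]
  \<comment> \<open>The definite description is resolved by exhibiting the explicit eigenfunction
    and comparing every other candidate with it.\<close>
  have "macdonald_C n b q t (one_row r) = row_laurent n q t r a"
    unfolding macdonald_C_def koornwinder_def
    by (rule the_equality, rule exist) (rule koornwinder_one_row_unique[OF assms(1) nz gen _ exist])
  then have "leval n (macdonald_C n b q t (one_row r)) x = (\<Sum>j\<le>r div 2. a j * macdonald_G n q t (r - 2 * j) x)"
    by (simp only: leval_row_laurent[OF assms(4)] macdonald_G_eq_nth[OF assms(2)])
  then show ?thesis
    unfolding s_pow s_shift s_def[symmetric] a_def sum_distrib_left by (simp add: mult_ac)
qed

end
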